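(* There is a deterministic black-box identity testing algorithm for $\Sigma\Pi\Sigma(k,d)$ circuits in $n$ variables (i.e., an algorithm that, given only the ability to evaluate the polynomial computed by such a circuit at chosen points, correctly decides whether the polynomial is identically zero) running in time $\mathrm{poly}(n,d^{k^3\log d})$.
   Context: A $\Sigma\Pi\Sigma(k,d)$ circuit over a field $\mathbb{F}$ in variables $x_1,\dots,x_n$ computes a polynomial of the form $\sum_{i=1}^k \prod_{j=1}^{d}\ell_{i,j}$ where each $\ell_{i,j}$ is a linear polynomial over $\mathbb{F}$ (edges may carry field constants); $k$ is the top fanin and $d$ the degree. *)

theory Defs
  imports
    Complex_Main
    "HOL-Library.Poly_Mapping"
    "HOL-Computational_Algebra.Computational_Algebra"
begin

section \<open>Multivariate polynomials and depth-3 circuits\<close>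

text \<open>Formal polynomials in variables indexed by the naturals: a finitely supported map from
  exponent vectors to coefficients, with the convolution product of \<^theory>\<open>HOL-Library.Poly_Mapping\<close>.\<close>

type_synonym 'a mpoly = "(nat \<Rightarrow>\<^sub>0 nat) \<Rightarrow>\<^sub>0 'a"

definition mconst :: "'a::field \<Rightarrow> 'a mpoly" where
  "mconst c = Poly_Mapping.single 0 c"

definition mvar :: "nat \<Rightarrow> 'a::field mpoly" where
  "mvar i = Poly_Mapping.single (Poly_Mapping.single i 1) 1"

text \<open>A linear polynomial may have a constant term (and may be constant). The variables
  \<open>x\<^sub>1, \<dots>, x\<^sub>n\<close> are numbered \<open>0, \<dots>, n - 1\<close>.\<close>

definition linear_mpoly :: "nat \<Rightarrow> 'a::field mpoly \<Rightarrow> bool" where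
  "linear_mpoly n l \<longleftrightarrow> (\<exists>c a. l = mconst c + (\<Sum>i<n. mconst (a i) * mvar i))"

text \<open>Field constants on the edges are absorbed by the linear polynomials, since \<open>d \<ge> 1\<close> wherever
  this is used.\<close>

definition sps_computes :: "nat \<Rightarrow> nat \<Rightarrow> nat \<Rightarrow> 'a::field mpoly \<Rightarrow> bool" where
  "sps_computes k d n p \<longleftrightarrow>
     (\<exists>l. (\<forall>i<k. \<forall>j<d. linear_mpoly n (l i j)) \<and> p = (\<Sum>i<k. \<Prod>j<d. l i j))"


section \<open>Black boxes\<close>

definition msubst :: "'a::field mpoly \<Rightarrow> (nat \<Rightarrow> 'a poly) \<Rightarrow> 'a poly" where
  "msubst p a = (\<Sum>m\<in>Poly_Mapping.keys p.
     smult (Poly_Mapping.lookup p m)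
       (\<Prod>i\<in>Poly_Mapping.keys m. a i ^ Poly_Mapping.lookup m i))"

text \<open>A black box takes an irreducible modulus \<open>f\<close> and a point with coordinates in the extension
  field \<open>F[y]/(f)\<close>, whose elements are represented by residues, and returns the value at that point.
  For \<open>f\<close> of degree 1 this is evaluation at a point over \<open>F\<close> itself.\<close>

type_synonym 'a blackbox = "'a poly \<Rightarrow> (nat \<Rightarrow> 'a poly) \<Rightarrow> 'a poly"

definition blackbox_of :: "'a::field mpoly \<Rightarrow> 'a blackbox" where
  "blackbox_of p f a = msubst p a mod f"

text \<open>Over a finite field a nonzero polynomial can vanish at all points of the field, so there (and
  only there) points in proper extension fields may be queried.\<close>

definition legal_modulus :: "'a::field poly \<Rightarrow> nat \<Rightarrow> bool" where
  "legal_modulus f r \<longleftrightarrow>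
     irreducible f \<and> degree f = r \<and> (infinite (UNIV :: 'a set) \<longrightarrow> r = 1)"


section \<open>The machine model\<close>

text \<open>Programs of a random access machine with named arrays of naturals and named arrays of field
  elements. Programs contain no field constants: besides the field operations, the only source of
  field elements is an enumeration of distinct elements of the field, which the machine is given
  (see \<open>FEnum\<close> and \<open>enumerates_field\<close>). On naturals there is only addition and truncated
  subtraction, so that numbers have at most linearly many bits in the running time and unit cost is
  realistic. Field operations and field equality tests have unit cost.\<close>

type_synonym vname = string

datatype nexp =
    NConst nat
  | NArr vname nexp
  | NAdd nexp nexp
  | NSub nexp nexp

datatype fexp =
    FZero
  | FOne
  | FEnum nexp
  | FArr vname nexp
  | FAdd fexp fexp
  | FSub fexp fexp
  | FMul fexp fexp
  | FDiv fexp fexp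

datatype bexp =
    NLess nexp nexp
  | NEq nexp nexp
  | FEq fexp fexp
  | BNot bexp
  | BAnd bexp bexp

text \<open>\<open>Query R G r P\<close> queries the black box: the modulus has degree \<open>r\<close> and its coefficients are
  \<open>G[0], \<dots>, G[r]\<close>; coefficient \<open>j\<close> of coordinate \<open>i\<close> of the point is \<open>P[i * r + j]\<close>; the
  coefficients of the answer are stored in \<open>R[0], \<dots>, R[r - 1]\<close>.\<close>

datatype com =
    Skip
  | NAssign vname nexp nexp
  | FAssign vname nexp fexp
  | Seq com com
  | Cond bexp com com
  | While bexp com
  | Query vname vname nexp vname

type_synonym 'a state = "(vname \<Rightarrow> nat \<Rightarrow> nat) \<times> (vname \<Rightarrow> nat \<Rightarrow> 'a)"

fun nval :: "nexp \<Rightarrow> 'a state \<Rightarrow> nat" where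
  "nval (NConst c) s = c"
| "nval (NArr x a) s = fst s x (nval a s)"
| "nval (NAdd a b) s = nval a s + nval b s"
| "nval (NSub a b) s = nval a s - nval b s"

fun fval :: "(nat \<Rightarrow> 'a::field) \<Rightarrow> fexp \<Rightarrow> 'a state \<Rightarrow> 'a" where
  "fval e FZero s = 0"
| "fval e FOne s = 1"
| "fval e (FEnum a) s = e (nval a s)"
| "fval e (FArr x a) s = snd s x (nval a s)"
| "fval e (FAdd a b) s = fval e a s + fval e b s"
| "fval e (FSub a b) s = fval e a s - fval e b s"
| "fval e (FMul a b) s = fval e a s * fval e b s"
| "fval e (FDiv a b) s = fval e a s / fval e b s"

fun bval :: "(nat \<Rightarrow> 'a::field) \<Rightarrow> bexp \<Rightarrow> 'a state \<Rightarrow> bool" where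
  "bval e (NLess a b) s \<longleftrightarrow> nval a s < nval b s"
| "bval e (NEq a b) s \<longleftrightarrow> nval a s = nval b s"
| "bval e (FEq a b) s \<longleftrightarrow> fval e a s = fval e b s"
| "bval e (BNot b) s \<longleftrightarrow> \<not> bval e b s"
| "bval e (BAnd b c) s \<longleftrightarrow> bval e b s \<and> bval e c s"

definition array_poly :: "(nat \<Rightarrow> 'a::field) \<Rightarrow> nat \<Rightarrow> nat \<Rightarrow> 'a poly" where
  "array_poly A start len = (\<Sum>j<len. monom (A (start + j)) j)"

definition array_point :: "(nat \<Rightarrow> 'a::field) \<Rightarrow> nat \<Rightarrow> nat \<Rightarrow> nat \<Rightarrow> 'a poly" where
  "array_point A n r i = (if i < n then array_poly A (i * r) r else 0)"

definition nupdate :: "vname \<Rightarrow> nat \<Rightarrow> nat \<Rightarrow> 'a state \<Rightarrow> 'a state" where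
  "nupdate x i v s = ((fst s)(x := (fst s x)(i := v)), snd s)"

definition fupdate :: "vname \<Rightarrow> nat \<Rightarrow> 'a \<Rightarrow> 'a state \<Rightarrow> 'a state" where
  "fupdate x i v s = (fst s, (snd s)(x := (snd s x)(i := v)))"

definition store_answer :: "vname \<Rightarrow> nat \<Rightarrow> 'a::field poly \<Rightarrow> 'a state \<Rightarrow> 'a state" where
  "store_answer R r v s =
     (fst s, (snd s)(R := (\<lambda>j. if j < r then coeff v j else snd s R j)))"

text \<open>\<open>exec e n bb c s t s'\<close>: with field enumeration \<open>e\<close> and black box \<open>bb\<close> in \<open>n\<close> variables,
  \<open>c\<close> started in \<open>s\<close> terminates in \<open>s'\<close> after \<open>t\<close> steps. Expressions have a size fixed by the
  program, so their evaluation is charged as one step. A query is charged for all the field elements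
  it transmits. A query with an illegal modulus has no execution.\<close>

inductive exec ::
  "(nat \<Rightarrow> 'a::field) \<Rightarrow> nat \<Rightarrow> 'a blackbox \<Rightarrow> com \<Rightarrow> 'a state \<Rightarrow> nat \<Rightarrow> 'a state \<Rightarrow> bool"
  for e :: "nat \<Rightarrow> 'a::field" and n :: nat and bb :: "'a blackbox"
where
  Skip: "exec e n bb Skip s 1 s"
| NAssign: "exec e n bb (NAssign x a b) s 1 (nupdate x (nval a s) (nval b s) s)"
| FAssign: "exec e n bb (FAssign x a b) s 1 (fupdate x (nval a s) (fval e b s) s)"
| Seq: "exec e n bb c1 s t1 s' \<Longrightarrow> exec e n bb c2 s' t2 s'' \<Longrightarrow>
    exec e n bb (Seq c1 c2) s (t1 + t2) s''"
| CondTrue: "bval e b s \<Longrightarrow> exec e n bb c1 s t s' \<Longrightarrow> exec e n bb (Cond b c1 c2) s (t + 1) s'"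
| CondFalse: "\<not> bval e b s \<Longrightarrow> exec e n bb c2 s t s' \<Longrightarrow> exec e n bb (Cond b c1 c2) s (t + 1) s'"
| WhileFalse: "\<not> bval e b s \<Longrightarrow> exec e n bb (While b c) s 1 s"
| WhileTrue: "bval e b s \<Longrightarrow> exec e n bb c s t1 s' \<Longrightarrow> exec e n bb (While b c) s' t2 s'' \<Longrightarrow>
    exec e n bb (While b c) s (t1 + t2 + 1) s''"
| Query: "r = nval a s \<Longrightarrow> f = array_poly (snd s G) 0 (r + 1) \<Longrightarrow> legal_modulus f r \<Longrightarrow>
    exec e n bb (Query R G a P) s ((n + 2) * r + 1)
      (store_answer R r (bb f (array_point (snd s P) n r)) s)"

inductive_cases exec_SkipE: "exec e n bb Skip s t s'"
inductive_cases exec_NAssignE: "exec e n bb (NAssign x a b) s t s'"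
inductive_cases exec_FAssignE: "exec e n bb (FAssign x a b) s t s'"
inductive_cases exec_SeqE: "exec e n bb (Seq c1 c2) s t s'"
inductive_cases exec_CondE: "exec e n bb (Cond b c1 c2) s t s'"
inductive_cases exec_WhileE: "exec e n bb (While b c) s t s'"
inductive_cases exec_QueryE: "exec e n bb (Query R G a P) s t s'"

lemma exec_deterministic:
  "exec e n bb c s t s' \<Longrightarrow> exec e n bb c s u s'' \<Longrightarrow> u = t \<and> s'' = s'"
proof (induction arbitrary: u s'' rule: exec.induct)
  case (Skip s)
  then show ?case by (rule exec_SkipE) simp
next
  case (NAssign x a b s)
  then show ?case by (rule exec_NAssignE) simp
next
  case (FAssign x a b s)
  then show ?case by (rule exec_FAssignE) simp
next
  case (Seq c1 s t1 s' c2 t2 s2)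
  from Seq.prems show ?case by (rule exec_SeqE) (metis Seq.IH)
next
  case (CondTrue b s c1 t s' c2)
  from CondTrue.prems show ?case by (rule exec_CondE) (auto dest: CondTrue.IH simp: CondTrue.hyps(1))
next
  case (CondFalse b s c2 t s' c1)
  from CondFalse.prems show ?case by (rule exec_CondE) (auto dest: CondFalse.IH simp: CondFalse.hyps(1))
next
  case (WhileFalse b s c)
  from WhileFalse.prems show ?case by (rule exec_WhileE) (simp_all add: WhileFalse.hyps)
next
  case (WhileTrue b s c t1 s' t2 s2)
  from WhileTrue.prems show ?case
  proof (rule exec_WhileE)
    fix t1' v t2'
    assume u: "u = Suc (t1' + t2')" and 1: "exec e n bb c s t1' v"
      and 2: "exec e n bb (While b c) v t2' s''"
    from WhileTrue.IH(1)[OF 1] have "t1' = t1" "v = s'" by simp_all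
    with WhileTrue.IH(2)[of t2' s''] 2 u show ?thesis by simp
  qed (simp_all add: WhileTrue.hyps(1))
next
  case (Query r a s f G R P)
  from Query.prems show ?case by (rule exec_QueryE) (simp add: Query.hyps)
qed

definition enumerates_field :: "(nat \<Rightarrow> 'a::field) \<Rightarrow> bool" where
  "enumerates_field e \<longleftrightarrow>
     (if finite (UNIV :: 'a set) then bij_betw e {..<card (UNIV :: 'a set)} UNIV else inj e)"

definition initial_state :: "nat \<Rightarrow> nat \<Rightarrow> nat \<Rightarrow> 'a::field state" where
  "initial_state n k d =
     ((\<lambda>x i. if x = ''n'' then n else if x = ''k'' then k else if x = ''d'' then d else 0),
      (\<lambda>x i. 0))"

definition verdict :: "'a state \<Rightarrow> nat" where
  "verdict s = fst s ''out'' 0"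

end

theory Submission
  imports Defs
begin

text \<open>The test uses a single univariate restriction: for \<open>M = d n k + 1\<close>, the variable \<open>x\<^sub>l\<close> is replaced by
  the sum over \<open>1 \<le> j \<le> k\<close> of the powers of \<open>z\<close> with exponents \<open>l j + M (d + 1) ^ (j - 1)\<close>. The degree is
  polynomial in \<open>n\<close> and \<open>d\<^sup>k\<close>, and nonzeroness is preserved by an ideal argument in the style of Saxena
  and Seshadhri.

  Homogenize the circuit to \<open>C = T\<^sub>1 + \<dots> + T\<^sub>k\<close> and start with the ideal \<open>I = 0\<close>. If \<open>C\<close> does not lie in
  \<open>I + (T\<^sub>1)\<close>, let \<open>S\<close> be a minimal subproduct of \<open>T\<^sub>1\<close> such that \<open>C\<close> does not lie in \<open>I + (S)\<close>, and replace
  \<open>I\<close> by \<open>I + (S)\<close>: the factors of \<open>S\<close> span only one direction modulo the forms in the generators of \<open>I\<close>,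
  and \<open>T\<^sub>1\<close> disappears. Otherwise homogeneity gives \<open>C = \<alpha> T\<^sub>1\<close> modulo \<open>I\<close>, and whether the product \<open>T\<^sub>1\<close>
  lies in \<open>I\<close> depends only on linear relations between few forms. So a linear projection that preserves
  the independence of up to \<open>k\<close> forms of the circuit preserves nonzeroness. Over \<open>F(z)\<close> the projection
  \<open>x\<^sub>l \<mapsto> \<Sum>\<^sub>j z\<^bsup>l j\<^esup> y\<^sub>j\<close> does so, by comparison of degrees in \<open>z\<close>, and Kronecker substitution for the
  \<open>y\<^sub>j\<close> makes the result univariate.

  Over an infinite field the univariate polynomial is evaluated at sufficiently many points. Over a
  finite field it is the answer to one query modulo an irreducible polynomial of larger degree, taken
  from an explicit family.\<close>

text \<open>Every form that enters the generators of the ideal is paid for by one summand of the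
  circuit, so the number of forms plus the number of remaining summands never exceeds
  \<open>k\<close>. Hence a projection only has to respect \<open>k\<close> forms at a time, and
  \<open>k\<close> Vandermonde columns suffice.

  The projection has coefficients in \<open>F(z)\<close>, which is infinite even if \<open>F\<close>
  is not. The same \<open>z\<close> then serves as Kronecker variable, so the weights carry the
  factor \<open>M\<close>, which exceeds every degree that the projection produces.

  Two features of the statement need special care. For \<open>d = 1\<close> the allowed time does
  not depend on \<open>k\<close>, so the program then treats the circuit as a single summand.
  Moreover programs contain no field constants, and instead of testing irreducibility the modulus is
  taken from a family that is known to be irreducible and whose degrees grow by a constant factor.
  The prime \<open>l\<close>, the exponent \<open>u\<close> and the shape of the family depend on
  the field alone and are built into the program, which only has to find one field element.\<close>

section \<open>Polynomial functions and their ideals\<close>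

text \<open>Over an infinite field, polynomials can be represented by the functions they induce, and algebra
  homomorphisms by precomposition. \<open>pfun\<close> are the polynomial functions, \<open>hfun d\<close> the homogeneous ones of
  degree \<open>d\<close>, and \<open>idl G\<close> is the ideal generated by \<open>G\<close>.\<close>

inductive pfun :: "((nat \<Rightarrow> 'b::field) \<Rightarrow> 'b) \<Rightarrow> bool" where
  const: "pfun (\<lambda>_. c)"
| coord: "pfun (\<lambda>v. v i)"
| add: "pfun f \<Longrightarrow> pfun g \<Longrightarrow> pfun (\<lambda>v. f v + g v)"
| mult: "pfun f \<Longrightarrow> pfun g \<Longrightarrow> pfun (\<lambda>v. f v * g v)"

inductive hfun :: "nat \<Rightarrow> ((nat \<Rightarrow> 'b::field) \<Rightarrow> 'b) \<Rightarrow> bool" where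
  zero: "hfun i (\<lambda>_. 0)"
| const: "hfun 0 (\<lambda>_. c)"
| coord: "hfun (Suc 0) (\<lambda>v. v i)"
| add: "hfun i f \<Longrightarrow> hfun i g \<Longrightarrow> hfun i (\<lambda>v. f v + g v)"
| mult: "hfun i f \<Longrightarrow> hfun j g \<Longrightarrow> hfun (i + j) (\<lambda>v. f v * g v)"

inductive idl :: "((nat \<Rightarrow> 'b::field) \<Rightarrow> 'b) set \<Rightarrow> ((nat \<Rightarrow> 'b) \<Rightarrow> 'b) \<Rightarrow> bool" for G where
  zero: "idl G (\<lambda>_. 0)"
| step: "idl G h \<Longrightarrow> pfun a \<Longrightarrow> g \<in> G \<Longrightarrow> idl G (\<lambda>v. h v + a v * g v)"

definition linform :: "((nat \<Rightarrow> 'b::field) \<Rightarrow> 'b) \<Rightarrow> bool" where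
  "linform l \<longleftrightarrow> (\<exists>N c. l = (\<lambda>v. \<Sum>i<N. c i * v i))"

text \<open>The span of \<open>K\<close> is handled through its common kernel: a linear form \<open>l\<close> lies in the
  span iff \<open>tinv K l\<close>, and a polynomial is one in the forms \<open>K\<close> iff it is invariant in this sense.\<close>

definition vanish :: "((nat \<Rightarrow> 'b::field) \<Rightarrow> 'b) set \<Rightarrow> (nat \<Rightarrow> 'b) \<Rightarrow> bool" where
  "vanish K w \<longleftrightarrow> (\<forall>l\<in>K. l w = 0)"

definition tinv :: "((nat \<Rightarrow> 'b::field) \<Rightarrow> 'b) set \<Rightarrow> ((nat \<Rightarrow> 'b) \<Rightarrow> 'b) \<Rightarrow> bool" where
  "tinv K g \<longleftrightarrow> (\<forall>v w. vanish K w \<longrightarrow> g (\<lambda>i. v i + w i) = g v)"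

lemma pfun_uminus: "pfun f \<Longrightarrow> pfun (\<lambda>v. - f v)"
  using pfun.mult[OF pfun.const[of "-1"]] by fastforce

lemma pfun_diff: "pfun f \<Longrightarrow> pfun g \<Longrightarrow> pfun (\<lambda>v. f v - g v)"
  using pfun.add[OF _ pfun_uminus] by fastforce

lemma pfun_prod: "(\<And>i. i \<in> A \<Longrightarrow> pfun (f i)) \<Longrightarrow> pfun (\<lambda>v. \<Prod>i\<in>A. f i v)"
  by (induction A rule: infinite_finite_induct) (auto intro: pfun.intros)

lemma hfun_imp_pfun: "hfun i f \<Longrightarrow> pfun f"
  by (induction rule: hfun.induct) (auto intro: pfun.intros)

lemma hfun_sum: "(\<And>i. i \<in> A \<Longrightarrow> hfun d (f i)) \<Longrightarrow> hfun d (\<lambda>v. \<Sum>i\<in>A. f i v)"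
  by (induction A rule: infinite_finite_induct) (auto intro: hfun.intros)

lemma hfun_prod:
  "finite A \<Longrightarrow> (\<And>i. i \<in> A \<Longrightarrow> hfun (Suc 0) (f i)) \<Longrightarrow> hfun (card A) (\<lambda>v. \<Prod>i\<in>A. f i v)"
proof (induction A rule: finite_induct)
  case empty
  show ?case using hfun.const[of 1] by simp
next
  case (insert x A)
  then have "hfun (Suc 0 + card A) (\<lambda>v. f x v * (\<Prod>i\<in>A. f i v))"
    by (intro hfun.mult) auto
  with insert show ?case by simp
qed

lemma hfun_cmult: "hfun i f \<Longrightarrow> hfun i (\<lambda>v. c * f v)"
  using hfun.mult[OF hfun.const[of c], of i f] by simp

lemma hfun_diff: "hfun i f \<Longrightarrow> hfun i g \<Longrightarrow> hfun i (\<lambda>v. f v - g v)"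
  using hfun.add[of i f, OF _ hfun_cmult[of i g "-1"]] by simp

lemma hfun_scale: "hfun i f \<Longrightarrow> f (\<lambda>x. t * v x) = t ^ i * f v"
  by (induction rule: hfun.induct) (auto simp: algebra_simps power_add)

lemma hfun_0_const: "hfun 0 f \<Longrightarrow> f v = f (\<lambda>_. 0)"
  using hfun_scale[of 0 f 0 v] by simp

lemma linform_linear: "linform l \<Longrightarrow> l (\<lambda>i. v i + t * w i) = l v + t * l w"
  by (auto simp: linform_def sum.distrib sum_distrib_left algebra_simps)

lemma linform_add: "linform l \<Longrightarrow> l (\<lambda>i. v i + w i) = l v + l w"
  using linform_linear[of l v 1 w] by simp

lemma linform_scale: "linform l \<Longrightarrow> l (\<lambda>i. t * w i) = t * l w"
  using linform_linear[of l "\<lambda>_. 0" t w] by (auto simp: linform_def)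

lemma linform_hfun: "linform l \<Longrightarrow> hfun (Suc 0) l"
  by (auto simp: linform_def intro!: hfun_sum hfun_cmult hfun.coord)

lemma linform_pfun: "linform l \<Longrightarrow> pfun l"
  using hfun_imp_pfun linform_hfun by blast

text \<open>Restriction to lines reduces questions about zeros to polynomials in one
  variable.\<close>

lemma pfun_line: "pfun f \<Longrightarrow> \<exists>q. \<forall>t. f (\<lambda>i. v i + t * w i) = poly q t"
proof (induction rule: pfun.induct)
  case (const c)
  show ?case by (rule exI[of _ "[:c:]"]) simp
next
  case (coord i)
  show ?case by (rule exI[of _ "[:v i, w i:]"]) simp
next
  case (add f g)
  then show ?case by (metis poly_add)
next
  case (mult f g)
  then show ?case by (metis poly_mult)
qed

lemma infinite_poly_zero:
  fixes q :: "'b::field poly"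
  assumes "infinite (UNIV :: 'b set)" "finite A" "\<And>t. t \<notin> A \<Longrightarrow> poly q t = 0"
  shows "q = 0"
proof (rule ccontr)
  assume "q \<noteq> 0"
  then have "finite {t. poly q t = 0}" by (rule poly_roots_finite)
  moreover have "UNIV \<subseteq> {t. poly q t = 0} \<union> A" using assms(3) by auto
  ultimately show False using assms(1,2) finite_subset by blast
qed

text \<open>On the line through \<open>v\<close> and \<open>w\<close> neither restriction is the
  zero polynomial, so over an infinite field their product has a nonroot.\<close>

lemma pfun_mult_eq_0:
  fixes f g :: "(nat \<Rightarrow> 'b::field) \<Rightarrow> 'b"
  assumes inf: "infinite (UNIV :: 'b set)" and f: "pfun f" and g: "pfun g" and "f v \<noteq> 0" "g w \<noteq> 0"
  obtains u where "f u * g u \<noteq> 0"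
proof -
  define x where "x = (\<lambda>i. w i - v i)"
  obtain p where p: "\<And>t. f (\<lambda>i. v i + t * x i) = poly p t" using pfun_line[OF f] by blast
  obtain q where q: "\<And>t. g (\<lambda>i. v i + t * x i) = poly q t" using pfun_line[OF g] by blast
  have "p \<noteq> 0" using p[of 0] assms by auto
  moreover have "q \<noteq> 0" using q[of 1] assms by (auto simp: x_def)
  ultimately have "p * q \<noteq> 0" by simp
  then obtain t where "poly (p * q) t \<noteq> 0"
    using infinite_poly_zero[OF inf, of "{}" "p * q"] by auto
  then show ?thesis using that[of "\<lambda>i. v i + t * x i"] p q by simp
qed

lemma pfun_cancel:
  fixes f :: "(nat \<Rightarrow> 'b::field) \<Rightarrow> 'b"
  assumes inf: "infinite (UNIV :: 'b set)" and f: "pfun f" and l: "pfun l" "l w \<noteq> 0"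
    and 0: "\<And>v. l v * f v = 0"
  shows "f v = 0"
  using pfun_mult_eq_0[OF inf f l(1) _ l(2)] 0 by (metis mult.commute)

section \<open>Ideals of polynomial functions and cancellation modulo them\<close>

lemma idl_add:
  assumes "idl G f" "idl G h"
  shows "idl G (\<lambda>v. f v + h v)"
  using assms(2)
proof (induction rule: idl.induct)
  case zero
  then show ?case using assms(1) by simp
next
  case (step h a g)
  then show ?case using idl.step[of G "\<lambda>v. f v + h v" a g] by (simp add: add.assoc)
qed

lemma idl_mult: "idl G f \<Longrightarrow> pfun b \<Longrightarrow> idl G (\<lambda>v. b v * f v)"
proof (induction rule: idl.induct)
  case zero
  then show ?case using idl.zero by simp
next
  case (step h a g)
  then show ?case using idl.step[of G "\<lambda>v. b v * h v" "\<lambda>v. b v * a v" g]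
    by (simp add: algebra_simps pfun.mult)
qed

lemma idl_cmult: "idl G f \<Longrightarrow> idl G (\<lambda>v. c * f v)"
  using idl_mult pfun.const by blast

lemma idl_diff: "idl G f \<Longrightarrow> idl G h \<Longrightarrow> idl G (\<lambda>v. f v - h v)"
  using idl_add[of G f, OF _ idl_cmult[of G h "-1"]] by simp

lemma idl_base: "g \<in> G \<Longrightarrow> idl G g"
  using idl.step[OF idl.zero pfun.const[of 1]] by fastforce

lemma idl_mono: "idl G f \<Longrightarrow> G \<subseteq> H \<Longrightarrow> idl H f"
  by (induction rule: idl.induct) (auto intro: idl.intros)

lemma idl_pfun: "idl G f \<Longrightarrow> (\<And>g. g \<in> G \<Longrightarrow> pfun g) \<Longrightarrow> pfun f"
  by (induction rule: idl.induct) (simp_all add: pfun.const pfun.add pfun.mult)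

lemma idl_insertD:
  "idl (insert T G) f \<Longrightarrow> \<exists>a. pfun a \<and> idl G (\<lambda>v. f v - a v * T v)"
proof (induction rule: idl.induct)
  case zero
  show ?case by (rule exI[of _ "\<lambda>_. 0"]) (simp add: pfun.const idl.zero)
next
  case (step h a g)
  then obtain b where b: "pfun b" "idl G (\<lambda>v. h v - b v * T v)" by blast
  show ?case
  proof (cases "g = T")
    case True
    have "idl G (\<lambda>v. h v + a v * g v - (b v + a v) * T v)"
      using b(2) True by (simp add: algebra_simps)
    then show ?thesis using pfun.add[OF b(1) step.hyps(2)] by blast
  next
    case False
    then have "idl G (\<lambda>v. h v - b v * T v + a v * g v)" using step b by (auto intro: idl.step)
    then have "idl G (\<lambda>v. h v + a v * g v - b v * T v)" by (simp add: algebra_simps)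
    then show ?thesis using b by blast
  qed
qed

lemma idl_insertI:
  assumes "pfun a" "idl G (\<lambda>v. f v - a v * T v)"
  shows "idl (insert T G) f"
  using idl.step[OF idl_mono[OF assms(2) subset_insertI] assms(1), of T T] by simp

lemma idl_comp:
  assumes "idl G f" and A: "\<And>f. pfun f \<Longrightarrow> pfun (\<lambda>v. f (A v))"
  shows "idl ((\<lambda>g v. g (A v)) ` G) (\<lambda>v. f (A v))"
  using assms(1)
  by (induction rule: idl.induct) (auto intro!: idl.intros A)

lemma pfun_comp:
  assumes "pfun f" "\<And>i. pfun (\<lambda>v. A v i)"
  shows "pfun (\<lambda>v. f (A v))"
  using assms(1) by (induction rule: pfun.induct) (auto intro: pfun.intros assms(2))

lemma tinv_linform: "linform l \<Longrightarrow> tinv K l \<longleftrightarrow> (\<forall>w. vanish K w \<longrightarrow> l w = 0)"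
  by (auto simp: tinv_def linform_add)

lemma tinv_prod: "(\<And>i. i \<in> A \<Longrightarrow> tinv K (f i)) \<Longrightarrow> tinv K (\<lambda>v. \<Prod>i\<in>A. f i v)"
  by (auto simp: tinv_def intro!: prod.cong)

lemma tinv_mono: "tinv K g \<Longrightarrow> K \<subseteq> K' \<Longrightarrow> tinv K' g"
  unfolding tinv_def vanish_def by blast

text \<open>With \<open>l w = 1\<close>, precomposition with \<open>v \<mapsto> v - l v \<cdot> w\<close> is an endomorphism that fixes the
  generators and kills exactly the multiples of \<open>l\<close>.\<close>

lemma idl_cancel:
  fixes f :: "(nat \<Rightarrow> 'b::field) \<Rightarrow> 'b"
  assumes inf: "infinite (UNIV :: 'b set)" and l: "linform l" and K: "\<And>\<kappa>. \<kappa> \<in> K \<Longrightarrow> linform \<kappa>"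
    and w: "vanish K w" "l w \<noteq> 0"
    and G: "\<And>g. g \<in> G \<Longrightarrow> pfun g" "\<And>g. g \<in> G \<Longrightarrow> tinv K g"
    and f: "pfun f" "idl G (\<lambda>v. l v * f v)"
  shows "idl G f"
proof -
  define w' where "w' = (\<lambda>i. (1 / l w) * w i)"
  have lw': "l w' = 1" using w(2) unfolding w'_def linform_scale[OF l] by simp
  have van: "vanish K (\<lambda>i. t * w' i)" for t
    unfolding vanish_def w'_def
  proof
    fix \<kappa> assume "\<kappa> \<in> K"
    then show "\<kappa> (\<lambda>i. t * (1 / l w * w i)) = 0"
      using w(1) linform_scale[OF K, of \<kappa> "t * (1 / l w)" w] by (simp add: vanish_def mult.assoc)
  qed
  define A where "A = (\<lambda>v i. v i - l v * w' i)"
  have lA: "l (A v) = 0" for v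
    using linform_linear[OF l, of v "- l v" w'] lw' by (simp add: A_def)
  have gA: "g (A v) = g v" if "g \<in> G" for g v
    using G(2)[OF that, unfolded tinv_def, rule_format, OF van[of "- l v"], of v] by (simp add: A_def)
  \<comment> \<open>By induction on \<open>a\<close>: \<open>A\<close> moves \<open>v\<close> by
    \<open>l v\<close> times a fixed vector, so the difference is divisible by \<open>l\<close>;
    products are treated as in the Leibniz rule.\<close>
  have div: "\<exists>b. pfun b \<and> (\<forall>v. a v - a (A v) = l v * b v)" if "pfun a" for a
    using that
  proof (induction rule: pfun.induct)
    case (const c)
    show ?case by (rule exI[of _ "\<lambda>_. 0"]) (simp add: pfun.const)
  next
    case (coord i)
    show ?case by (rule exI[of _ "\<lambda>_. w' i"]) (simp add: pfun.const A_def)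
  next
    case (add f g)
    then obtain b c where b: "pfun b" "\<And>v. f v - f (A v) = l v * b v"
      and c: "pfun c" "\<And>v. g v - g (A v) = l v * c v" by blast
    have "f v + g v - (f (A v) + g (A v)) = l v * (b v + c v)" for v
      unfolding distrib_left b(2)[symmetric] c(2)[symmetric] by simp
    then show ?case using pfun.add[OF b(1) c(1)] by blast
  next
    case (mult f g)
    then obtain b c where b: "pfun b" "\<And>v. f v - f (A v) = l v * b v"
      and c: "pfun c" "\<And>v. g v - g (A v) = l v * c v" by blast
    have "pfun (\<lambda>v. A v i)" for i
      unfolding A_def by (intro pfun_diff pfun.intros linform_pfun l)
    then have "pfun (\<lambda>v. f (A v))" by (rule pfun_comp[OF mult.hyps(1)])
    then have "pfun (\<lambda>v. b v * g v + f (A v) * c v)"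
      using b(1) c(1) mult.hyps by (intro pfun.add pfun.mult)
    moreover have "f v * g v - f (A v) * g (A v) = l v * (b v * g v + f (A v) * c v)" for v
    proof -
      have "f v * g v - f (A v) * g (A v) = (f v - f (A v)) * g v + f (A v) * (g v - g (A v))"
        by (simp add: algebra_simps)
      then show ?thesis unfolding b(2) c(2) by (simp add: algebra_simps)
    qed
    ultimately show ?case by blast
  qed
  \<comment> \<open>Since \<open>A\<close> fixes the generators, only the cofactors change, and
    their quotients by \<open>l\<close> again give an element of the ideal.\<close>
  have "\<exists>h'. idl G h' \<and> (\<forall>v. h v - h (A v) = l v * h' v)" if "idl G h" for h
    using that
  proof (induction rule: idl.induct)
    case zero
    show ?case by (rule exI[of _ "\<lambda>_. 0"]) (simp add: idl.zero)
  next
    case (step h a g)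
    then obtain h' b where h': "idl G h'" "\<And>v. h v - h (A v) = l v * h' v"
      and b: "pfun b" "\<And>v. a v - a (A v) = l v * b v" using div by blast
    have "h v + a v * g v - (h (A v) + a (A v) * g (A v)) = l v * (h' v + b v * g v)" for v
    proof -
      have "h v + a v * g v - (h (A v) + a (A v) * g (A v))
          = (h v - h (A v)) + (a v - a (A v)) * g v" using gA[OF step.hyps(3)] by (simp add: algebra_simps)
      then show ?thesis unfolding h'(2) b(2) by (simp add: algebra_simps)
    qed
    then show ?case using idl.step[OF h'(1) b(1) step.hyps(3)] by blast
  qed
  \<comment> \<open>The product of \<open>l\<close> and \<open>f\<close> vanishes after composition
    with \<open>A\<close>, because \<open>l (A v) = 0\<close>. So it equals \<open>l\<close> times
    an ideal element, and \<open>l\<close> can be cancelled as a function.\<close>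
  from this[OF f(2)] obtain h' where h': "idl G h'" "\<And>v. l v * f v = l v * h' v" using lA by auto
  have "pfun (\<lambda>v. f v - h' v)" using f(1) idl_pfun[OF h'(1) G(1)] by (rule pfun_diff)
  moreover have "l w' \<noteq> 0" using lw' by simp
  moreover have "l v * (f v - h' v) = 0" for v using h'(2)[of v] by (simp add: algebra_simps)
  ultimately have "f v - h' v = 0" for v
    using pfun_cancel[OF inf _ linform_pfun[OF l], of "\<lambda>v. f v - h' v" w' v] by blast
  then have "f = h'" by (auto simp: fun_eq_iff)
  then show ?thesis using h'(1) by simp
qed

text \<open>The property \<open>J\<close> is used for \<open>\<lambda>_. True\<close> and for membership in a homogeneous ideal.\<close>

definition hdecomp :: "(((nat \<Rightarrow> 'b::field) \<Rightarrow> 'b) \<Rightarrow> bool) \<Rightarrow> ((nat \<Rightarrow> 'b) \<Rightarrow> 'b) \<Rightarrow> bool" where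
  "hdecomp J f \<longleftrightarrow> (\<exists>m h. (\<forall>i. hfun i (h i) \<and> J (h i)) \<and> f = (\<lambda>v. \<Sum>i<m. h i v))"

lemma hdecomp_hfun:
  assumes "hfun i f" "J f" "J (\<lambda>_. 0)"
  shows "hdecomp J f"
  unfolding hdecomp_def
  by (rule exI[of _ "Suc i"], rule exI[of _ "\<lambda>j. if j = i then f else (\<lambda>_. 0)"])
    (auto simp: assms hfun.zero fun_eq_iff)

lemma hdecomp_add:
  assumes f: "hdecomp J f" and g: "hdecomp J g"
    and J: "J (\<lambda>_. 0)" "\<And>f g. J f \<Longrightarrow> J g \<Longrightarrow> J (\<lambda>v. f v + g v)"
  shows "hdecomp J (\<lambda>v. f v + g v)"
proof -
  obtain m h where h: "\<And>i. hfun i (h i) \<and> J (h i)" "f = (\<lambda>v. \<Sum>i<m. h i v)"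
    using f unfolding hdecomp_def by blast
  obtain m' h' where h': "\<And>i. hfun i (h' i) \<and> J (h' i)" "g = (\<lambda>v. \<Sum>i<m'. h' i v)"
    using g unfolding hdecomp_def by blast
  define H where "H = (\<lambda>i v. (if i < m then h i else (\<lambda>_. 0)) v + (if i < m' then h' i else (\<lambda>_. 0)) v)"
  have "hfun i (H i) \<and> J (H i)" for i
    unfolding H_def using h(1) h'(1) J hfun.zero by (auto intro!: hfun.add J(2))
  moreover have "f v + g v = (\<Sum>i<max m m'. H i v)" for v
  proof -
    have "f v = (\<Sum>i<max m m'. (if i < m then h i else (\<lambda>_. 0)) v)"
      unfolding h(2) by (rule sum.mono_neutral_cong_left) auto
    moreover have "g v = (\<Sum>i<max m m'. (if i < m' then h' i else (\<lambda>_. 0)) v)"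
      unfolding h'(2) by (rule sum.mono_neutral_cong_left) auto
    ultimately show ?thesis by (simp add: H_def sum.distrib)
  qed
  ultimately show ?thesis unfolding hdecomp_def by blast
qed

lemma hdecomp_sum:
  assumes "\<And>i. i \<in> A \<Longrightarrow> hdecomp J (f i)"
    and J: "J (\<lambda>_. 0)" "\<And>f g. J f \<Longrightarrow> J g \<Longrightarrow> J (\<lambda>v. f v + g v)"
  shows "hdecomp J (\<lambda>v. \<Sum>i\<in>A. f i v)"
  using assms(1)
proof (induction A rule: infinite_finite_induct)
  case (insert x F)
  then have "hdecomp J (\<lambda>v. f x v + (\<Sum>i\<in>F. f i v))" by (intro hdecomp_add J) auto
  with insert show ?case by simp
qed (auto intro: J hdecomp_hfun[OF hfun.zero])

lemma pfun_hdecomp: "pfun f \<Longrightarrow> hdecomp (\<lambda>_. True) f"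
proof (induction rule: pfun.induct)
  case (mult f g)
  obtain m h where h: "\<And>i. hfun i (h i)" "f = (\<lambda>v. \<Sum>i<m. h i v)"
    using mult unfolding hdecomp_def by blast
  obtain m' h' where h': "\<And>i. hfun i (h' i)" "g = (\<lambda>v. \<Sum>i<m'. h' i v)"
    using mult unfolding hdecomp_def by blast
  have "hdecomp (\<lambda>_. True) (\<lambda>v. \<Sum>i<m. \<Sum>j<m'. h i v * h' j v)"
    by (intro hdecomp_sum) (auto intro: hdecomp_hfun hfun.mult h(1) h'(1))
  then show ?case unfolding h(2) h'(2) by (simp add: sum_product)
next
  case (const c)
  show ?case by (rule hdecomp_hfun[OF hfun.const]) auto
next
  case (coord i)
  show ?case by (rule hdecomp_hfun[OF hfun.coord]) auto
next
  case (add f g)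
  then show ?case by (intro hdecomp_add) auto
qed

text \<open>Splitting every cofactor into homogeneous components does not leave the ideal, and the
  products are homogeneous because the generators are.\<close>

lemma idl_hdecomp:
  assumes "idl G f" and G: "\<And>g. g \<in> G \<Longrightarrow> \<exists>i. hfun i g"
  shows "hdecomp (idl G) f"
  using assms(1)
proof (induction rule: idl.induct)
  case zero
  show ?case by (rule hdecomp_hfun[OF hfun.zero]) (rule idl.zero)+
next
  case (step h a g)
  obtain m b where b: "\<And>i. hfun i (b i)" "a = (\<lambda>v. \<Sum>i<m. b i v)"
    using pfun_hdecomp[OF step.hyps(2)] unfolding hdecomp_def by blast
  obtain j where j: "hfun j g" using G step.hyps by blast
  have "idl G (\<lambda>v. b i v * g v)" for i
    using idl_mult[OF idl_base[OF step.hyps(3)]] hfun_imp_pfun[OF b(1)] by blast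
  then have "hdecomp (idl G) (\<lambda>v. \<Sum>i<m. b i v * g v)"
    by (intro hdecomp_sum hdecomp_hfun[OF hfun.mult[OF b(1) j]] idl_add idl.zero)
  then have "hdecomp (idl G) (\<lambda>v. a v * g v)" unfolding b(2) by (simp add: sum_distrib_right)
  with step.IH show ?case by (rule hdecomp_add) (rule idl.zero idl_add; assumption?)+
qed

text \<open>Scaling the argument by \<open>t\<close> turns the sum into a polynomial in
  \<open>t\<close> that vanishes everywhere; its coefficients are the summands.\<close>

lemma hfun_sum_eq_0:
  fixes h :: "nat \<Rightarrow> (nat \<Rightarrow> 'b::field) \<Rightarrow> 'b"
  assumes inf: "infinite (UNIV :: 'b set)" and h: "\<And>i. hfun i (h i)"
    and 0: "\<And>v. (\<Sum>i<m. h i v) = 0" and "i < m"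
  shows "h i v = 0"
proof -
  define q where "q = (\<Sum>i<m. monom (h i v) i)"
  have "poly q t = 0" for t
    using 0[of "\<lambda>x. t * v x"] by (simp add: hfun_scale[OF h] q_def poly_sum poly_monom mult.commute)
  then have "q = 0" using infinite_poly_zero[OF inf, of "{}"] by auto
  then have "coeff q i = 0" by simp
  then show ?thesis using assms(4) by (simp add: q_def coeff_sum)
qed

text \<open>In degree \<open>d\<close> only the constant component of the cofactor \<open>a\<close>
  meets \<open>T\<close>, so comparing components of degree \<open>d\<close> replaces
  \<open>a\<close> by a scalar.\<close>

lemma idl_insert_homogeneous:
  fixes C T :: "(nat \<Rightarrow> 'b::field) \<Rightarrow> 'b"
  assumes inf: "infinite (UNIV :: 'b set)" and C: "hfun d C" and T: "hfun d T"
    and G: "\<And>g. g \<in> G \<Longrightarrow> \<exists>i. hfun i g" and "idl (insert T G) C"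
  shows "\<exists>\<alpha>. idl G (\<lambda>v. C v - \<alpha> * T v)"
proof -
  obtain a where a: "pfun a" "idl G (\<lambda>v. C v - a v * T v)" using idl_insertD[OF assms(5)] by blast
  obtain m h where h: "\<And>i. hfun i (h i)" "\<And>i. idl G (h i)" "\<And>v. C v - a v * T v = (\<Sum>i<m. h i v)"
    using idl_hdecomp[OF a(2) G] unfolding hdecomp_def fun_eq_iff by blast
  obtain m' b where b: "\<And>i. hfun i (b i)" "\<And>v. a v = (\<Sum>i<m'. b i v)"
    using pfun_hdecomp[OF a(1)] unfolding hdecomp_def fun_eq_iff by blast
  \<comment> \<open>Large enough for the components of the ideal element, for \<open>C\<close> in
    degree \<open>d\<close>, and for those of \<open>a\<close> shifted by \<open>d\<close>.\<close>
  define N where "N = m + m' + d + 1"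
  define b' where "b' = (\<lambda>i. if i < m' then b i else (\<lambda>_. 0))"
  define h' where "h' = (\<lambda>i. if i < m then h i else (\<lambda>_. 0))"
  define F where "F = (\<lambda>i v. ((if i = d then C else (\<lambda>_. 0)) v
     - (if d \<le> i then (\<lambda>v. b' (i - d) v * T v) else (\<lambda>_. 0)) v) - h' i v)"
  have b'h: "hfun i (b' i)" for i using b(1) by (simp add: b'_def hfun.zero)
  have h'h: "hfun i (h' i)" "idl G (h' i)" for i using h(1,2) by (simp_all add: h'_def hfun.zero idl.zero)
  have "hfun i (if d \<le> i then (\<lambda>v. b' (i - d) v * T v) else (\<lambda>_. 0))" for i
    using hfun.mult[OF b'h[of "i - d"] T] by (auto simp: hfun.zero)
  then have F: "hfun i (F i)" for i
    unfolding F_def using C h'h by (intro hfun_diff) (auto simp: hfun.zero)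
  have "(\<Sum>i<N. F i v) = 0" for v
  proof -
    have 1: "(\<Sum>i<N. (if i = d then C else (\<lambda>_. 0)) v) = C v"
    proof -
      have "(\<Sum>i<N. (if i = d then C else (\<lambda>_. 0)) v) = (\<Sum>i<N. if i = d then C v else 0)"
        by (rule sum.cong) auto
      then show ?thesis by (simp add: N_def)
    qed
    have 2: "(\<Sum>i<N. (if d \<le> i then (\<lambda>v. b' (i - d) v * T v) else (\<lambda>_. 0)) v) = a v * T v"
    proof -
      have "a v * T v = (\<Sum>i<m'. b' i v * T v)"
        by (simp add: b(2) b'_def sum_distrib_right)
      also have "\<dots> = (\<Sum>i\<in>{d..<d+m'}. b' (i - d) v * T v)"
        using sum.shift_bounds_nat_ivl[of "\<lambda>i. b' (i - d) v * T v" 0 d m'] by (simp add: atLeast0LessThan add.commute)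
      also have "\<dots> = (\<Sum>i<N. (if d \<le> i then (\<lambda>v. b' (i - d) v * T v) else (\<lambda>_. 0)) v)"
        by (rule sum.mono_neutral_cong_left) (auto simp: N_def b'_def)
      finally show ?thesis by simp
    qed
    have 3: "(\<Sum>i<N. h' i v) = (\<Sum>i<m. h i v)"
      by (rule sum.mono_neutral_cong_right) (auto simp: N_def h'_def)
    show ?thesis unfolding F_def sum_subtractf 1 2 3 h(3)[symmetric] by simp
  qed
  then have "F d v = 0" for v
    using hfun_sum_eq_0[OF inf, of F N d v] F by (simp add: N_def)
  then have "C v - b' 0 v * T v = h' d v" for v by (simp add: F_def)
  then have "C v - b' 0 (\<lambda>_. 0) * T v = h' d v" for v
    by (simp only: hfun_0_const[OF b'h[of 0], of v, symmetric])
  then have "idl G (\<lambda>v. C v - b' 0 (\<lambda>_. 0) * T v)" using h'h(2)[of d] by simp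
  then show ?thesis by (rule exI)
qed

section \<open>Closure properties of linear forms\<close>

lemma linformI: "(\<And>v. l v = (\<Sum>i<N. c i * v i)) \<Longrightarrow> linform l"
  unfolding linform_def fun_eq_iff by blast

lemma linform_cmult: "linform l \<Longrightarrow> linform (\<lambda>v. c * l v)"
proof -
  assume "linform l"
  then obtain N a where "l = (\<lambda>v. \<Sum>i<N. a i * v i)" unfolding linform_def by blast
  then have "c * l v = (\<Sum>i<N. (c * a i) * v i)" for v
    by (simp add: sum_distrib_left mult.assoc)
  then show ?thesis by (rule linformI)
qed

lemma linform_plus:
  assumes "linform l" "linform l'"
  shows "linform (\<lambda>v. l v + l' v)"
proof -
  obtain N a where a: "l = (\<lambda>v. \<Sum>i<N. a i * v i)" using assms unfolding linform_def by blast
  obtain M b where b: "l' = (\<lambda>v. \<Sum>i<M. b i * v i)" using assms unfolding linform_def by blast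
  define a' where "a' = (\<lambda>i. if i < N then a i else 0)"
  define b' where "b' = (\<lambda>i. if i < M then b i else 0)"
  have "l v = (\<Sum>i<max N M. a' i * v i)" for v
    unfolding a by (rule sum.mono_neutral_cong_left) (auto simp: a'_def)
  moreover have "l' v = (\<Sum>i<max N M. b' i * v i)" for v
    unfolding b by (rule sum.mono_neutral_cong_left) (auto simp: b'_def)
  ultimately have "l v + l' v = (\<Sum>i<max N M. (a' i + b' i) * v i)" for v
    by (simp add: sum.distrib distrib_right)
  then show ?thesis by (rule linformI)
qed

lemma linform_zero: "linform (\<lambda>_. 0)"
  unfolding linform_def by (rule exI[of _ 0]) auto

lemma linform_sum: "(\<And>i. i \<in> A \<Longrightarrow> linform (l i)) \<Longrightarrow> linform (\<lambda>v. \<Sum>i\<in>A. l i v)"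
  by (induction A rule: infinite_finite_induct) (simp_all add: linform_zero linform_plus)

lemma linform_coord: "linform (\<lambda>v. v i)"
  unfolding linform_def
  by (rule exI[of _ "Suc i"], rule exI[of _ "\<lambda>j. if j = i then 1 else 0"])
    (auto simp: fun_eq_iff)

lemma linform_comp:
  assumes "linform l" "\<And>i. linform (\<lambda>v. A v i)"
  shows "linform (\<lambda>v. l (A v))"
proof -
  obtain N a where a: "l = (\<lambda>v. \<Sum>i<N. a i * v i)" using assms unfolding linform_def by blast
  show ?thesis unfolding a by (intro linform_sum linform_cmult assms(2))
qed

lemma linform_arg_sum:
  assumes "linform l"
  shows "l (\<lambda>i. \<Sum>x\<in>A. c x * y x i) = (\<Sum>x\<in>A. c x * l (y x))"
proof -
  obtain N a where a: "l = (\<lambda>v. \<Sum>i<N. a i * v i)" using assms unfolding linform_def by blast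
  show ?thesis unfolding a sum_distrib_left
    by (subst sum.swap) (simp add: mult_ac)
qed

section \<open>Ideal nonmembership under rank-preserving substitutions\<close>

lemma idl_cancel_prod:
  fixes h :: "(nat \<Rightarrow> 'b::field) \<Rightarrow> 'b"
  assumes inf: "infinite (UNIV :: 'b set)" and K: "\<And>\<kappa>. \<kappa> \<in> K \<Longrightarrow> linform \<kappa>"
    and G: "\<And>g. g \<in> G \<Longrightarrow> pfun g" "\<And>g. g \<in> G \<Longrightarrow> tinv K g"
    and "finite B" and h: "pfun h"
    and B: "\<And>j. j \<in> B \<Longrightarrow> linform (f j)" "\<And>j. j \<in> B \<Longrightarrow> \<exists>w. vanish K w \<and> f j w \<noteq> 0"
    and "idl G (\<lambda>v. (\<Prod>j\<in>B. f j v) * h v)"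
  shows "idl G h"
  using assms(5) B assms(9)
proof (induction B rule: finite_induct)
  case empty
  then show ?case by simp
next
  case (insert j B)
  obtain w where w: "vanish K w" "f j w \<noteq> 0" using insert.prems by blast
  have "idl G (\<lambda>v. f j v * ((\<Prod>j\<in>B. f j v) * h v))"
    using insert by (simp add: mult.assoc)
  moreover have "pfun (\<lambda>v. (\<Prod>j\<in>B. f j v) * h v)"
    using insert.prems by (intro pfun.mult pfun_prod h linform_pfun) auto
  ultimately have "idl G (\<lambda>v. (\<Prod>j\<in>B. f j v) * h v)"
    using idl_cancel[where l = "f j" and K = K and w = w and G = G
        and f = "\<lambda>v. (\<Prod>j\<in>B. f j v) * h v"] inf K w G insert.prems by blast
  then show ?case using insert by blast
qed

text \<open>In \<open>pres\<close>, a form outside the span of fewer than \<open>k\<close> others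
  stays outside after pullback along \<open>\<Psi>\<close>. Expressing both sides by common kernels
  avoids bases and coefficients.\<close>

locale rank_preserving =
  fixes L :: "((nat \<Rightarrow> 'b::field) \<Rightarrow> 'b) set" and \<Psi> :: "(nat \<Rightarrow> 'b) \<Rightarrow> nat \<Rightarrow> 'b" and k :: nat
  assumes inf: "infinite (UNIV :: 'b set)"
    and lin: "\<And>l. l \<in> L \<Longrightarrow> linform l"
    and lin\<Psi>: "\<And>i. linform (\<lambda>y. \<Psi> y i)"
    and pres: "\<And>K l. finite K \<Longrightarrow> K \<subseteq> L \<Longrightarrow> card K < k \<Longrightarrow> l \<in> L \<Longrightarrow> \<not> tinv K l \<Longrightarrow>
      \<exists>y. vanish K (\<Psi> y) \<and> l (\<Psi> y) \<noteq> 0"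
begin

text \<open>This gives a right inverse of \<open>\<Psi>\<close> modulo the common kernel of
  \<open>K\<close>. A minimal \<open>K0\<close> with the same kernel is a basis of the span of
  \<open>K\<close>; its pullbacks stay independent, so there are vectors \<open>y \<kappa>\<close>
  dual to them up to scaling, and \<open>\<Theta>\<close> interpolates with these.\<close>

lemma section_mod_kernel:
  assumes K: "finite K" "K \<subseteq> L" "card K \<le> k"
  obtains \<Theta> where "\<And>i. linform (\<lambda>v. \<Theta> v i)" "\<And>v. vanish K (\<lambda>i. \<Psi> (\<Theta> v) i - v i)"
proof -
  define P where "P = (\<lambda>K0. K0 \<subseteq> K \<and> (\<forall>w. vanish K0 w \<longrightarrow> vanish K w))"
  obtain K0 where K0: "P K0" and min: "\<And>K1. P K1 \<Longrightarrow> card K0 \<le> card K1"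
    using ex_has_least_nat[of P K card] by (auto simp: P_def)
  have sub: "K0 \<subseteq> L" "finite K0" using K0 K finite_subset by (auto simp: P_def)
  have "\<exists>y. vanish (K0 - {\<kappa>}) (\<Psi> y) \<and> \<kappa> (\<Psi> y) \<noteq> 0" if "\<kappa> \<in> K0" for \<kappa>
  proof (rule pres)
    have "card (K0 - {\<kappa>}) < card K0" by (rule card_Diff1_less[OF sub(2) that])
    then show "card (K0 - {\<kappa>}) < k" using K0 K by (meson P_def card_mono le_trans less_le_trans)
    show "\<not> tinv (K0 - {\<kappa>}) \<kappa>"
    proof
      assume *: "tinv (K0 - {\<kappa>}) \<kappa>"
      have "vanish K0 w" if w: "vanish (K0 - {\<kappa>}) w" for w
      proof -
        have "\<kappa> w = 0" using * w lin sub \<open>\<kappa> \<in> K0\<close> by (auto simp: tinv_linform)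
        then show ?thesis using w by (auto simp: vanish_def)
      qed
      then have "P (K0 - {\<kappa>})" using K0 by (auto simp: P_def)
      then show False using min \<open>card (K0 - {\<kappa>}) < card K0\<close> by fastforce
    qed
  qed (use that sub in auto)
  then obtain y where y: "\<And>\<kappa>. \<kappa> \<in> K0 \<Longrightarrow> vanish (K0 - {\<kappa>}) (\<Psi> (y \<kappa>))"
    "\<And>\<kappa>. \<kappa> \<in> K0 \<Longrightarrow> \<kappa> (\<Psi> (y \<kappa>)) \<noteq> 0" by metis
  define \<Theta> where "\<Theta> = (\<lambda>v i. \<Sum>\<kappa>\<in>K0. (\<kappa> v / \<kappa> (\<Psi> (y \<kappa>))) * y \<kappa> i)"
  have "linform (\<lambda>v. \<Theta> v i)" for i
  proof -
    have "linform (\<lambda>v. \<Sum>\<kappa>\<in>K0. (y \<kappa> i / \<kappa> (\<Psi> (y \<kappa>))) * \<kappa> v)"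
      using sub lin by (intro linform_sum linform_cmult) auto
    then show ?thesis by (simp add: \<Theta>_def mult.commute)
  qed
  moreover have "vanish K (\<lambda>i. \<Psi> (\<Theta> v) i - v i)" for v
  proof -
    have "\<mu> (\<lambda>i. \<Psi> (\<Theta> v) i - v i) = 0" if \<mu>: "\<mu> \<in> K0" for \<mu>
    proof -
      have l\<mu>: "linform \<mu>" using \<mu> sub lin by blast
      have "linform (\<lambda>y. \<mu> (\<Psi> y))" by (rule linform_comp[OF l\<mu> lin\<Psi>])
      then have "\<mu> (\<Psi> (\<Theta> v)) = (\<Sum>\<kappa>\<in>K0. (\<kappa> v / \<kappa> (\<Psi> (y \<kappa>))) * \<mu> (\<Psi> (y \<kappa>)))"
        unfolding \<Theta>_def by (rule linform_arg_sum)
      also have "\<dots> = (\<Sum>\<kappa>\<in>K0. if \<kappa> = \<mu> then \<mu> v else 0)"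
      proof (rule sum.cong[OF refl])
        fix \<kappa> assume "\<kappa> \<in> K0"
        then show "\<kappa> v / \<kappa> (\<Psi> (y \<kappa>)) * \<mu> (\<Psi> (y \<kappa>)) = (if \<kappa> = \<mu> then \<mu> v else 0)"
          using y[of \<kappa>] \<mu> by (auto simp: vanish_def)
      qed
      also have "\<dots> = \<mu> v" using \<mu> sub by simp
      finally show ?thesis using linform_linear[OF l\<mu>, of "\<Psi> (\<Theta> v)" "-1" v] by simp
    qed
    then show ?thesis using K0 by (simp add: P_def vanish_def)
  qed
  ultimately show ?thesis using that by blast
qed

text \<open>Factors outside the span of \<open>K\<close> stay outside after pullback and can be
  cancelled there. The generators and the other factors depend on \<open>K\<close> alone; on such
  functions \<open>\<Theta>\<close> undoes \<open>\<Psi>\<close>, which carries the membership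
  back.\<close>

lemma prod_notin_idl:
  assumes K: "finite K" "K \<subseteq> L" "card K < k"
    and G: "\<And>g. g \<in> G \<Longrightarrow> pfun g" "\<And>g. g \<in> G \<Longrightarrow> tinv K g"
    and J: "finite J" "\<And>j. j \<in> J \<Longrightarrow> f j \<in> L"
    and idl: "idl ((\<lambda>g y. g (\<Psi> y)) ` G) (\<lambda>y. \<Prod>j\<in>J. f j (\<Psi> y))"
  shows "idl G (\<lambda>v. \<Prod>j\<in>J. f j v)"
proof -
  define U where "U = {j \<in> J. tinv K (f j)}"
  define K' where "K' = (\<lambda>\<kappa> y. \<kappa> (\<Psi> y)) ` K"
  have pf\<Psi>: "pfun (\<lambda>y. g (\<Psi> y))" if "pfun g" for g
    using pfun_comp[OF that linform_pfun[OF lin\<Psi>]] .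
  have \<Psi>add: "\<Psi> (\<lambda>i. v i + w i) = (\<lambda>i. \<Psi> v i + \<Psi> w i)" for v w
    using linform_add[OF lin\<Psi>] by blast
  have vK': "vanish K' w \<longleftrightarrow> vanish K (\<Psi> w)" for w by (auto simp: K'_def vanish_def)
  have split: "(\<Prod>j\<in>J. g j) = (\<Prod>j\<in>J - U. g j) * (\<Prod>j\<in>U. g j)" for g :: "_ \<Rightarrow> 'b"
    using J(1) by (intro prod.subset_diff) (auto simp: U_def)
  have finU: "finite U" using J(1) by (auto simp: U_def)
  have "idl ((\<lambda>g y. g (\<Psi> y)) ` G) (\<lambda>y. \<Prod>j\<in>U. f j (\<Psi> y))"
  proof (rule idl_cancel_prod[OF inf, of K' _ "J - U"])
    show "linform \<kappa>" if "\<kappa> \<in> K'" for \<kappa>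
      using that K lin by (auto simp: K'_def intro!: linform_comp[OF _ lin\<Psi>])
    show "pfun g" if "g \<in> (\<lambda>g y. g (\<Psi> y)) ` G" for g using that G pf\<Psi> by auto
    show "tinv K' g" if "g \<in> (\<lambda>g y. g (\<Psi> y)) ` G" for g
    proof -
      obtain g' where "g' \<in> G" "g = (\<lambda>y. g' (\<Psi> y))" using \<open>g \<in> _\<close> by blast
      then show ?thesis using G(2)[of g'] by (simp add: tinv_def vK' \<Psi>add)
    qed
    show "finite (J - U)" using J by simp
    show "pfun (\<lambda>y. \<Prod>j\<in>U. f j (\<Psi> y))"
      using J(2) lin by (intro pfun_prod pf\<Psi> linform_pfun) (auto simp: U_def)
    show "linform (\<lambda>y. f j (\<Psi> y))" if "j \<in> J - U" for j
      using that J(2) lin by (intro linform_comp[OF _ lin\<Psi>]) auto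
    show "\<exists>w. vanish K' w \<and> f j (\<Psi> w) \<noteq> 0" if "j \<in> J - U" for j
      unfolding vK' using that J(2) by (intro pres K) (auto simp: U_def)
    show "idl ((\<lambda>g y. g (\<Psi> y)) ` G) (\<lambda>y. (\<Prod>j\<in>J - U. f j (\<Psi> y)) * (\<Prod>j\<in>U. f j (\<Psi> y)))"
      using idl unfolding split .
  qed
  moreover obtain \<Theta> where \<Theta>: "\<And>i. linform (\<lambda>v. \<Theta> v i)" "\<And>v. vanish K (\<lambda>i. \<Psi> (\<Theta> v) i - v i)"
    using section_mod_kernel[of K] K by auto
  moreover have "pfun (\<lambda>v. g (\<Theta> v))" if "pfun g" for g
    using pfun_comp[OF that linform_pfun[OF \<Theta>(1)]] .
  ultimately have *: "idl ((\<lambda>g v. g (\<Theta> v)) ` (\<lambda>g y. g (\<Psi> y)) ` G) (\<lambda>v. \<Prod>j\<in>U. f j (\<Psi> (\<Theta> v)))"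
    by (intro idl_comp[of _ "\<lambda>y. \<Prod>j\<in>U. f j (\<Psi> y)" \<Theta>]) blast+
  have inv: "g (\<Psi> (\<Theta> v)) = g v" if "tinv K g" for g v
    using that[unfolded tinv_def, rule_format, OF \<Theta>(2)[of v], of v] by simp
  have "(\<lambda>v. \<Prod>j\<in>U. f j (\<Psi> (\<Theta> v))) = (\<lambda>v. \<Prod>j\<in>U. f j v)"
  proof (intro ext prod.cong refl)
    fix v j assume "j \<in> U"
    then show "f j (\<Psi> (\<Theta> v)) = f j v" by (intro inv) (simp add: U_def)
  qed
  moreover have "(\<lambda>g v. g (\<Theta> v)) ` (\<lambda>g y. g (\<Psi> y)) ` G = G"
  proof -
    have "(\<lambda>v. g (\<Psi> (\<Theta> v))) = g" if "g \<in> G" for g by (intro ext inv G(2) that)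
    then show ?thesis by (simp add: image_image)
  qed
  ultimately have "idl G (\<lambda>v. \<Prod>j\<in>U. f j v)" using * by simp
  then have "idl G (\<lambda>v. (\<Prod>j\<in>J - U. f j v) * (\<Prod>j\<in>U. f j v))"
    by (rule idl_mult) (intro pfun_prod linform_pfun lin J(2), simp)
  then show ?thesis unfolding split .
qed

text \<open>A minimal subproduct of \<open>T\<close> still witnessing nonmembership involves, modulo \<open>K\<close>, a single
  direction: otherwise it splits into two coprime parts, one of which is cancellable modulo the
  other.\<close>

lemma exists_node:
  assumes K: "finite K" "K \<subseteq> L"
    and G: "\<And>g. g \<in> G \<Longrightarrow> pfun g" "\<And>g. g \<in> G \<Longrightarrow> tinv K g"
    and J: "finite J" "\<And>j. j \<in> J \<Longrightarrow> f j \<in> L" and C: "pfun C"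
    and notin: "\<not> idl (insert (\<lambda>v. \<Prod>j\<in>J. f j v) G) C"
  obtains S j0 where "S \<subseteq> J" "j0 \<in> J" "\<not> idl (insert (\<lambda>v. \<Prod>j\<in>S. f j v) G) C"
    "tinv (insert (f j0) K) (\<lambda>v. \<Prod>j\<in>S. f j v)"
proof -
  define Q where "Q = (\<lambda>S v. \<Prod>j\<in>S. f j v)"
  define P where "P = (\<lambda>S. S \<subseteq> J \<and> \<not> idl (insert (Q S) G) C)"
  have "P J" using notin by (simp add: P_def Q_def)
  then obtain S where S: "P S" and min: "\<And>S'. P S' \<Longrightarrow> card S \<le> card S'"
    using ex_has_least_nat[of P J card] by blast
  have finS: "finite S" and SJ: "S \<subseteq> J" using S J finite_subset by (auto simp: P_def)
  have less: "idl (insert (Q S') G) C" if "S' \<subset> S" for S'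
  proof -
    have "\<not> P S'" using min[of S'] psubset_card_mono[OF finS that] by auto
    then show ?thesis using that SJ by (auto simp: P_def)
  qed
  \<comment> \<open>The empty product is 1, and the ideal would contain everything.\<close>
  have "S \<noteq> {}"
  proof
    assume "S = {}"
    then have "idl G (\<lambda>v. C v - C v * Q S v)" by (simp add: Q_def idl.zero)
    then have "idl (insert (Q S) G) C" by (rule idl_insertI[OF C])
    then show False using S by (simp add: P_def)
  qed
  then obtain j0 where j0: "j0 \<in> S" by blast
  define K' where "K' = insert (f j0) K"
  have K': "linform \<kappa>" if "\<kappa> \<in> K'" for \<kappa> using that K J SJ j0 lin by (auto simp: K'_def)
  define A where "A = {j \<in> S. tinv K' (f j)}"
  have finA: "finite A" "finite (S - A)" using finS by (auto simp: A_def)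
  have j0A: "j0 \<in> A" using j0 K' by (auto simp: A_def tinv_linform K'_def) (auto simp: vanish_def)
  have tA: "tinv K' (Q A)" unfolding Q_def by (rule tinv_prod) (simp add: A_def)
  have pQ: "pfun (Q S')" if "S' \<subseteq> S" for S'
    unfolding Q_def using that SJ J lin by (intro pfun_prod linform_pfun) auto
  have "S - A = {}"
  proof (rule ccontr)
    assume "S - A \<noteq> {}"
    then have "A \<subset> S" "S - A \<subset> S" using j0A by (auto simp: A_def)
    \<comment> \<open>By minimality both partial products capture \<open>C\<close>. Modulo
      \<open>G\<close>, \<open>C\<close> is \<open>b\<close> times the product over
      \<open>S - A\<close>. Modulo \<open>Q A\<close> that product can be cancelled, so
      \<open>b\<close> is a multiple of \<open>Q A\<close>, and \<open>C\<close> would lie in the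
      ideal of \<open>Q S\<close>.\<close>
    then have inA: "idl (insert (Q A) G) C" and inB: "idl (insert (Q (S - A)) G) C" using less by auto
    obtain b where b: "pfun b" "idl G (\<lambda>v. C v - b v * Q (S - A) v)" using idl_insertD[OF inB] by blast
    have "idl (insert (Q A) G) (\<lambda>v. C v - (C v - b v * Q (S - A) v))"
      by (rule idl_diff[OF inA idl_mono[OF b(2)]]) auto
    then have "idl (insert (Q A) G) (\<lambda>v. (\<Prod>j\<in>S - A. f j v) * b v)"
      by (simp add: Q_def mult.commute)
    then have "idl (insert (Q A) G) b"
    proof (rule idl_cancel_prod[OF inf K', rotated -1])
      show "pfun g" if "g \<in> insert (Q A) G" for g using that G pQ[of A] by (auto simp: A_def)
      show "tinv K' g" if "g \<in> insert (Q A) G" for g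
        using that tA tinv_mono[OF G(2), of g K'] by (auto simp: K'_def)
      show "linform (f j)" if "j \<in> S - A" for j using that SJ J lin by auto
      then show "\<exists>w. vanish K' w \<and> f j w \<noteq> 0" if "j \<in> S - A" for j
        using that tinv_linform[of "f j" K'] by (auto simp: A_def)
    qed (use b finA in auto)
    then obtain a where a: "pfun a" "idl G (\<lambda>v. b v - a v * Q A v)" using idl_insertD by blast
    have "idl G (\<lambda>v. (C v - b v * Q (S - A) v) + Q (S - A) v * (b v - a v * Q A v))"
      by (intro idl_add b idl_mult a pQ) auto
    moreover have "Q S v = Q A v * Q (S - A) v" for v
      unfolding Q_def using finS prod.subset_diff[of A S] by (auto simp: A_def mult.commute)
    ultimately have "idl G (\<lambda>v. C v - a v * Q S v)" by (simp add: algebra_simps)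
    then show False using idl_insertI[OF a(1)] S by (auto simp: P_def)
  qed
  then have "A = S" by (auto simp: A_def)
  then show ?thesis using that[of S j0] S SJ j0 tA by (auto simp: P_def Q_def K'_def)
qed

text \<open>A summand leaves \<open>I\<close> whenever a form enters \<open>K\<close>, so
  \<open>card K + card I \<le> k\<close> persists and leaves \<open>card K < k\<close> for the
  treatment of each summand.\<close>

lemma sum_prod_notin_idl:
  fixes d :: nat
  assumes "finite I" "\<And>i j. i \<in> I \<Longrightarrow> j < d \<Longrightarrow> f i j \<in> L"
    and "finite K" "K \<subseteq> L" "card K + card I \<le> k"
    and "\<And>g. g \<in> G \<Longrightarrow> pfun g" "\<And>g. g \<in> G \<Longrightarrow> tinv K g" "\<And>g. g \<in> G \<Longrightarrow> \<exists>i. hfun i g"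
    and "\<not> idl G (\<lambda>v. \<Sum>i\<in>I. \<Prod>j<d. f i j v)"
  shows "\<not> idl ((\<lambda>g y. g (\<Psi> y)) ` G) (\<lambda>y. \<Sum>i\<in>I. \<Prod>j<d. f i j (\<Psi> y))"
  using assms
proof (induction I arbitrary: K G rule: finite_induct)
  case empty
  then show ?case using idl.zero by fastforce
next
  case (insert i I)
  define T where "T = (\<lambda>i v. \<Prod>j<d. f i j v)"
  define C where "C = (\<lambda>v. \<Sum>i\<in>insert i I. T i v)"
  have hT: "hfun d (T i')" if "i' \<in> insert i I" for i'
  proof -
    have "hfun (card {..<d}) (T i')"
      unfolding T_def by (rule hfun_prod) (use insert.prems(1)[OF that] lin linform_hfun in auto)
    then show ?thesis by simp
  qed
  have hC: "hfun d C" unfolding C_def by (rule hfun_sum) (rule hT)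
  have C: "C v = T i v + (\<Sum>i\<in>I. T i v)" for v unfolding C_def using insert.hyps by simp
  have notin: "\<not> idl G C" using insert.prems(8) by (simp add: C_def T_def)
  have card: "card K < k" "card K + 1 + card I \<le> k" using insert.prems(4) insert.hyps by auto
  have comp: "idl ((\<lambda>g y. g (\<Psi> y)) ` G) (\<lambda>y. h (\<Psi> y))" if "idl G h" for G h
    by (rule idl_comp[OF that]) (rule pfun_comp[OF _ linform_pfun[OF lin\<Psi>]])
  show ?case
  proof (cases "idl (insert (T i) G) C")
    case True
    \<comment> \<open>\<open>C\<close> and \<open>\<alpha> * T i\<close> agree modulo the ideal
      before and after the substitution. Since \<open>\<alpha>\<close> cannot be 0, the sum is
      thereby exchanged for the single product \<open>T i\<close>, to which
      \<open>prod_notin_idl\<close> applies.\<close>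
    then obtain \<alpha> where \<alpha>: "idl G (\<lambda>v. C v - \<alpha> * T i v)"
      using idl_insert_homogeneous[OF inf hC hT insert.prems(7)] by blast
    show ?thesis
    proof
      assume "idl ((\<lambda>g y. g (\<Psi> y)) ` G) (\<lambda>y. \<Sum>i\<in>insert i I. \<Prod>j<d. f i j (\<Psi> y))"
      then have "idl ((\<lambda>g y. g (\<Psi> y)) ` G) (\<lambda>y. C (\<Psi> y))" by (simp add: C_def T_def)
      from idl_diff[OF this comp[OF \<alpha>]]
      have *: "idl ((\<lambda>g y. g (\<Psi> y)) ` G) (\<lambda>y. \<alpha> * T i (\<Psi> y))" by simp
      have "\<alpha> \<noteq> 0" using \<alpha> notin by auto
      then have "(\<lambda>y. 1 / \<alpha> * (\<alpha> * T i (\<Psi> y))) = (\<lambda>y. \<Prod>j<d. f i j (\<Psi> y))"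
        by (simp add: T_def)
      with idl_cmult[OF *, of "1 / \<alpha>"]
      have **: "idl ((\<lambda>g y. g (\<Psi> y)) ` G) (\<lambda>y. \<Prod>j<d. f i j (\<Psi> y))" by (simp only:)
      have "f i j \<in> L" if "j \<in> {..<d}" for j using insert.prems(1) that by simp
      from prod_notin_idl[OF insert.prems(2,3) card(1) insert.prems(5,6) _ this **]
      have "idl G (T i)" unfolding T_def by simp
      from idl_add[OF \<alpha> idl_cmult[OF this, of \<alpha>]]
      show False using notin by simp
    qed
  next
    case False
    obtain S j0 where S: "S \<subseteq> {..<d}" "j0 \<in> {..<d}" "\<not> idl (insert (\<lambda>v. \<Prod>j\<in>S. f i j v) G) C"
      "tinv (insert (f i j0) K) (\<lambda>v. \<Prod>j\<in>S. f i j v)"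
    proof (rule exists_node[OF insert.prems(2,3,5,6) _ _ hfun_imp_pfun[OF hC] False[unfolded T_def]])
      show "f i j \<in> L" if "j \<in> {..<d}" for j using insert.prems(1) that by simp
    qed auto
    define Q where "Q = (\<lambda>v. \<Prod>j\<in>S. f i j v)"
    define G' where "G' = insert Q G"
    have finS: "finite S" using S(1) finite_subset by blast
    have lS: "linform (f i j)" if "j \<in> S" for j using that S(1) insert.prems(1) lin by blast
    have "T i = (\<lambda>v. (\<Prod>j\<in>{..<d} - S. f i j v) * Q v)"
      unfolding T_def Q_def using S(1) by (intro ext prod.subset_diff) auto
    moreover have "idl G' (\<lambda>v. (\<Prod>j\<in>{..<d} - S. f i j v) * Q v)"
    proof (rule idl_mult[OF idl_base])
      show "pfun (\<lambda>v. \<Prod>j\<in>{..<d} - S. f i j v)"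
        using insert.prems(1) lin by (intro pfun_prod linform_pfun) auto
    qed (simp add: G'_def)
    ultimately have TG': "idl G' (T i)" by simp
    have Q: "pfun Q" "hfun (card S) Q" "tinv (insert (f i j0) K) Q"
      unfolding Q_def using finS lS S(4) by (auto intro: pfun_prod hfun_prod linform_pfun linform_hfun)
    \<comment> \<open>\<open>T i\<close> is a multiple of the new generator, so modulo
      \<open>G'\<close> the full sum agrees with the sum over the smaller \<open>I\<close>; the
      direction \<open>f i j0\<close> is all that \<open>K\<close> has to gain.\<close>
    have IH: "\<not> idl ((\<lambda>g y. g (\<Psi> y)) ` G') (\<lambda>y. \<Sum>i\<in>I. \<Prod>j<d. f i j (\<Psi> y))"
    proof (rule insert.IH[of "insert (f i j0) K" G'])
      show "\<not> idl G' (\<lambda>v. \<Sum>i\<in>I. \<Prod>j<d. f i j v)"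
      proof
        assume "idl G' (\<lambda>v. \<Sum>i\<in>I. \<Prod>j<d. f i j v)"
        then have "idl G' (\<lambda>v. T i v + (\<Sum>i\<in>I. T i v))"
          using idl_add[OF TG'] by (simp add: T_def)
        then show False using S(3) by (simp add: C[symmetric] G'_def Q_def)
      qed
      show "card (insert (f i j0) K) + card I \<le> k"
        using card card_insert_le_m1[of "Suc (card K)" K "f i j0"] by simp
      show "insert (f i j0) K \<subseteq> L" using insert.prems(1,3) S(2) by simp
      show "pfun g" if "g \<in> G'" for g using that Q(1) insert.prems(5) by (auto simp: G'_def)
      show "tinv (insert (f i j0) K) g" if "g \<in> G'" for g
        using that Q(3) tinv_mono[OF insert.prems(6) subset_insertI] by (auto simp: G'_def)
      show "\<exists>i. hfun i g" if "g \<in> G'" for g using that Q(2) insert.prems(7) by (auto simp: G'_def)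
    qed (use insert.prems in auto)
    show ?thesis
    proof
      assume "idl ((\<lambda>g y. g (\<Psi> y)) ` G) (\<lambda>y. \<Sum>i\<in>insert i I. \<Prod>j<d. f i j (\<Psi> y))"
      then have "idl ((\<lambda>g y. g (\<Psi> y)) ` G') (\<lambda>y. C (\<Psi> y))"
        unfolding C_def T_def G'_def by (rule idl_mono) (rule image_mono, rule subset_insertI)
      from idl_diff[OF this comp[OF TG']] show False using IH by (simp add: C T_def)
    qed
  qed
qed

lemma sum_prod_nonzero:
  fixes d :: nat
  assumes "\<And>i j. i < k \<Longrightarrow> j < d \<Longrightarrow> f i j \<in> L" "(\<Sum>i<k. \<Prod>j<d. f i j v) \<noteq> 0"
  obtains y where "(\<Sum>i<k. \<Prod>j<d. f i j (\<Psi> y)) \<noteq> 0"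
proof -
  have emp: "h = (\<lambda>_. 0)" if "idl {} h" for h :: "(nat \<Rightarrow> 'b) \<Rightarrow> 'b"
    using that by (induction rule: idl.induct) auto
  have "\<not> idl {} (\<lambda>v. \<Sum>i<k. \<Prod>j<d. f i j v)" using emp assms(2) by metis
  then have "\<not> idl ((\<lambda>g y. g (\<Psi> y)) ` {}) (\<lambda>y. \<Sum>i<k. \<Prod>j<d. f i j (\<Psi> y))"
    using assms(1) by (intro sum_prod_notin_idl[of _ _ _ "{}"]) auto
  then have "(\<lambda>y. \<Sum>i<k. \<Prod>j<d. f i j (\<Psi> y)) \<noteq> (\<lambda>_. 0)" using idl.zero by (metis image_empty)
  then show ?thesis using that by (auto simp: fun_eq_iff)
qed

end

section \<open>Vandermonde projections\<close>

lemma infinite_fract_poly: "infinite (UNIV :: 'a::field poly fract set)"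
proof
  assume "finite (UNIV :: 'a poly fract set)"
  moreover have "inj (\<lambda>n::nat. to_fract (monom 1 n :: 'a poly))"
    by (rule injI) (auto simp: monom_eq_iff')
  ultimately show False using finite_imageD[of "\<lambda>n::nat. to_fract (monom 1 n :: 'a poly)" UNIV]
    finite_subset[of _ "UNIV :: 'a poly fract set"] by auto
qed

text \<open>If \<open>f b\<close> does not vanish on the common kernel of the others, some
  \<open>y0\<close> in that kernel has \<open>f b y0 \<noteq> 0\<close>. Subtracting the multiple of
  \<open>f b\<close> that agrees with \<open>g\<close> at \<open>y0\<close> leaves a form that
  depends on the others only. If there is no such \<open>y0\<close>, then \<open>f b\<close> can be
  omitted.\<close>

lemma linform_combination:
  assumes "finite A" "\<And>a. a \<in> A \<Longrightarrow> linform (f a)" "linform g"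
    and "\<And>y. (\<And>a. a \<in> A \<Longrightarrow> f a y = 0) \<Longrightarrow> g y = 0"
  shows "\<exists>c. \<forall>y. g y = (\<Sum>a\<in>A. c a * f a y)"
  using assms
proof (induction A arbitrary: g rule: finite_induct)
  case empty
  then show ?case by simp
next
  case (insert b A)
  show ?case
  proof (cases "\<exists>y0. (\<forall>a\<in>A. f a y0 = 0) \<and> f b y0 \<noteq> 0")
    case True
    then obtain y0 where y0: "\<And>a. a \<in> A \<Longrightarrow> f a y0 = 0" "f b y0 \<noteq> 0" by blast
    define s where "s = g y0 / f b y0"
    have "linform (\<lambda>y. g y + (- s) * f b y)"
      using insert.prems by (intro linform_plus linform_cmult) auto
    moreover have "g y + (- s) * f b y = 0" if y: "\<And>a. a \<in> A \<Longrightarrow> f a y = 0" for y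
    proof -
      define t where "t = - (f b y / f b y0)"
      have "g (\<lambda>i. y i + t * y0 i) = 0"
      proof (rule insert.prems(3))
        fix a assume "a \<in> insert b A"
        then show "f a (\<lambda>i. y i + t * y0 i) = 0"
          using y y0 linform_linear[OF insert.prems(1), of a y t y0] by (auto simp: t_def)
      qed
      then have "g y + t * g y0 = 0" using linform_linear[OF insert.prems(2)] by simp
      then show ?thesis by (simp add: t_def s_def mult.commute)
    qed
    ultimately obtain c where "\<And>y. g y + (- s) * f b y = (\<Sum>a\<in>A. c a * f a y)"
      using insert.IH[of "\<lambda>y. g y + (- s) * f b y"] insert.prems(1) by blast
    then have c: "g y = s * f b y + (\<Sum>a\<in>A. c a * f a y)" for y
      by (metis add.commute add_diff_cancel_left' diff_conv_add_uminus diff_add_cancel mult_minus_left)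
    define c' where "c' = c(b := s)"
    have "(\<Sum>a\<in>A. c' a * f a y) = (\<Sum>a\<in>A. c a * f a y)" for y
      using insert.hyps(2) by (intro sum.cong) (auto simp: c'_def)
    then have "\<forall>y. g y = (\<Sum>a\<in>insert b A. c' a * f a y)"
      using c insert.hyps by (simp add: c'_def)
    then show ?thesis by blast
  next
    case False
    then have "g y = 0" if "\<And>a. a \<in> A \<Longrightarrow> f a y = 0" for y
      using that by (intro insert.prems(3)) auto
    then obtain c where c: "\<And>y. g y = (\<Sum>a\<in>A. c a * f a y)"
      using insert.IH[of g] insert.prems(1,2) by blast
    define c' where "c' = c(b := 0)"
    have "(\<Sum>a\<in>A. c' a * f a y) = (\<Sum>a\<in>A. c a * f a y)" for y
      using insert.hyps(2) by (intro sum.cong) (auto simp: c'_def)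
    then have "\<forall>y. g y = (\<Sum>a\<in>insert b A. c' a * f a y)"
      using c insert.hyps by (simp add: c'_def)
    then show ?thesis by blast
  qed
qed

text \<open>The degree of \<open>z\<^sup>i B\<^sub>i(z\<^sup>j)\<close> is a line in \<open>j\<close> with slope \<open>degree B\<^sub>i\<close>. If the sum vanishes at \<open>j\<close> then
  the upper envelope of these lines breaks at \<open>j\<close>, so the slope of the envelope increases \<open>k\<close> times.\<close>

lemma many_degrees:
  fixes B :: "nat \<Rightarrow> 'a::field poly"
  assumes I: "finite I" "I \<noteq> {}" "\<And>i. i \<in> I \<Longrightarrow> B i \<noteq> 0"
    and 0: "\<And>j. j < k \<Longrightarrow> (\<Sum>i\<in>I. monom 1 i * pcompose (B i) (monom 1 (Suc j))) = 0"
  shows "k < card ((\<lambda>i. degree (B i)) ` I)"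
proof -
  define val where "val = (\<lambda>j i. i + j * degree (B i))"
  have ties: "\<exists>i1\<in>I. \<exists>i2\<in>I. degree (B i1) < degree (B i2) \<and>
      (\<forall>i\<in>I. val (Suc j) i \<le> val (Suc j) i1) \<and> (\<forall>i\<in>I. val (Suc j) i \<le> val (Suc j) i2)"
    if "j < k" for j
  proof -
    \<comment> \<open>If a single line attained the maximum \<open>\<mu>\<close>, its leading term
      could not cancel. Two lines that attain it have different slopes because they have different
      intercepts.\<close>
    define \<mu> where "\<mu> = Max (val (Suc j) ` I)"
    have "\<mu> \<in> val (Suc j) ` I" unfolding \<mu>_def using I by (intro Max_in) auto
    then obtain i1 where i1: "i1 \<in> I" "val (Suc j) i1 = \<mu>" by auto
    have max: "val (Suc j) i \<le> \<mu>" if "i \<in> I" for i unfolding \<mu>_def using I that by simp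
    have deg: "degree (pcompose (B i) (monom 1 (Suc j))) = Suc j * degree (B i)" for i
      by (simp add: degree_pcompose degree_monom_eq)
    have lc: "lead_coeff (pcompose (B i) (monom 1 (Suc j))) = lead_coeff (B i)" for i
      by (subst lead_coeff_comp) (simp_all add: degree_monom_eq)
    have "\<exists>i2\<in>I. i2 \<noteq> i1 \<and> val (Suc j) i2 = \<mu>"
    proof (rule ccontr)
      assume neg: "\<not> ?thesis"
      have "coeff (monom 1 i * pcompose (B i) (monom 1 (Suc j))) \<mu> = (if i = i1 then lead_coeff (B i1) else 0)"
        if "i \<in> I" for i
      proof (cases "i = i1")
        case True
        have "Suc j * degree (B i1) = \<mu> - i1" "i1 \<le> \<mu>" using i1(2) by (auto simp: val_def)
        then show ?thesis using True lc[of i1] deg[of i1] by (simp add: coeff_monom_mult)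
      next
        case False
        then have "val (Suc j) i < \<mu>" using neg max[OF that] that by fastforce
        then have "degree (pcompose (B i) (monom 1 (Suc j))) < \<mu> - i" unfolding deg val_def by linarith
        then show ?thesis using False by (simp add: coeff_monom_mult coeff_eq_0)
      qed
      then have "coeff (\<Sum>i\<in>I. monom 1 i * pcompose (B i) (monom 1 (Suc j))) \<mu> = lead_coeff (B i1)"
        using I(1) i1(1) by (simp add: coeff_sum)
      then show False using 0[OF \<open>j < k\<close>] I(3)[OF i1(1)] by simp
    qed
    then obtain i2 where i2: "i2 \<in> I" "i2 \<noteq> i1" "val (Suc j) i2 = \<mu>" by blast
    then have "degree (B i1) \<noteq> degree (B i2)" using i1 by (auto simp: val_def)
    then show ?thesis using i1 i2 max by (metis linorder_neqE_nat)
  qed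
  \<comment> \<open>The induction maintains a line that is highest at \<open>j\<close> with at least
    \<open>j\<close> smaller slopes. The lines highest at the next point are at least as steep, and
    the steeper of two such lines gains the slope of the flatter one.\<close>
  have "\<exists>i\<in>I. (\<forall>i'\<in>I. val j i' \<le> val j i) \<and> j \<le> card {\<delta> \<in> (\<lambda>i. degree (B i)) ` I. \<delta> < degree (B i)}"
    if "j \<le> k" for j
    using that
  proof (induction j)
    case 0
    have "Max I \<in> I" "\<And>i. i \<in> I \<Longrightarrow> i \<le> Max I" using I by auto
    then show ?case by (auto simp: val_def)
  next
    case (Suc j)
    then obtain i where i: "i \<in> I" "\<And>i'. i' \<in> I \<Longrightarrow> val j i' \<le> val j i"
      and card: "j \<le> card {\<delta> \<in> (\<lambda>i. degree (B i)) ` I. \<delta> < degree (B i)}" by auto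
    obtain i1 i2 where i12: "i1 \<in> I" "i2 \<in> I" "degree (B i1) < degree (B i2)"
      "\<And>i. i \<in> I \<Longrightarrow> val (Suc j) i \<le> val (Suc j) i1" "\<And>i. i \<in> I \<Longrightarrow> val (Suc j) i \<le> val (Suc j) i2"
      using ties[of j] Suc.prems by auto
    have le: "degree (B i) \<le> degree (B i1)" using i(2)[OF i12(1)] i12(4)[OF i(1)] by (simp add: val_def)
    have "insert (degree (B i1)) {\<delta> \<in> (\<lambda>i. degree (B i)) ` I. \<delta> < degree (B i)}
        \<subseteq> {\<delta> \<in> (\<lambda>i. degree (B i)) ` I. \<delta> < degree (B i2)}" using le i12 by auto
    from card_mono[OF _ this] have "Suc j \<le> card {\<delta> \<in> (\<lambda>i. degree (B i)) ` I. \<delta> < degree (B i2)}"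
      using I(1) le card by simp
    then show ?case using i12 by blast
  qed
  from this[of k] obtain i where i: "i \<in> I"
    "k \<le> card {\<delta> \<in> (\<lambda>i. degree (B i)) ` I. \<delta> < degree (B i)}" by auto
  \<comment> \<open>The slope of the line itself is one more degree beyond the \<open>k\<close>
    smaller ones.\<close>
  have "{\<delta> \<in> (\<lambda>i. degree (B i)) ` I. \<delta> < degree (B i)} \<subset> (\<lambda>i. degree (B i)) ` I" using i by blast
  from psubset_card_mono[OF _ this] show ?thesis using I(1) i(2) by simp
qed

text \<open>Nonzero polynomials of distinct degrees are linearly independent, so the span of
  \<open>L\<close> contains at most \<open>card L\<close> of them. \<open>S\<close> selects one
  polynomial for every degree.\<close>

lemma card_degrees_le:
  fixes L :: "'a::field poly set"
  assumes "finite L" "finite I" and B: "\<And>i. i \<in> I \<Longrightarrow> B i = (\<Sum>l\<in>L. smult (c i l) l)" "\<And>i. i \<in> I \<Longrightarrow> B i \<noteq> 0"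
  shows "card ((\<lambda>i. degree (B i)) ` I) \<le> card L"
proof -
  interpret vector_space "smult :: 'a \<Rightarrow> 'a poly \<Rightarrow> 'a poly"
    by standard (auto simp: smult_add_right smult_add_left)
  have "\<exists>S\<subseteq>B ` I. inj_on degree S \<and> degree ` B ` I = degree ` S"
    by (rule subset_image_inj[THEN iffD1]) (rule subset_refl)
  then obtain S where S: "S \<subseteq> B ` I" "inj_on degree S" "degree ` B ` I = degree ` S"
    by blast
  have finS: "finite S" by (rule finite_subset[OF S(1)]) (simp add: assms(2))
  have "independent S"
  proof (rule independent_if_scalars_zero[OF finS])
    fix f x assume 0: "(\<Sum>x\<in>S. smult (f x) x) = 0" and x: "x \<in> S"
    show "f x = 0"
    proof (rule ccontr)
      assume "f x \<noteq> 0"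
      define M where "M = {y \<in> S. f y \<noteq> 0}"
      have M: "finite M" "M \<noteq> {}" using finS x \<open>f x \<noteq> 0\<close> by (auto simp: M_def)
      have "Max (degree ` M) \<in> degree ` M" using M by (intro Max_in) auto
      then obtain y where y: "y \<in> M" and max: "Max (degree ` M) = degree y" by auto
      have le: "degree w \<le> degree y" if "w \<in> M" for w
        using Max_ge[of "degree ` M" "degree w"] M(1) that max by auto
      have "coeff (smult (f w) w) (degree y) = (if w = y then f y * lead_coeff y else 0)" if "w \<in> S" for w
      proof (cases "w = y \<or> w \<notin> M")
        case False
        then have "degree w \<noteq> degree y" using inj_onD[OF S(2), of w y] that y by (auto simp: M_def)
        then have "degree w < degree y" using le[of w] False by simp
        then show ?thesis using False by (simp add: coeff_eq_0)
      next
        case True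
        then show ?thesis using that y by (cases "w = y") (simp_all add: M_def)
      qed
      then have "coeff (\<Sum>x\<in>S. smult (f x) x) (degree y)
          = (\<Sum>w\<in>S. if w = y then f y * lead_coeff y else 0)"
        unfolding coeff_sum by (rule sum.cong[OF refl])
      also have "\<dots> = f y * lead_coeff y" using finS y by (simp add: M_def)
      finally have "f y * lead_coeff y = 0" using 0 by simp
      moreover have "y \<noteq> 0" using y S(1) B(2) by (auto simp: M_def)
      ultimately show False using y by (simp add: M_def)
    qed
  qed
  moreover have "S \<subseteq> span L"
  proof
    fix x assume "x \<in> S"
    then obtain i where "i \<in> I" "x = B i" using S(1) by blast
    then show "x \<in> span L" using B(1)[of i] by (simp add: span_sum span_scale span_base)
  qed
  ultimately have "card S \<le> card L" using independent_span_bound[OF assms(1)] by blast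
  moreover have "card S = card ((\<lambda>i. degree (B i)) ` I)"
    using card_image[OF S(2)] S(3) by (simp only: image_image)
  ultimately show ?thesis by simp
qed

lemma monom_mult_eq: "monom c i * p = smult c (monom 1 i * p)" for c :: "'a::comm_semiring_1"
  by (metis mult.right_neutral mult_smult_left smult_monom)

text \<open>Linear forms over \<open>F\<close> are coded by polynomials \<open>L\<close> whose coefficients are those of the form, so that
  the form takes the value \<open>L(z\<^sup>j)\<close> at the Vandermonde point \<open>(z\<^bsup>l j\<^esup>)\<^sub>l\<close>. The homogenizing variable has
  index 0; \<open>vdm\<close> maps it to a variable of its own, which can be set to 1 again.\<close>

definition lf :: "'a::field poly \<Rightarrow> (nat \<Rightarrow> 'a poly fract) \<Rightarrow> 'a poly fract" where
  "lf L v = (\<Sum>i\<le>degree L. to_fract [:coeff L i:] * v i)"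

lemma lf_bound: "degree L \<le> N \<Longrightarrow> lf L v = (\<Sum>i\<le>N. to_fract [:coeff L i:] * v i)"
  unfolding lf_def by (rule sum.mono_neutral_left) (auto simp: coeff_eq_0)

lemma linform_lf: "linform (lf L)"
  by (rule linformI[of _ "\<lambda>i. to_fract [:coeff L i:]" "Suc (degree L)"]) (simp add: lf_def lessThan_Suc_atMost)

lemma lf_0: "lf 0 v = 0"
  by (simp add: lf_def)

lemma lf_add: "lf (L + M) v = lf L v + lf M v"
proof -
  let ?N = "max (degree L) (degree M)"
  have "lf (L + M) v = (\<Sum>i\<le>?N. to_fract [:coeff (L + M) i:] * v i)"
    by (rule lf_bound) (rule degree_add_le_max)
  also have "\<dots> = (\<Sum>i\<le>?N. to_fract [:coeff L i:] * v i) + (\<Sum>i\<le>?N. to_fract [:coeff M i:] * v i)"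
    by (simp add: sum.distrib[symmetric] distrib_right[symmetric] to_fract_add[symmetric] del: to_fract_add)
  finally show ?thesis using lf_bound[of L ?N v] lf_bound[of M ?N v] by simp
qed

lemma lf_smult: "lf (smult c L) v = to_fract [:c:] * lf L v"
proof -
  have "lf (smult c L) v = (\<Sum>i\<le>degree L. to_fract [:coeff (smult c L) i:] * v i)"
    by (rule lf_bound) (rule degree_smult_le)
  moreover have "to_fract [:c * x:] = to_fract [:c:] * to_fract [:x:]" for x :: 'a
    by (simp add: to_fract_mult[symmetric] del: to_fract_mult)
  ultimately show ?thesis by (simp add: lf_def sum_distrib_left mult.assoc)
qed

lemma lf_sum: "lf (\<Sum>a\<in>A. f a) v = (\<Sum>a\<in>A. lf (f a) v)"
  by (induction A rule: infinite_finite_induct) (simp_all add: lf_0 lf_add)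

definition vdm :: "nat \<Rightarrow> (nat \<Rightarrow> 'a::field poly fract) \<Rightarrow> nat \<Rightarrow> 'a poly fract" where
  "vdm k y l = (if l = 0 then y 0 else \<Sum>j<k. to_fract (monom 1 (l * Suc j)) * y (Suc j))"

lemma linform_vdm: "linform (\<lambda>y. vdm k y l)"
  by (cases "l = 0") (auto simp: vdm_def intro!: linform_coord linform_sum linform_cmult)

lemma to_fract_sum: "to_fract (\<Sum>a\<in>A. f a) = (\<Sum>a\<in>A. to_fract (f a))"
  by (induction A rule: infinite_finite_induct) simp_all

lemma to_fract_power: "to_fract (x ^ n) = to_fract x ^ n"
  by (induction n) simp_all

lemma pcompose_monom_eq_sum: "pcompose L (monom 1 j) = (\<Sum>i\<le>degree L. [:coeff L i:] * monom 1 (i * j))"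
  for L :: "'a::field poly"
proof -
  have "pcompose L (monom 1 j) = (\<Sum>i\<le>degree L. pcompose (monom (coeff L i) i) (monom 1 j))"
    by (subst (1) poly_as_sum_of_monoms[of L, symmetric]) (simp add: pcompose_sum)
  moreover have "pcompose (monom c i) (monom 1 j) = [:c:] * monom 1 (i * j)" for c :: 'a and i
    by (induction i) (simp_all add: monom_0 monom_Suc pcompose_pCons mult_monom mult_ac)
  ultimately show ?thesis by simp
qed

text \<open>The indicator of \<open>Suc j\<close> selects one Vandermonde column. The value 1 at
  index 0 supplies the entry for the homogenizing variable, whose exponent is 0.\<close>

lemma lf_vdm:
  fixes L :: "'a::field poly"
  assumes "j < k"
  shows "lf L (vdm k (\<lambda>i. if i = 0 \<or> i = Suc j then 1 else 0)) = to_fract (pcompose L (monom 1 (Suc j)))"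
proof -
  have "vdm k (\<lambda>i. if i = 0 \<or> i = Suc j then 1 else 0) l = to_fract (monom (1::'a) (l * Suc j))" for l
  proof -
    have "(\<Sum>i<k. to_fract (monom 1 (l * Suc i)) * (if Suc i = 0 \<or> Suc i = Suc j then 1 else 0))
      = (\<Sum>i<k. if i = j then to_fract (monom (1::'a) (l * Suc j)) else 0)"
      by (rule sum.cong) auto
    then show ?thesis using assms by (auto simp: vdm_def)
  qed
  then show ?thesis
    by (simp only: lf_def pcompose_monom_eq_sum to_fract_sum to_fract_mult)
qed

lemma common_denominator:
  fixes c :: "'i \<Rightarrow> 'a::field poly fract"
  assumes "finite A"
  obtains q \<gamma> where "q \<noteq> 0" "\<And>a. a \<in> A \<Longrightarrow> to_fract q * c a = to_fract (\<gamma> a)"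
proof -
  have "\<exists>q \<gamma>. q \<noteq> 0 \<and> (\<forall>a\<in>A. to_fract q * c a = to_fract (\<gamma> a))"
    using assms
  proof (induction A rule: finite_induct)
    case empty
    show ?case by (rule exI[of _ 1]) simp
  next
    case (insert b A)
    then obtain q \<gamma> where q: "q \<noteq> 0" "\<And>a. a \<in> A \<Longrightarrow> to_fract q * c a = to_fract (\<gamma> a)" by blast
    obtain x y where xy: "c b = Fract x y" "y \<noteq> 0" by (cases "c b") auto
    then have cb: "to_fract y * c b = to_fract x" by (simp add: to_fract_def eq_fract)
    define \<gamma>' where "\<gamma>' = (\<lambda>a. if a = b then q * x else y * \<gamma> a)"
    have "to_fract (q * y) * c a = to_fract (\<gamma>' a)" if "a \<in> insert b A" for a
    proof (cases "a = b")
      case True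
      then show ?thesis using cb by (simp add: \<gamma>'_def mult.assoc)
    next
      case False
      then show ?thesis using q(2)[of a] that by (simp add: \<gamma>'_def mult_ac)
    qed
    then show ?case using q(1) xy(2) by (intro exI[of _ "q * y"] exI[of _ \<gamma>']) auto
  qed
  then show ?thesis using that by blast
qed

text \<open>If a form became dependent on fewer than \<open>k\<close> others, clearing denominators
  would give a relation over \<open>F[z]\<close> among at most \<open>k\<close> polynomials, valid
  with argument \<open>z ^ j\<close> for \<open>1 \<le> j \<le> k\<close>. This would force more
  than \<open>k\<close> distinct degrees into a space spanned by at most \<open>k\<close>
  polynomials.\<close>

lemma vdm_rank_preserving:
  "rank_preserving (range (lf :: 'a::field poly \<Rightarrow> _)) (vdm k) k"
proof
  show "infinite (UNIV :: 'a poly fract set)" by (rule infinite_fract_poly)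
  show "linform (\<lambda>y. vdm k y i)" for i by (rule linform_vdm)
  show "linform l" if "l \<in> range lf" for l using that linform_lf by auto
  fix K and l :: "(nat \<Rightarrow> 'a poly fract) \<Rightarrow> 'a poly fract"
  assume K: "finite K" "K \<subseteq> range lf" "card K < k" and l: "l \<in> range lf" "\<not> tinv K l"
  obtain L0 where L0: "l = lf L0" using l by auto
  obtain A where A: "K = lf ` A" "inj_on lf A" using subset_image_inj[THEN iffD1, OF K(2)] by auto
  have finA: "finite A" "card A < k" using A K finite_imageD card_image by metis+
  have "L0 \<notin> A"
  proof
    assume "L0 \<in> A"
    then have "tinv K l" using L0 A by (auto simp: tinv_linform linform_lf vanish_def)
    then show False using l by simp
  qed
  show "\<exists>y. vanish K (vdm k y) \<and> l (vdm k y) \<noteq> 0"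
  proof (rule ccontr)
    assume neg: "\<not> ?thesis"
    have "\<exists>c. \<forall>y. lf L0 (vdm k y) = (\<Sum>L\<in>A. c L * lf L (vdm k y))"
    proof (rule linform_combination[OF finA(1)])
      show "lf L0 (vdm k y) = 0" if "\<And>L. L \<in> A \<Longrightarrow> lf L (vdm k y) = 0" for y
        using neg that by (auto simp: L0 A vanish_def)
    qed (auto intro: linform_comp[OF linform_lf linform_vdm])
    then obtain c where c: "\<And>y. lf L0 (vdm k y) = (\<Sum>L\<in>A. c L * lf L (vdm k y))" by blast
    obtain q \<gamma> where q: "q \<noteq> 0" and \<gamma>: "\<And>L. L \<in> A \<Longrightarrow> to_fract q * c L = to_fract (\<gamma> L)"
      using common_denominator[OF finA(1)] by metis
    define \<gamma>' where "\<gamma>' = (\<lambda>L. if L = L0 then - q else \<gamma> L)"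
    define A' where "A' = insert L0 A"
    have A': "finite A'" "card A' \<le> k" using finA \<open>L0 \<notin> A\<close> by (auto simp: A'_def)
    have rel: "(\<Sum>L\<in>A'. \<gamma>' L * pcompose L (monom 1 (Suc j))) = 0" if "j < k" for j
    proof -
      have "to_fract (q * pcompose L0 (monom 1 (Suc j)))
          = (\<Sum>L\<in>A. (to_fract q * c L) * to_fract (pcompose L (monom 1 (Suc j))))"
        using c[of "\<lambda>i. if i = 0 \<or> i = Suc j then 1 else 0"]
        by (simp add: lf_vdm[OF that] sum_distrib_left mult.assoc)
      also have "\<dots> = to_fract (\<Sum>L\<in>A. \<gamma> L * pcompose L (monom 1 (Suc j)))"
        by (simp add: to_fract_sum \<gamma>)
      finally have "q * pcompose L0 (monom 1 (Suc j)) = (\<Sum>L\<in>A. \<gamma> L * pcompose L (monom 1 (Suc j)))"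
        by (simp only: to_fract_eq_iff)
      moreover have "(\<Sum>L\<in>A. \<gamma>' L * pcompose L (monom 1 (Suc j))) = (\<Sum>L\<in>A. \<gamma> L * pcompose L (monom 1 (Suc j)))"
        using \<open>L0 \<notin> A\<close> by (intro sum.cong) (auto simp: \<gamma>'_def)
      ultimately show ?thesis
        using \<open>L0 \<notin> A\<close> finA by (simp add: A'_def) (simp add: \<gamma>'_def)
    qed
    define E where "E = Max ((\<lambda>L. degree (\<gamma>' L)) ` A')"
    have E: "degree (\<gamma>' L) \<le> E" if "L \<in> A'" for L unfolding E_def using A' that by simp
    \<comment> \<open>Sorting the relation by the powers of \<open>z\<close> in its coefficients
      yields the sum of \<open>many_degrees\<close>, with every \<open>B i\<close> in the span of
      \<open>A'\<close> over the ground field.\<close>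
    define B where "B = (\<lambda>i. \<Sum>L\<in>A'. smult (coeff (\<gamma>' L) i) L)"
    define I where "I = {i \<in> {..E}. B i \<noteq> 0}"
    \<comment> \<open>At this index the coefficient of \<open>L0\<close> is
      \<open>- lead_coeff q\<close>, which is not 0. If \<open>B\<close> vanished there,
      \<open>L0\<close> would depend on \<open>A\<close> already over the ground field.\<close>
    have "degree q \<in> I"
    proof -
      have "B (degree q) \<noteq> 0"
      proof
        assume "B (degree q) = 0"
        then have 0: "to_fract [:- lead_coeff q:] * lf L0 v + (\<Sum>L\<in>A. to_fract [:coeff (\<gamma>' L) (degree q):] * lf L v) = 0" for v
        proof -
          assume 0: "B (degree q) = 0"
          have "lf (B (degree q)) v = (\<Sum>L\<in>A'. to_fract [:coeff (\<gamma>' L) (degree q):] * lf L v)"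
            by (simp add: B_def lf_sum lf_smult)
          then show ?thesis using 0 \<open>L0 \<notin> A\<close> finA by (simp add: A'_def lf_0) (simp add: \<gamma>'_def)
        qed
        have "l w = 0" if "vanish K w" for w
        proof -
          have "(\<Sum>L\<in>A. to_fract [:coeff (\<gamma>' L) (degree q):] * lf L w) = 0"
            using that by (intro sum.neutral) (auto simp: A vanish_def)
          then show ?thesis using 0[of w] q by (simp add: L0)
        qed
        then show False using l by (simp add: L0 tinv_linform linform_lf)
      qed
      moreover have "degree q \<le> E" using E[of L0] by (simp add: A'_def \<gamma>'_def)
      ultimately show ?thesis by (simp add: I_def)
    qed
    moreover have "(\<Sum>i\<in>I. monom 1 i * pcompose (B i) (monom 1 (Suc j))) = 0" if "j < k" for j
    proof -
      have "(\<Sum>i\<in>I. monom 1 i * pcompose (B i) (monom 1 (Suc j)))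
          = (\<Sum>i\<le>E. monom 1 i * pcompose (B i) (monom 1 (Suc j)))"
        by (rule sum.mono_neutral_left) (auto simp: I_def)
      also have "\<dots> = (\<Sum>i\<le>E. \<Sum>L\<in>A'. monom (coeff (\<gamma>' L) i) i * pcompose L (monom 1 (Suc j)))"
        by (simp add: B_def pcompose_sum pcompose_smult sum_distrib_left
            monom_mult_eq[of "coeff (\<gamma>' _) _"])
      also have "\<dots> = (\<Sum>L\<in>A'. \<Sum>i\<le>E. monom (coeff (\<gamma>' L) i) i * pcompose L (monom 1 (Suc j)))"
        by (rule sum.swap)
      also have "\<dots> = (\<Sum>L\<in>A'. \<gamma>' L * pcompose L (monom 1 (Suc j)))"
      proof (rule sum.cong[OF refl])
        fix L assume "L \<in> A'"
        then show "(\<Sum>i\<le>E. monom (coeff (\<gamma>' L) i) i * pcompose L (monom 1 (Suc j))) = \<gamma>' L * pcompose L (monom 1 (Suc j))"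
          by (simp add: sum_distrib_right[symmetric] poly_as_sum_of_monoms'[OF E])
      qed
      finally show ?thesis using rel[OF that] by simp
    qed
    ultimately have "k < card ((\<lambda>i. degree (B i)) ` I)"
      by (intro many_degrees) (auto simp: I_def)
    moreover have "card ((\<lambda>i. degree (B i)) ` I) \<le> card A'"
      by (rule card_degrees_le[OF A'(1), of _ _ "\<lambda>i L. coeff (\<gamma>' L) i"]) (auto simp: I_def B_def)
    ultimately show False using A' by simp
  qed
qed

section \<open>Kronecker substitution and the univariate hit\<close>

abbreviation lkp :: "('x \<Rightarrow>\<^sub>0 'y::zero) \<Rightarrow> 'x \<Rightarrow> 'y" where "lkp \<equiv> Poly_Mapping.lookup"
abbreviation keys :: "('x \<Rightarrow>\<^sub>0 'y::zero) \<Rightarrow> 'x set" where "keys \<equiv> Poly_Mapping.keys"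
abbreviation single :: "'x \<Rightarrow> 'y::zero \<Rightarrow> ('x \<Rightarrow>\<^sub>0 'y)" where "single \<equiv> Poly_Mapping.single"

definition mon :: "(nat \<Rightarrow> 'c::comm_semiring_1) \<Rightarrow> (nat \<Rightarrow>\<^sub>0 nat) \<Rightarrow> 'c" where
  "mon a m = (\<Prod>i\<in>keys m. a i ^ lkp m i)"

lemma mon_superset: "finite S \<Longrightarrow> keys m \<subseteq> S \<Longrightarrow> mon a m = (\<Prod>i\<in>S. a i ^ lkp m i)"
  unfolding mon_def by (rule prod.mono_neutral_left) (auto simp: in_keys_iff)

lemma mon_0 [simp]: "mon a 0 = 1"
  by (simp add: mon_def)

lemma mon_add: "mon a (m + m') = mon a m * mon a m'"
proof -
  let ?S = "keys m \<union> keys m'"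
  have "mon a (m + m') = (\<Prod>i\<in>?S. a i ^ lkp (m + m') i)"
    using Poly_Mapping.keys_add[of m m'] by (intro mon_superset) auto
  also have "\<dots> = (\<Prod>i\<in>?S. a i ^ lkp m i) * (\<Prod>i\<in>?S. a i ^ lkp m' i)"
    by (simp add: lookup_add power_add prod.distrib)
  finally show ?thesis using mon_superset[of ?S m a] mon_superset[of ?S m' a] by simp
qed

lemma mon_single [simp]: "mon a (single j 1) = a j"
  by (simp add: mon_def lookup_single)

lemma mon_monom:
  "finite S \<Longrightarrow> keys m \<subseteq> S \<Longrightarrow> mon (\<lambda>i. monom 1 (f i)) m = monom 1 (\<Sum>i\<in>S. f i * lkp m i)"
proof -
  have "(\<Prod>i\<in>S. monom (1::'a::comm_semiring_1) (g i)) = monom 1 (\<Sum>i\<in>S. g i)" if "finite S" for g and S :: "nat set"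
    using that by (induction S rule: finite_induct) (simp_all add: mult_monom)
  then show "finite S \<Longrightarrow> keys m \<subseteq> S \<Longrightarrow> ?thesis"
    by (simp add: mon_superset[of S] monom_power)
qed

lemma poly_mapping_expansion: "p = (\<Sum>m\<in>keys p. single m (lkp p m))"
proof (rule poly_mapping_eqI)
  fix m
  show "lkp p m = lkp (\<Sum>m\<in>keys p. single m (lkp p m)) m"
    by (simp add: lookup_sum lookup_single when_def in_keys_iff)
qed

lemma poly_mapping_mult_expansion:
  "p * q = (\<Sum>m\<in>keys p. \<Sum>m'\<in>keys q. single (m + m') (lkp p m * lkp q m'))"
  by (subst poly_mapping_expansion[of p], subst poly_mapping_expansion[of q])
    (simp add: sum_product mult_single)

text \<open>The coefficient map allows one computation to cover field coefficients sent to constants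
  of \<open>F[z]\<close> or \<open>F(z)\<close>, and coefficients in \<open>F[z]\<close> that are
  kept or embedded in \<open>F(z)\<close>.\<close>

locale coeff_hom =
  fixes \<phi> :: "'a::comm_semiring_1 \<Rightarrow> 'c::comm_semiring_1"
  assumes \<phi>_0: "\<phi> 0 = 0" and \<phi>_1: "\<phi> 1 = 1"
    and \<phi>_add: "\<phi> (x + y) = \<phi> x + \<phi> y" and \<phi>_mult: "\<phi> (x * y) = \<phi> x * \<phi> y"
begin

definition ev :: "(nat \<Rightarrow> 'c) \<Rightarrow> ((nat \<Rightarrow>\<^sub>0 nat) \<Rightarrow>\<^sub>0 'a) \<Rightarrow> 'c" where
  "ev a p = (\<Sum>m\<in>keys p. \<phi> (lkp p m) * mon a m)"

lemma ev_superset: "finite S \<Longrightarrow> keys p \<subseteq> S \<Longrightarrow> ev a p = (\<Sum>m\<in>S. \<phi> (lkp p m) * mon a m)"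
  unfolding ev_def by (rule sum.mono_neutral_left) (auto simp: in_keys_iff \<phi>_0)

lemma ev_0 [simp]: "ev a 0 = 0"
  by (simp add: ev_def)

lemma ev_add: "ev a (p + q) = ev a p + ev a q"
proof -
  let ?S = "keys p \<union> keys q"
  have "ev a (p + q) = (\<Sum>m\<in>?S. \<phi> (lkp (p + q) m) * mon a m)"
    using Poly_Mapping.keys_add[of p q] by (intro ev_superset) auto
  also have "\<dots> = (\<Sum>m\<in>?S. \<phi> (lkp p m) * mon a m) + (\<Sum>m\<in>?S. \<phi> (lkp q m) * mon a m)"
    by (simp add: lookup_add \<phi>_add distrib_right sum.distrib)
  finally show ?thesis using ev_superset[of ?S p a] ev_superset[of ?S q a] by simp
qed

lemma ev_single: "ev a (single m c) = \<phi> c * mon a m"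
  by (cases "c = 0") (auto simp: ev_def lookup_single \<phi>_0)

lemma ev_sum: "ev a (\<Sum>i\<in>A. f i) = (\<Sum>i\<in>A. ev a (f i))"
  by (induction A rule: infinite_finite_induct) (simp_all add: ev_add)

lemma ev_mult: "ev a (p * q) = ev a p * ev a q"
  unfolding poly_mapping_mult_expansion ev_sum ev_single \<phi>_mult mon_add
  by (simp add: ev_def sum_product mult_ac)

lemma ev_1: "ev a 1 = 1"
  using ev_single[of a 0 1] by (simp add: \<phi>_1)

lemma ev_prod: "ev a (\<Prod>i\<in>A. f i) = (\<Prod>i\<in>A. ev a (f i))"
  by (induction A rule: infinite_finite_induct) (simp_all add: ev_mult ev_1)

end

lemma digits_unique:
  fixes f g :: "nat \<Rightarrow> nat"
  assumes "(\<Sum>j<N. (b + 1) ^ j * f j) = (\<Sum>j<N. (b + 1) ^ j * g j)"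
    and "\<And>j. j < N \<Longrightarrow> f j \<le> b" "\<And>j. j < N \<Longrightarrow> g j \<le> b" "j < N"
  shows "f j = g j"
  using assms
proof (induction N arbitrary: f g j)
  case 0
  then show ?case by simp
next
  case (Suc N)
  have exp: "(\<Sum>j<Suc N. (b + 1) ^ j * h j) = h 0 + (b + 1) * (\<Sum>j<N. (b + 1) ^ j * h (Suc j))" for h :: "nat \<Rightarrow> nat"
    by (simp add: sum.lessThan_Suc_shift sum_distrib_left algebra_simps del: sum.lessThan_Suc)
  have eq: "f 0 + (b + 1) * (\<Sum>j<N. (b + 1) ^ j * f (Suc j)) = g 0 + (b + 1) * (\<Sum>j<N. (b + 1) ^ j * g (Suc j))"
    using Suc.prems(1) unfolding exp .
  have "f 0 < b + 1" "g 0 < b + 1" using Suc.prems(2)[of 0] Suc.prems(3)[of 0] by auto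
  moreover have "f 0 mod (b + 1) = g 0 mod (b + 1)"
    using arg_cong[OF eq, of "\<lambda>x. x mod (b + 1)"] by (simp only: mod_mult_self2)
  ultimately have fg: "f 0 = g 0" by (simp only: mod_less)
  show ?case
  proof (cases j)
    case 0
    then show ?thesis using fg by simp
  next
    case (Suc i)
    have "(\<Sum>j<N. (b + 1) ^ j * f (Suc j)) = (\<Sum>j<N. (b + 1) ^ j * g (Suc j))"
      using eq unfolding fg add_left_cancel mult_cancel1 by simp
    then show ?thesis
      using Suc.IH[of "\<lambda>j. f (Suc j)" "\<lambda>j. g (Suc j)" i] Suc.prems Suc by auto
  qed
qed

text \<open>Kronecker substitution: the exponents \<open>M \<cdot> \<kappa>(m)\<close> of different monomials are at least \<open>M\<close>
  apart, so coefficients of degree below \<open>M\<close> cannot interfere.\<close>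

lemma kronecker_nonzero:
  fixes c :: "(nat \<Rightarrow>\<^sub>0 nat) \<Rightarrow> 'a::comm_ring_1 poly"
  assumes S: "finite S" "m0 \<in> S" "c m0 \<noteq> 0" and deg: "\<And>m. m \<in> S \<Longrightarrow> degree (c m) < M"
    and keys: "\<And>m. m \<in> S \<Longrightarrow> keys m \<subseteq> {..<N}" "\<And>m i. m \<in> S \<Longrightarrow> lkp m i \<le> b"
  shows "(\<Sum>m\<in>S. c m * mon (\<lambda>i. monom 1 (M * (b + 1) ^ i)) m) \<noteq> 0"
proof -
  define \<kappa> where "\<kappa> = (\<lambda>m. \<Sum>i<N. (b + 1) ^ i * lkp m i)"
  have mon: "mon (\<lambda>i. monom (1::'a) (M * (b + 1) ^ i)) m = monom 1 (M * \<kappa> m)" if "m \<in> S" for m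
    by (subst mon_monom[of "{..<N}"])
      (use keys(1)[OF that] in \<open>simp_all add: \<kappa>_def sum_distrib_left mult.assoc\<close>)
  have inj: "m = m0" if "m \<in> S" "\<kappa> m = \<kappa> m0" for m
  proof (rule poly_mapping_eqI)
    fix i
    show "lkp m i = lkp m0 i"
    proof (cases "i < N")
      case True
      then show ?thesis using digits_unique[of b "lkp m" N "lkp m0" i] that keys(2) S(2) by (simp add: \<kappa>_def)
    next
      case False
      then have "i \<notin> keys m" "i \<notin> keys m0" using keys(1) that S(2) by auto
      then show ?thesis by (simp add: in_keys_iff)
    qed
  qed
  have cmm: "coeff (q * monom 1 a) i = (if a \<le> i then coeff q (i - a) else 0)" for q :: "'a poly" and a i
    by (simp add: mult.commute[of q] coeff_monom_mult)
  \<comment> \<open>This is the top exponent of the block of \<open>m0\<close>; every other block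
    ends before it or starts after it.\<close>
  define e where "e = M * \<kappa> m0 + degree (c m0)"
  have "coeff (c m * monom 1 (M * \<kappa> m)) e = (if m = m0 then lead_coeff (c m0) else 0)" if m: "m \<in> S" for m
  proof (cases "m = m0")
    case True
    then show ?thesis by (simp add: e_def cmm)
  next
    case False
    then have "\<kappa> m \<noteq> \<kappa> m0" using inj m by blast
    then consider "\<kappa> m + 1 \<le> \<kappa> m0" | "\<kappa> m0 + 1 \<le> \<kappa> m" by linarith
    then show ?thesis
    proof cases
      case 1
      then have "M * \<kappa> m + M \<le> e" unfolding e_def using mult_le_mono2[OF 1, of M] by simp
      then have "degree (c m) < e - M * \<kappa> m" using deg[OF m] by linarith
      then show ?thesis using False by (simp add: cmm coeff_eq_0)
    next
      case 2
      then have "e < M * \<kappa> m" unfolding e_def using mult_le_mono2[OF 2, of M] deg[OF S(2)] by simp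
      then show ?thesis using False by (simp add: cmm)
    qed
  qed
  then have "(\<Sum>m\<in>S. coeff (c m * monom 1 (M * \<kappa> m)) e) = (\<Sum>m\<in>S. if m = m0 then lead_coeff (c m0) else 0)"
    by (rule sum.cong[OF refl])
  also have "\<dots> = lead_coeff (c m0)" using S by simp
  finally have "coeff (\<Sum>m\<in>S. c m * mon (\<lambda>i. monom 1 (M * (b + 1) ^ i)) m) e \<noteq> 0"
    using S mon by (simp add: coeff_sum)
  then show ?thesis by auto
qed

text \<open>The two degrees are tracked separately: \<open>e\<close> bounds the degree of the
  coefficients in \<open>z\<close>, \<open>t\<close> the total degree in the variables still to be
  replaced.\<close>

definition bounded :: "nat \<Rightarrow> nat \<Rightarrow> nat \<Rightarrow> ((nat \<Rightarrow>\<^sub>0 nat) \<Rightarrow>\<^sub>0 'a::comm_ring_1 poly) \<Rightarrow> bool" where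
  "bounded k e t Q \<longleftrightarrow> (\<forall>m. degree (lkp Q m) \<le> e) \<and>
     (\<forall>m\<in>keys Q. keys m \<subseteq> {..<k} \<and> (\<Sum>i<k. lkp m i) \<le> t)"

lemma bounded_0: "bounded k e t 0"
  by (simp add: bounded_def)

lemma bounded_single:
  "degree c \<le> e \<Longrightarrow> keys m \<subseteq> {..<k} \<Longrightarrow> (\<Sum>i<k. lkp m i) \<le> t \<Longrightarrow> bounded k e t (single m c)"
  by (auto simp: bounded_def lookup_single when_def)

lemma bounded_add: "bounded k e t p \<Longrightarrow> bounded k e t q \<Longrightarrow> bounded k e t (p + q)"
  unfolding bounded_def using Poly_Mapping.keys_add[of p q]
  by (simp add: lookup_add degree_add_le) blast

lemma bounded_sum: "(\<And>i. i \<in> A \<Longrightarrow> bounded k e t (f i)) \<Longrightarrow> bounded k e t (\<Sum>i\<in>A. f i)"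
  by (induction A rule: infinite_finite_induct) (auto intro: bounded_add bounded_0)

lemma bounded_mult:
  assumes "bounded k e t p" "bounded k e' t' q"
  shows "bounded k (e + e') (t + t') (p * q)"
  unfolding poly_mapping_mult_expansion
proof (intro bounded_sum bounded_single)
  fix m m' assume m: "m \<in> keys p" "m' \<in> keys q"
  show "degree (lkp p m * lkp q m') \<le> e + e'"
    using assms degree_mult_le[of "lkp p m" "lkp q m'"] unfolding bounded_def
    by (meson add_mono le_trans)
  show "keys (m + m') \<subseteq> {..<k}"
    using Poly_Mapping.keys_add[of m m'] assms m unfolding bounded_def by blast
  show "(\<Sum>i<k. lkp (m + m') i) \<le> t + t'"
    using assms m unfolding bounded_def by (simp add: lookup_add sum.distrib add_mono)
qed

lemma bounded_prod:
  assumes "\<And>j. j < d \<Longrightarrow> bounded k e t (f j)"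
  shows "bounded k (d * e) (d * t) (\<Prod>j<d. f j)"
  using assms
proof (induction d)
  case 0
  have "bounded k 0 0 (single 0 1)" by (rule bounded_single) auto
  then show ?case by simp
next
  case (Suc d)
  then have "bounded k (e + d * e) (t + d * t) (f d * (\<Prod>j<d. f j))" by (intro bounded_mult) auto
  then show ?case by (simp add: mult.commute[of "f d"])
qed

text \<open>The substitute for the variable \<open>x\<^sub>l\<close>; indices start at 0, hence the successors.\<close>

definition hit :: "nat \<Rightarrow> nat \<Rightarrow> nat \<Rightarrow> nat \<Rightarrow> 'a::field poly" where
  "hit k d M l = (\<Sum>j<k. monom 1 (Suc l * Suc j + M * (d + 1) ^ j))"

section \<open>Homogenized and restricted circuits\<close>

locale circuit =
  fixes n k d :: nat and c :: "nat \<Rightarrow> nat \<Rightarrow> 'a::field" and b :: "nat \<Rightarrow> nat \<Rightarrow> nat \<Rightarrow> 'a"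
    and p :: "'a mpoly"
  assumes p: "p = (\<Sum>i<k. \<Prod>j<d. (mconst (c i j) + (\<Sum>l<n. mconst (b i j l) * mvar l)))"
begin

lemma ev_p:
  fixes \<phi> :: "'a \<Rightarrow> 'c::comm_semiring_1"
  assumes "coeff_hom \<phi>"
  shows "coeff_hom.ev \<phi> a p = (\<Sum>i<k. \<Prod>j<d. (\<phi> (c i j) + (\<Sum>l<n. \<phi> (b i j l) * a l)))"
proof -
  interpret coeff_hom \<phi> by fact
  show ?thesis
    unfolding p ev_sum ev_prod ev_add ev_mult mconst_def mvar_def ev_single mon_single
    by (simp add: \<phi>_1)
qed

lemma msubst_p: "msubst p a = (\<Sum>i<k. \<Prod>j<d. ([:c i j:] + (\<Sum>l<n. [:b i j l:] * a l)))"
proof -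
  have hom: "coeff_hom (\<lambda>c::'a. [:c:])" by standard auto
  have "msubst p a = coeff_hom.ev (\<lambda>c. [:c:]) a p"
    by (simp add: msubst_def coeff_hom.ev_def[OF hom] mon_def)
  then show ?thesis by (simp add: ev_p[OF hom])
qed

text \<open>The homogenized circuit over \<open>F(z)\<close>, with \<open>v 0\<close> as
  homogenizing variable.\<close>

definition F :: "(nat \<Rightarrow> 'a poly fract) \<Rightarrow> 'a poly fract" where
  "F v = (\<Sum>i<k. \<Prod>j<d. (to_fract [:c i j:] * v 0 + (\<Sum>l<n. to_fract [:b i j l:] * v (Suc l))))"

text \<open>Over a finite field a nonzero formal polynomial may vanish as a function. Over
  \<open>F(z)\<close> the Kronecker point is a nonroot; the coefficients are constants, so
  \<open>M = 1\<close> suffices there.\<close>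

lemma F_nonzero:
  assumes "p \<noteq> 0"
  obtains v where "F v \<noteq> 0"
proof -
  have hom: "coeff_hom (\<lambda>c::'a. to_fract [:c:])"
    by standard (simp_all add: one_pCons[symmetric] flip: to_fract_mult to_fract_add)
  obtain m0 where m0: "m0 \<in> keys p" using assms by fastforce
  define N where "N = Suc (Max (\<Union>m\<in>keys p. keys m))"
  define D where "D = Max (\<Union>m\<in>keys p. lkp m ` keys m)"
  have N: "keys m \<subseteq> {..<N}" if "m \<in> keys p" for m
    unfolding N_def using that by (auto simp: less_Suc_eq_le intro!: Max_ge)
  have D: "lkp m i \<le> D" if "m \<in> keys p" for m i
  proof (cases "i \<in> keys m")
    case True
    then show ?thesis unfolding D_def using that by (auto intro!: Max_ge)
  qed (simp add: in_keys_iff)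
  define x where "x = (\<lambda>i. monom (1::'a) (1 * (D + 1) ^ i))"
  have "(\<Sum>m\<in>keys p. [:lkp p m:] * mon x m) \<noteq> 0"
    unfolding x_def using m0 N D by (intro kronecker_nonzero[of _ m0]) (auto simp: in_keys_iff)
  then have nz: "to_fract (\<Sum>m\<in>keys p. [:lkp p m:] * mon x m) \<noteq> 0" by (metis to_fract_eq_0_iff)
  have "to_fract (mon x m) = mon (\<lambda>i. to_fract (x i)) m" for m
  proof -
    have "to_fract (\<Prod>i\<in>A. f i) = (\<Prod>i\<in>A. to_fract (f i))" for A :: "nat set" and f :: "nat \<Rightarrow> 'a poly"
      by (induction A rule: infinite_finite_induct) simp_all
    then show ?thesis by (simp add: mon_def to_fract_power)
  qed
  then have "coeff_hom.ev (\<lambda>c. to_fract [:c:]) (\<lambda>i. to_fract (x i)) p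
      = to_fract (\<Sum>m\<in>keys p. [:lkp p m:] * mon x m)"
    unfolding coeff_hom.ev_def[OF hom] to_fract_sum to_fract_mult by (intro sum.cong) auto
  with nz have "coeff_hom.ev (\<lambda>c. to_fract [:c:]) (\<lambda>i. to_fract (x i)) p \<noteq> 0" by argo
  then have "F (case_nat 1 (\<lambda>i. to_fract (x i))) \<noteq> 0" unfolding ev_p[OF hom] F_def by simp
  then show ?thesis by (rule that)
qed

text \<open>A nonroot can be chosen with nonzero coordinate 0, and by homogeneity it may be rescaled
  to make that coordinate 1, which dehomogenizes.\<close>

lemma F_vdm_nonzero:
  assumes "p \<noteq> 0"
  obtains y where "F (vdm k y) \<noteq> 0" "y 0 = 1"
proof -
  interpret rank_preserving "range (lf :: 'a poly \<Rightarrow> _)" "vdm k" k by (rule vdm_rank_preserving)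
  define L where "L = (\<lambda>i j. pCons (c i j) (\<Sum>l<n. monom (b i j l) l))"
  have cL: "coeff (L i j) 0 = c i j" "l < n \<Longrightarrow> coeff (L i j) (Suc l) = b i j l" for i j l
    by (simp_all add: L_def coeff_sum)
  have deg: "degree (\<Sum>l<n. monom (b i j l) l) \<le> n - 1" for i j
    by (rule degree_sum_le) (auto intro: order.trans[OF degree_monom_le])
  have "degree (L i j) \<le> n" for i j
  proof (cases "n = 0")
    case False
    then show ?thesis using deg[of i j] degree_pCons_le[of "c i j" "\<Sum>l<n. monom (b i j l) l"]
      by (simp add: L_def)
  qed (simp add: L_def)
  then have lfL: "lf (L i j) v = to_fract [:c i j:] * v 0 + (\<Sum>l<n. to_fract [:b i j l:] * v (Suc l))" for i j v
    by (simp add: lf_bound[of _ n] sum.atMost_shift cL)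
  have F: "F v = (\<Sum>i<k. \<Prod>j<d. lf (L i j) v)" for v by (simp add: F_def lfL)
  obtain v where v: "(\<Sum>i<k. \<Prod>j<d. lf (L i j) v) \<noteq> 0" using F_nonzero[OF assms] F by auto
  obtain y where y: "(\<Sum>i<k. \<Prod>j<d. lf (L i j) (vdm k y)) \<noteq> 0"
    using sum_prod_nonzero[where f = "\<lambda>i j. lf (L i j)", OF _ v] by blast
  have h: "hfun d (\<lambda>y. F (vdm k y))"
    unfolding F
  proof (rule hfun_sum)
    fix i
    have "hfun (card {..<d}) (\<lambda>y. \<Prod>j<d. lf (L i j) (vdm k y))"
      by (rule hfun_prod) (auto intro: linform_hfun linform_comp linform_lf linform_vdm)
    then show "hfun d (\<lambda>y. \<Prod>j<d. lf (L i j) (vdm k y))" by simp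
  qed
  obtain u where u: "F (vdm k u) * u 0 \<noteq> 0"
    using pfun_mult_eq_0[OF inf hfun_imp_pfun[OF h] pfun.coord[of 0], of y "\<lambda>_. 1"] y F by auto
  have "F (vdm k (\<lambda>i. 1 / u 0 * u i)) = (1 / u 0) ^ d * F (vdm k u)"
    using hfun_scale[OF h] .
  then show ?thesis using that[of "\<lambda>i. 1 / u 0 * u i"] u by simp
qed

text \<open>\<open>Q\<close> is the projected circuit as a polynomial in the
  \<open>y\<^sub>j\<close> over \<open>F[z]\<close>; it is nonzero because evaluating it over
  \<open>F(z)\<close> yields \<open>F (vdm k y)\<close>. Its coefficients have degree below
  \<open>M\<close> and its exponents are at most \<open>d\<close>, so replacing the
  \<open>y\<^sub>j\<close> by powers of the same \<open>z\<close> cannot annihilate it.\<close>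

theorem msubst_hit_nonzero:
  assumes "p \<noteq> 0" and M: "d * (n * k) < M"
  shows "msubst p (hit k d M) \<noteq> 0"
proof -
  define X :: "nat \<Rightarrow> (nat \<Rightarrow>\<^sub>0 nat) \<Rightarrow>\<^sub>0 'a poly"
    where "X = (\<lambda>l. \<Sum>j<k. single (single j 1) (monom 1 (Suc l * Suc j)))"
  define Q where "Q = (\<Sum>i<k. \<Prod>j<d. (single 0 [:c i j:] + (\<Sum>l<n. single 0 [:b i j l:] * X l)))"
  have evQ: "coeff_hom.ev \<phi> a Q = (\<Sum>i<k. \<Prod>j<d. (\<phi> [:c i j:] + (\<Sum>l<n. \<phi> [:b i j l:] *
      (\<Sum>j<k. \<phi> (monom 1 (Suc l * Suc j)) * a j))))" if "coeff_hom \<phi>"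
    for \<phi> :: "'a poly \<Rightarrow> 'c::comm_semiring_1" and a
  proof -
    interpret coeff_hom \<phi> by fact
    show ?thesis unfolding Q_def X_def ev_sum ev_prod ev_add ev_mult ev_single mon_single by simp
  qed
  have "Q \<noteq> 0"
  proof
    assume "Q = 0"
    have hom: "coeff_hom (to_fract :: 'a poly \<Rightarrow> _)" by standard simp_all
    obtain y where y: "F (vdm k y) \<noteq> 0" "y 0 = 1" using F_vdm_nonzero[OF assms(1)] .
    have "F (vdm k y) = coeff_hom.ev to_fract (\<lambda>j. y (Suc j)) Q"
      unfolding evQ[OF hom] F_def vdm_def using y(2) by simp
    then show False using y \<open>Q = 0\<close> coeff_hom.ev_0[OF hom] by simp
  qed
  then obtain m0 where m0: "m0 \<in> keys Q" by fastforce
  have "bounded k (d * (n * k)) (d * 1) Q"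
    unfolding Q_def
  proof (intro bounded_sum bounded_prod bounded_add)
    fix i j l assume "l \<in> {..<n}"
    have "bounded k (n * k) 1 (X l)"
      unfolding X_def
    proof (intro bounded_sum bounded_single)
      fix j assume j: "j \<in> {..<k}"
      show "degree (monom (1::'a) (Suc l * Suc j)) \<le> n * k"
        using j \<open>l \<in> _\<close> by (intro order.trans[OF degree_monom_le] mult_le_mono) auto
      show "(\<Sum>i<k. lkp (single j 1) i) \<le> (1::nat)" using j by (simp add: lookup_single when_def)
      show "keys (single j (1::nat)) \<subseteq> {..<k}" using j by simp
    qed
    then show "bounded k (n * k) 1 (single 0 [:b i j l:] * X l)"
      using bounded_mult[of k 0 0 "single 0 [:b i j l:]" "n * k" 1 "X l"] by (simp add: bounded_single)
  qed (rule bounded_single; simp)+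
  then have Q: "degree (lkp Q m) \<le> d * (n * k)" "m \<in> keys Q \<Longrightarrow> keys m \<subseteq> {..<k}"
    "m \<in> keys Q \<Longrightarrow> (\<Sum>i<k. lkp m i) \<le> d" for m by (auto simp: bounded_def)
  have "lkp m i \<le> d" if m: "m \<in> keys Q" for m i
  proof (cases "i < k")
    case True
    then have "lkp m i \<le> (\<Sum>i<k. lkp m i)" by (intro member_le_sum) auto
    then show ?thesis using Q(3)[OF m] by simp
  next
    case False
    then have "i \<notin> keys m" using Q(2)[OF m] by auto
    then show ?thesis by (simp add: in_keys_iff)
  qed
  moreover have "degree (lkp Q m) < M" for m using Q(1)[of m] M by linarith
  ultimately have nz: "(\<Sum>m\<in>keys Q. lkp Q m * mon (\<lambda>i. monom 1 (M * (d + 1) ^ i)) m) \<noteq> 0"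
    using m0 Q(2) by (intro kronecker_nonzero[of _ m0 _ _ k]) (auto simp: in_keys_iff)
  have hom: "coeff_hom (\<lambda>x::'a poly. x)" by standard simp_all
  have "hit k d M l = (\<Sum>j<k. monom 1 (Suc l * Suc j) * monom (1::'a) (M * (d + 1) ^ j))" for l
    by (simp only: hit_def mult_monom mult_1)
  then have "msubst p (hit k d M) = coeff_hom.ev (\<lambda>x. x) (\<lambda>j. monom 1 (M * (d + 1) ^ j)) Q"
    unfolding msubst_p evQ[OF hom] by simp
  then show ?thesis using nz unfolding coeff_hom.ev_def[OF hom] by simp
qed

lemma degree_msubst_le:
  assumes "\<And>l. l < n \<Longrightarrow> degree (a l) \<le> e"
  shows "degree (msubst p a) \<le> d * e"
  unfolding msubst_p
proof (rule degree_sum_le)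
  fix i
  have "degree ([:c i j:] + (\<Sum>l<n. [:b i j l:] * a l)) \<le> e" for j
  proof (intro degree_add_le degree_sum_le)
    fix l assume "l \<in> {..<n}"
    then show "degree ([:b i j l:] * a l) \<le> e"
      using assms[of l] degree_mult_le[of "[:b i j l:]" "a l"] by simp
  qed auto
  then have "(\<Sum>j<d. degree ([:c i j:] + (\<Sum>l<n. [:b i j l:] * a l))) \<le> d * e"
    using sum_bounded_above[of "{..<d}" _ e] by simp
  then show "degree (\<Prod>j<d. ([:c i j:] + (\<Sum>l<n. [:b i j l:] * a l))) \<le> d * e"
    by (intro order.trans[OF degree_prod_sum_le]) (simp_all add: o_def)
qed simp

end

lemma sps_computes_circuit:
  assumes "sps_computes k d n p"
  obtains c b where "circuit n k d c b p"
proof -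
  obtain l where l: "\<forall>i<k. \<forall>j<d. linear_mpoly n (l i j)" "p = (\<Sum>i<k. \<Prod>j<d. l i j)"
    using assms unfolding sps_computes_def by blast
  define Z where "Z = (\<lambda>i j x. l i j = mconst (fst x) + (\<Sum>r<n. mconst (snd x r) * mvar r))"
  define z where "z = (\<lambda>i j. SOME x. Z i j x)"
  have "Z i j (z i j)" if "i < k" "j < d" for i j
  proof -
    obtain c a where "l i j = mconst c + (\<Sum>r<n. mconst (a r) * mvar r)"
      using l(1) \<open>i < k\<close> \<open>j < d\<close> unfolding linear_mpoly_def by blast
    then have "Z i j (c, a)" unfolding Z_def by (simp only: fst_conv snd_conv)
    then show ?thesis unfolding z_def by (rule someI)
  qed
  then have "circuit n k d (\<lambda>i j. fst (z i j)) (\<lambda>i j. snd (z i j)) p"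
    unfolding circuit_def l(2) Z_def by (intro sum.cong prod.cong refl) simp
  then show ?thesis by (rule that)
qed

section \<open>Irreducible polynomials over finite fields\<close>

lemma card_poly_degree_less:
  assumes "finite (UNIV :: 'a::field set)"
  shows "finite {g :: 'a poly. g \<noteq> 0 \<and> degree g < s}"
    and "card {g :: 'a poly. g \<noteq> 0 \<and> degree g < s} = card (UNIV :: 'a set) ^ s - 1"
proof -
  define P where "P = (\<lambda>s. {g :: 'a poly. \<forall>i\<ge>s. coeff g i = 0})"
  have *: "finite (P s) \<and> card (P s) = card (UNIV :: 'a set) ^ s" for s
  proof (induction s)
    case 0
    have "P 0 = {0}" by (auto simp: P_def poly_eq_iff)
    then show ?case by simp
  next
    case (Suc s)
    have "P (Suc s) = (\<lambda>(a, g). pCons a g) ` (UNIV \<times> P s)"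
    proof (intro equalityI subsetI)
      fix g assume g: "g \<in> P (Suc s)"
      obtain a h where "g = pCons a h" by (cases g)
      moreover have "h \<in> P s" using g calculation by (auto simp: P_def)
      ultimately show "g \<in> (\<lambda>(a, g). pCons a g) ` (UNIV \<times> P s)" by auto
    next
      fix g assume "g \<in> (\<lambda>(a, g). pCons a g) ` (UNIV \<times> P s)"
      then show "g \<in> P (Suc s)" by (auto simp: P_def coeff_pCons split: nat.split)
    qed
    moreover have "inj_on (\<lambda>(a, g). pCons a g) (UNIV \<times> P s)" by (auto simp: inj_on_def)
    ultimately show ?case using Suc assms by (simp add: card_image card_cartesian_product)
  qed
  have "{g :: 'a poly. g \<noteq> 0 \<and> degree g < s} = P s - {0}"
    by (auto simp: P_def coeff_eq_0) (metis leading_coeff_0_iff not_le_imp_less)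
  moreover have "0 \<in> P s" by (simp add: P_def)
  ultimately show "finite {g :: 'a poly. g \<noteq> 0 \<and> degree g < s}"
    "card {g :: 'a poly. g \<noteq> 0 \<and> degree g < s} = card (UNIV :: 'a set) ^ s - 1"
    using *[of s] by auto
qed

text \<open>Multiplication by \<open>x\<close> permutes the nonzero residues modulo
  \<open>f\<close>; comparing the products of all of them gives the claim.\<close>

lemma finite_field_poly_fermat:
  fixes f x :: "'a::field poly"
  assumes fin: "finite (UNIV :: 'a set)" and f: "irreducible f" and x: "\<not> f dvd x"
  shows "f dvd x ^ (card (UNIV :: 'a set) ^ degree f - 1) - 1"
proof -
  define S where "S = {g :: 'a poly. g \<noteq> 0 \<and> degree g < degree f}"
  have S: "finite S" "card S = card (UNIV :: 'a set) ^ degree f - 1"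
    unfolding S_def using card_poly_degree_less[OF fin] by auto
  have pf: "prime_elem f" using f by (rule field_poly_irreducible_imp_prime)
  have f0: "f \<noteq> 0" using f by auto
  have nd: "\<not> f dvd g" if "g \<in> S" for g
    using that dvd_imp_degree_le[of f g] by (auto simp: S_def)
  define h where "h = (\<lambda>g. (x * g) mod f)"
  have "h g \<in> S" if "g \<in> S" for g
  proof -
    have "\<not> f dvd x * g" using nd[OF that] x pf by (auto simp: prime_elem_dvd_mult_iff)
    then have "h g \<noteq> 0" by (simp add: h_def mod_eq_0_iff_dvd)
    then show ?thesis using degree_mod_less[OF f0, of "x * g"] by (auto simp: S_def h_def)
  qed
  moreover have "inj_on h S"
  proof (rule inj_onI)
    fix g g' assume g: "g \<in> S" "g' \<in> S" "h g = h g'"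
    then have "f dvd x * g - x * g'" unfolding h_def by (simp add: mod_eq_dvd_iff)
    then have "f dvd x * (g - g')" by (simp add: right_diff_distrib)
    then have "f dvd g - g'" using x pf by (auto simp: prime_elem_dvd_mult_iff)
    moreover have "degree (g - g') < degree f" using g by (auto simp: S_def intro: degree_diff_less)
    ultimately show "g = g'" using dvd_imp_degree_le[of f "g - g'"] by fastforce
  qed
  ultimately have "h ` S = S" using S(1) by (intro endo_inj_surj) auto
  then have "prod h S = prod (\<lambda>g. g) S" using prod.reindex[OF \<open>inj_on h S\<close>, of "\<lambda>g. g"] by simp
  moreover have "prod h S mod f = (\<Prod>g\<in>S. x * g) mod f" unfolding h_def by (rule mod_prod_eq)
  ultimately have "f dvd (\<Prod>g\<in>S. x * g) - prod (\<lambda>g. g) S" by (metis mod_eq_dvd_iff)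
  moreover have "(\<Prod>g\<in>S. x * g) - prod (\<lambda>g. g) S = (x ^ card S - 1) * prod (\<lambda>g. g) S"
    by (simp add: prod.distrib left_diff_distrib)
  moreover have "\<not> f dvd prod (\<lambda>g. g) T" if "finite T" "T \<subseteq> S" for T
    using that
  proof (induction T rule: finite_induct)
    case empty
    then show ?case using f by (simp add: irreducible_not_unit)
  next
    case (insert g T)
    then show ?case using nd[of g] pf by (simp add: prime_elem_dvd_mult_iff)
  qed
  ultimately show ?thesis using pf S by (auto simp: prime_elem_dvd_mult_iff)
qed

lemma power_minus_one_dvd:
  fixes x :: "'a::comm_ring_1"
  assumes "m dvd n"
  shows "x ^ m - 1 dvd x ^ n - 1"
proof -
  obtain c where "n = m * c" using assms by (elim dvdE)
  then show ?thesis using power_diff_1_eq[of "x ^ m" c] by (simp add: power_mult)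
qed

lemma dvd_power_gcd:
  fixes f x :: "'a::comm_ring_1"
  assumes "f dvd x ^ A - 1" "f dvd x ^ B - 1" "A \<noteq> 0"
  shows "f dvd x ^ gcd A B - 1"
proof -
  obtain u v where uv: "A * u = B * v + gcd A B" using bezout_nat[OF assms(3)] by blast
  have "f dvd x ^ (A * u) - 1" "f dvd x ^ (B * v) - 1"
    using assms(1,2) power_minus_one_dvd[of A "A * u" x] power_minus_one_dvd[of B "B * v" x] dvd_trans by auto
  then have "f dvd (x ^ (A * u) - 1) - x ^ gcd A B * (x ^ (B * v) - 1)" by (rule dvd_diff[OF _ dvd_mult])
  also have "\<dots> = x ^ gcd A B - 1" unfolding uv by (simp add: power_add algebra_simps)
  finally show ?thesis .
qed

text \<open>The order of \<open>x\<close> modulo \<open>f\<close> divides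
  \<open>l ^ Suc e * w\<close> but not \<open>l ^ e * w\<close>, so it contains the full power of
  \<open>l\<close>. The gcd with \<open>B\<close> takes the place of the order.\<close>

lemma prime_power_dvd_order:
  fixes f x :: "'a::comm_ring_1"
  assumes "prime l" "w > 0" "f dvd x ^ (l ^ Suc e * w) - 1" "\<not> f dvd x ^ (l ^ e * w) - 1" "f dvd x ^ B - 1"
  shows "l ^ Suc e dvd B"
proof -
  define g where "g = gcd (l ^ Suc e * w) B"
  have l: "l > 0" using assms(1) by (rule prime_gt_0_nat)
  have fg: "f dvd x ^ g - 1" unfolding g_def using assms l by (intro dvd_power_gcd) auto
  have "g dvd l ^ Suc e * w" by (simp add: g_def)
  then obtain a b where ab: "g = a * b" "a dvd l ^ Suc e" "b dvd w" using division_decomp by blast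
  obtain i where i: "i \<le> Suc e" "a = l ^ i" using ab(2) assms(1) divides_primepow_nat by blast
  have "i = Suc e"
  proof (rule ccontr)
    assume "i \<noteq> Suc e"
    then have "g dvd l ^ e * w" unfolding ab(1) i(2) using i(1) ab(3) by (intro mult_dvd_mono le_imp_power_dvd) auto
    then show False using power_minus_one_dvd fg assms(4) dvd_trans by blast
  qed
  then have "l ^ Suc e dvd g" using ab i by simp
  then show ?thesis by (simp add: g_def)
qed

text \<open>Lifting the exponent, one factor \<open>l\<close> at a time: if \<open>l\<close> divides \<open>x - 1\<close> exactly \<open>v\<close> times then it
  divides \<open>x\<^sup>l - 1\<close> exactly \<open>v + 1\<close> times.\<close>

lemma prime_power_dvd_exponent:
  fixes l :: nat and x :: int
  assumes "prime l" "v \<ge> 1" "int l ^ v dvd x - 1" "\<not> int l ^ Suc v dvd x - 1" "l = 2 \<Longrightarrow> v \<ge> 2"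
    and "int l ^ (v + m) dvd x ^ s - 1"
  shows "l ^ m dvd s"
  using assms
proof (induction m arbitrary: v x s)
  case 0
  then show ?case by simp
next
  case (Suc m)
  let ?l = "int l"
  have pl: "prime ?l" using Suc.prems(1) by simp
  have l0: "?l \<noteq> 0" using pl by auto
  obtain u where u: "x - 1 = ?l ^ v * u" using Suc.prems(3) by (elim dvdE)
  have nu: "\<not> ?l dvd u"
  proof
    assume "?l dvd u"
    then have "?l ^ v * ?l dvd ?l ^ v * u" by (rule mult_dvd_mono[OF dvd_refl])
    then show False using Suc.prems(4) u by (simp add: mult.commute)
  qed
  have lx: "?l dvd x - 1"
    using Suc.prems(2,3) by (metis dvd_power dvd_trans not_one_le_zero neq0_conv)
  \<comment> \<open>Modulo \<open>l\<close> a geometric sum counts its terms, so \<open>l\<close>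
    divides \<open>s\<close> once it divides the quotient of \<open>x ^ s - 1\<close> by
    \<open>x - 1\<close>.\<close>
  have geo: "?l dvd (\<Sum>i<t. x ^ i) - int t" for t
  proof -
    have "(\<Sum>i<t. x ^ i) - int t = (\<Sum>i<t. x ^ i - 1)" by (simp add: sum_subtractf)
    moreover have "?l dvd x ^ i - 1" for i using lx power_minus_one_dvd[of 1 i x] by (auto intro: dvd_trans)
    ultimately show ?thesis by (simp add: dvd_sum)
  qed
  have "?l ^ v * ?l dvd ?l ^ v * (u * (\<Sum>i<s. x ^ i))"
  proof -
    have "?l ^ Suc v dvd ?l ^ (v + Suc m)" by (rule le_imp_power_dvd) simp
    then have "?l ^ Suc v dvd (x - 1) * (\<Sum>i<s. x ^ i)"
      using Suc.prems(6) unfolding power_diff_1_eq[symmetric] by (rule dvd_trans)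
    then show ?thesis by (simp add: u mult_ac)
  qed
  then have "?l dvd u * (\<Sum>i<s. x ^ i)" using l0 by simp
  then have "?l dvd (\<Sum>i<s. x ^ i)" using pl nu by (auto simp: prime_dvd_mult_iff)
  then have "?l dvd int s" using geo[of s] by (metis dvd_diff_right_iff dvd_diff_commute)
  then obtain t where t: "s = l * t" by (auto elim!: dvdE)
  define y where "y = x ^ l"
  \<comment> \<open>The sum of \<open>l\<close> terms is \<open>l\<close> modulo the square of
    \<open>l\<close>, so \<open>y - 1\<close> has exactly one factor \<open>l\<close> more than
    \<open>x - 1\<close>.\<close>
  obtain z where z: "(\<Sum>i<l. x ^ i) = ?l + ?l ^ 2 * z"
  proof -
    obtain c where c: "x = 1 + ?l * c" using lx by (metis add.commute diff_add_cancel dvdE)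
    have "\<exists>r. x ^ i = 1 + int i * (?l * c) + ?l ^ 2 * r" for i
    proof (induction i)
      case 0
      show ?case by (rule exI[of _ 0]) simp
    next
      case (Suc i)
      then obtain r where r: "x ^ i = 1 + int i * (?l * c) + ?l ^ 2 * r" by blast
      have "x ^ Suc i = (1 + int i * (?l * c) + ?l ^ 2 * r) * (1 + ?l * c)"
        using r c by (simp add: mult.commute)
      also have "\<dots> = 1 + int (Suc i) * (?l * c) + ?l ^ 2 * (int i * c ^ 2 + r + r * ?l * c)"
        by (simp add: algebra_simps power2_eq_square)
      finally show ?case by blast
    qed
    then obtain r where r: "\<And>i. x ^ i = 1 + int i * (?l * c) + ?l ^ 2 * r i" by metis
    have sum: "(\<Sum>i<l. x ^ i) = ?l + (\<Sum>i<l. int i) * (?l * c) + ?l ^ 2 * (\<Sum>i<l. r i)"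
      unfolding r by (simp add: sum.distrib sum_distrib_left sum_distrib_right)
    have gauss: "2 * (\<Sum>i<n. int i) = int n * (int n - 1)" for n :: nat
      by (induction n) (simp_all add: algebra_simps)
    \<comment> \<open>For odd \<open>l\<close> the sum is \<open>l\<close> times
      \<open>(l - 1) / 2\<close>. For \<open>l = 2\<close> the sum is 1, and
      \<open>v \<ge> 2\<close> is needed to make \<open>c\<close> even.\<close>
    have "?l dvd (\<Sum>i<l. int i) * c"
    proof (cases "l = 2")
      case True
      then have "v \<ge> 2" using Suc.prems(5) by simp
      then have "2 ^ 2 dvd x - 1" using Suc.prems(3) True le_imp_power_dvd[of 2 v "2::int"] by (auto intro: dvd_trans)
      then have "4 dvd 2 * c" using c True by simp
      then have "2 dvd c" by presburger
      then show ?thesis using True by simp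
    next
      case False
      then have odd: "odd l" using Suc.prems(1) prime_odd_nat prime_ge_2_nat[of l] by fastforce
      then have "even (?l - 1)" by simp
      then obtain h where "?l - 1 = 2 * h" by (elim evenE)
      then have "(\<Sum>i<l. int i) = ?l * h" using gauss[of l] by simp
      then show ?thesis by simp
    qed
    then obtain k where k: "(\<Sum>i<l. int i) * c = ?l * k" by (elim dvdE)
    have "(\<Sum>i<l. x ^ i) = ?l + ?l * ((\<Sum>i<l. int i) * c) + ?l ^ 2 * (\<Sum>i<l. r i)"
      unfolding sum by (simp add: mult_ac)
    also have "\<dots> = ?l + ?l ^ 2 * (k + (\<Sum>i<l. r i))"
      unfolding k by (simp add: algebra_simps power2_eq_square)
    finally show ?thesis by (rule that)
  qed
  have y: "y - 1 = ?l ^ Suc v * (u * (1 + ?l * z))"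
    unfolding y_def power_diff_1_eq z u by (simp add: algebra_simps power2_eq_square)
  have "\<not> ?l dvd 1 + ?l * z"
  proof
    assume "?l dvd 1 + ?l * z"
    from dvd_diff[OF this dvd_triv_left[of ?l z]] have "?l dvd 1" by simp
    then show False using pl not_prime_unit by blast
  qed
  then have "\<not> ?l dvd u * (1 + ?l * z)" using nu pl by (simp add: prime_dvd_mult_iff)
  then have ny: "\<not> ?l ^ Suc v * ?l dvd y - 1" unfolding y using l0 by simp
  have "l ^ m dvd t"
  proof (intro Suc.IH[of "Suc v" y t])
    show "prime l" "1 \<le> Suc v" "l = 2 \<Longrightarrow> 2 \<le> Suc v" using Suc.prems(1,2) by auto
    show "?l ^ Suc v dvd y - 1" unfolding y by (rule dvd_triv_left)
    show "\<not> ?l ^ Suc (Suc v) dvd y - 1" using ny by (simp only: power_Suc mult_ac not_False_eq_True)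
    show "?l ^ (Suc v + m) dvd y ^ t - 1" using Suc.prems(6) by (simp add: y_def t power_mult)
  qed
  then show ?case using t by simp
qed

section \<open>Explicit irreducible polynomials\<close>

lemma ex_irreducible_factor:
  fixes H :: "'a::field poly"
  assumes "degree H > 0"
  obtains f where "irreducible f" "f dvd H"
proof -
  define P where "P = (\<lambda>f. f dvd H \<and> degree f > 0)"
  have "P H" using assms by (simp add: P_def)
  then obtain f where f: "P f" and min: "\<And>g. P g \<Longrightarrow> degree f \<le> degree g"
    using ex_has_least_nat[of P H degree] by blast
  have "irreducible f"
  proof (rule irreducibleI)
    show "f \<noteq> 0" using f by (auto simp: P_def)
    then show "\<not> f dvd 1" using f by (auto simp: P_def is_unit_iff_degree)
    fix a b assume ab: "f = a * b"
    then have nz: "a \<noteq> 0" "b \<noteq> 0" using \<open>f \<noteq> 0\<close> by auto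
    have "degree a = 0 \<or> degree b = 0"
    proof (rule ccontr)
      assume neg: "\<not> ?thesis"
      then have "P a" using f ab by (auto simp: P_def intro: dvd_mult_left)
      then show False using min[of a] neg ab nz by (simp add: degree_mult_eq)
    qed
    then show "a dvd 1 \<or> b dvd 1" using nz is_unit_iff_degree by blast
  qed
  then show ?thesis using that f by (auto simp: P_def)
qed

lemma irreducible_const_not_dvd:
  fixes f :: "'a::field poly"
  assumes "irreducible f" "c \<noteq> 0"
  shows "\<not> f dvd [:c:]"
  using assms by (meson dvd_trans irreducible_not_unit is_unit_pCons_iff pCons_eq_0_iff is_unit_triv)

text \<open>For an irreducible factor \<open>f\<close>, the order of \<open>X\<close> modulo
  \<open>f\<close> divides \<open>q ^ degree f - 1\<close>. By \<open>ord\<close> its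
  \<open>l\<close>-part is \<open>l ^ Suc e\<close>, so \<open>num\<close> makes \<open>D\<close>
  divide \<open>degree f\<close>, and \<open>f\<close> is all of \<open>H\<close> up to a
  unit.\<close>

lemma irreducible_if_order:
  fixes H :: "'a::field poly"
  assumes fin: "finite (UNIV :: 'a set)" and "prime l" "w > 0" and deg: "degree H = D" "D > 0"
    and H0: "poly H 0 \<noteq> 0"
    and ord: "\<And>f. irreducible f \<Longrightarrow> f dvd H \<Longrightarrow>
      f dvd [:0, 1:] ^ (l ^ Suc e * w) - 1 \<and> \<not> f dvd [:0, 1:] ^ (l ^ e * w) - 1"
    and num: "\<And>s. int l ^ Suc e dvd int (card (UNIV :: 'a set)) ^ s - 1 \<Longrightarrow> D dvd s"
  shows "irreducible H"
proof -
  let ?q = "card (UNIV :: 'a set)"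
  obtain f where f: "irreducible f" "f dvd H" using ex_irreducible_factor deg by metis
  obtain g where g: "H = f * g" using f(2) by (elim dvdE)
  have "H \<noteq> 0" using deg by auto
  \<comment> \<open>Fermat needs \<open>X\<close> to be invertible modulo \<open>f\<close>; a factor
    proportional to \<open>X\<close> would give \<open>H\<close> the root 0.\<close>
  have "\<not> f dvd [:0, 1:]"
  proof
    assume "f dvd [:0, 1:]"
    then obtain h where h: "[:0, 1:] = f * h" by (elim dvdE)
    then have "degree f + degree h = 1"
      by (metis degree_mult_eq degree_pCons_eq_if mult_eq_0_iff one_neq_zero pCons_eq_0_iff One_nat_def degree_0)
    moreover have "degree f > 0" using f(1) by (metis degree_eq_zeroE gr0I irreducible_const_not_dvd dvd_refl irreducible_def pCons_0_0)
    ultimately have "degree h = 0" by simp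
    then obtain c where "h = [:c:]" by (rule degree_eq_zeroE)
    then have "poly f 0 * c = 0" using arg_cong[OF h, of "\<lambda>p. poly p 0"] by auto
    moreover have "c \<noteq> 0" using h \<open>h = [:c:]\<close> by auto
    ultimately show False using H0 g by simp
  qed
  then have "f dvd [:0, 1:] ^ (?q ^ degree f - 1) - 1" by (rule finite_field_poly_fermat[OF fin f(1)])
  then have "l ^ Suc e dvd ?q ^ degree f - 1"
    using prime_power_dvd_order[OF assms(2,3)] ord[OF f] by blast
  then have "int (l ^ Suc e) dvd int (?q ^ degree f - 1)" by (simp only: of_nat_dvd_iff)
  moreover have "?q > 0" using fin by (simp add: card_gt_0_iff)
  ultimately have "int l ^ Suc e dvd int ?q ^ degree f - 1" by (simp add: of_nat_diff)
  from num[OF this] have "degree H \<le> degree f"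
    using f(1) deg by (metis degree_eq_zeroE dvd_imp_le gr0I irreducible_const_not_dvd dvd_refl irreducible_def pCons_0_0)
  then have "degree g = 0" using g \<open>H \<noteq> 0\<close> by (auto simp: degree_mult_eq)
  then have ug: "is_unit g" using g \<open>H \<noteq> 0\<close> is_unit_iff_degree by auto
  show ?thesis using f(1) irreducible_mult_unit_left[OF ug, of f] by (simp add: g mult.commute)
qed

text \<open>Translation by 1 permutes the field, so the sum of all elements is unchanged although
  each summand grows by 1.\<close>

lemma of_nat_card_field:
  assumes "finite (UNIV :: 'a::field set)"
  shows "of_nat (card (UNIV :: 'a set)) = (0 :: 'a)"
proof -
  have "(\<Sum>x\<in>UNIV. x) = (\<Sum>x\<in>UNIV. x + (1::'a))"
    by (rule sum.reindex_bij_witness[of _ "\<lambda>x. x + 1" "\<lambda>x. x - 1"]) auto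
  then show ?thesis by (simp add: sum.distrib)
qed

lemma field_fermat:
  fixes a :: "'a::field"
  assumes "finite (UNIV :: 'a set)" "a \<noteq> 0"
  shows "a ^ (card (UNIV :: 'a set) - 1) = 1"
proof -
  have "\<not> [:-a, 1:] dvd [:0, 1:]" using assms(2) by (simp add: poly_eq_0_iff_dvd[symmetric])
  from finite_field_poly_fermat[OF assms(1) _ this]
  have "[:-a, 1:] dvd [:0, 1:] ^ (card (UNIV :: 'a set) - 1) - 1"
    by (simp add: irreducible_linear_field_poly)
  then show ?thesis by (simp add: poly_eq_0_iff_dvd[symmetric])
qed

text \<open>Modulo a factor, \<open>X ^ (l ^ m)\<close> is \<open>a\<close>, whose power
  \<open>q - 1\<close> is 1 but whose power \<open>u = (q - 1) / l\<close> is not. So the order of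
  \<open>X\<close> contains \<open>m\<close> factors \<open>l\<close> more than \<open>q - 1\<close>
  does, and lifting the exponent gives \<open>num\<close>. For \<open>l = 2\<close> the even
  \<open>u\<close> ensures that 4 divides \<open>q - 1\<close>.\<close>

lemma irreducible_binomial:
  fixes a :: "'a::field"
  assumes fin: "finite (UNIV :: 'a set)" and l: "prime l" and u: "card (UNIV :: 'a set) - 1 = l * u" "u > 0"
    and l2: "l = 2 \<Longrightarrow> even u" and a: "a \<noteq> 0" "a ^ u \<noteq> 1"
  shows "irreducible ([:0, 1:] ^ (l ^ m) - [:a:])"
proof -
  let ?q = "card (UNIV :: 'a set)"
  define v where "v = multiplicity l (?q - 1)"
  have q1: "?q - 1 \<noteq> 0" using u l by (auto dest: prime_gt_0_nat)
  obtain w where w: "?q - 1 = l ^ v * w" "\<not> l dvd w"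
    using multiplicity_decompose'[of "?q - 1" l] q1 l unfolding v_def by (metis not_prime_unit)
  have "w > 0" using w q1 by (cases w) auto
  have "v \<noteq> 0"
  proof
    assume "v = 0"
    then have "l dvd w" using w u by simp
    then show False using w by simp
  qed
  then obtain v' where v': "v = Suc v'" by (cases v) auto
  have u': "u = l ^ v' * w" using u w v' l prime_gt_0_nat[of l] by simp
  have v2: "v \<ge> 2" if "l = 2"
  proof (rule ccontr)
    assume "\<not> v \<ge> 2"
    then have "v' = 0" using v' by simp
    then show False using u' l2 w that by simp
  qed
  have N: "l ^ m > 0" using l by (simp add: prime_gt_0_nat)
  let ?H = "[:0, 1:] ^ (l ^ m) - [:a:]"
  have degX: "degree ([:0, 1:] ^ n :: 'a poly) = n" for n by (simp add: degree_power_eq)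
  show ?thesis
  proof (rule irreducible_if_order[OF fin l \<open>w > 0\<close>, of ?H "l ^ m" "v' + m"])
    show "degree ?H = l ^ m"
      using N by (simp add: diff_conv_add_uminus degree_add_eq_left degX del: add_uminus_conv_diff)
    show "poly ?H 0 \<noteq> 0" using N a by (auto simp: power_0_left)
    fix f :: "'a poly" assume f: "irreducible f" "f dvd ?H"
    have pow: "f dvd [:0, 1:] ^ (l ^ m * i) - [:a ^ i:]" for i
    proof -
      have "([:0, 1:] ^ (l ^ m)) ^ i - [:a:] ^ i = ?H * (\<Sum>j<i. [:a:] ^ (i - Suc j) * ([:0, 1:] ^ (l ^ m)) ^ j)"
        by (rule power_diff_sumr2)
      then have "?H dvd ([:0, 1:] ^ (l ^ m)) ^ i - [:a:] ^ i" by (simp only: dvd_triv_left)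
      with f(2) have "f dvd ([:0, 1:] ^ (l ^ m)) ^ i - [:a:] ^ i" by (rule dvd_trans)
      then show ?thesis by (simp only: poly_const_pow power_mult)
    qed
    show "f dvd [:0, 1:] ^ (l ^ Suc (v' + m) * w) - 1 \<and> \<not> f dvd [:0, 1:] ^ (l ^ (v' + m) * w) - 1"
    proof
      have "l ^ Suc (v' + m) * w = l ^ m * (?q - 1)"
        unfolding w(1) v' by (simp add: power_add)
      then show "f dvd [:0, 1:] ^ (l ^ Suc (v' + m) * w) - 1"
        using pow[of "?q - 1"] field_fermat[OF fin a(1)] by (simp add: one_pCons)
      have e: "l ^ (v' + m) * w = l ^ m * u" by (simp add: u' power_add)
      show "\<not> f dvd [:0, 1:] ^ (l ^ (v' + m) * w) - 1"
      proof
        assume "f dvd [:0, 1:] ^ (l ^ (v' + m) * w) - 1"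
        then have "f dvd ([:0, 1:] ^ (l ^ m * u) - 1) - ([:0, 1:] ^ (l ^ m * u) - [:a ^ u:])"
          using pow[of u] unfolding e by (rule dvd_diff)
        then have "f dvd [:a ^ u - 1:]" by (simp add: one_pCons)
        then show False using irreducible_const_not_dvd[OF f(1)] a(2) by simp
      qed
    qed
  next
    fix s
    assume s: "int l ^ Suc (v' + m) dvd int ?q ^ s - 1"
    have q: "int ?q - 1 = int l ^ v * int w"
    proof -
      have "int (?q - 1) = int (l ^ v * w)" using w by simp
      then show ?thesis using q1 by (simp add: of_nat_diff)
    qed
    show "l ^ m dvd s"
    proof (rule prime_power_dvd_exponent[OF l, of v "int ?q"])
      show "int l ^ v dvd int ?q - 1" unfolding q by simp
      show "\<not> int l ^ Suc v dvd int ?q - 1"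
        unfolding q using w(2) l by (auto simp: prime_gt_0_nat mult.commute[of "int l"])
      show "int l ^ (v + m) dvd int ?q ^ s - 1" using s v' by simp
    qed (use v' v2 in auto)
  qed (use N in simp)
qed

text \<open>In characteristic 2, \<open>y ^ 2 + y - 1\<close> divides \<open>y ^ 3 - 1\<close> and
  is coprime to \<open>y - 1\<close>, so \<open>y\<close> has order 3 and \<open>X\<close> order
  \<open>3 ^ Suc m\<close>. If 3 divides \<open>2 ^ s - 1\<close> then \<open>s\<close> is even, and
  lifting starts from 4, as 3 divides \<open>4 - 1\<close> exactly once.\<close>

lemma irreducible_trinomial_2:
  assumes card: "card (UNIV :: 'a::field set) = 2"
  shows "irreducible ([:0, 1:] ^ (2 * 3 ^ m) + [:0, 1:] ^ (3 ^ m) - [:1::'a:])"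
proof -
  have fin: "finite (UNIV :: 'a set)" using card by (metis card.infinite zero_neq_numeral)
  have "of_nat 2 = (0 :: 'a)" using of_nat_card_field[OF fin] card by simp
  then have two: "(2 :: 'a) = 0" by simp
  define y :: "'a poly" where "y = [:0, 1:] ^ (3 ^ m)"
  have twop: "(2 :: 'a poly) = 0" using two by (simp add: numeral_poly)
  let ?H = "[:0, 1:] ^ (2 * 3 ^ m) + [:0, 1:] ^ (3 ^ m) - [:1::'a:]"
  have H: "?H = y ^ 2 + y - 1" by (simp add: y_def power_mult[symmetric] mult.commute one_pCons)
  have degX: "degree ([:0, 1:] ^ n :: 'a poly) = n" for n by (simp add: degree_power_eq)
  show ?thesis
  proof (rule irreducible_if_order[OF fin, of 3 1 ?H "2 * 3 ^ m" m])
    show "degree ?H = 2 * 3 ^ m"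
      by (simp add: diff_conv_add_uminus degree_add_eq_left degX add.assoc degree_add_less del: add_uminus_conv_diff)
    show "poly ?H 0 \<noteq> 0" by (simp add: power_0_left)
    fix f :: "'a poly" assume f: "irreducible f" "f dvd ?H"
    have "y ^ 3 - 1 = (y - 1) * (y ^ 2 + y - 1) + 2 * (y - 1)" by (simp add: algebra_simps power2_eq_square power3_eq_cube)
    then have "f dvd y ^ 3 - 1" using f(2) unfolding H twop by simp
    moreover have "\<not> f dvd y - 1"
    proof
      assume "f dvd y - 1"
      then have "f dvd (y ^ 2 + y - 1) - (y - 1) * (y + 2)" using f(2) unfolding H by (intro dvd_diff[OF _ dvd_mult2])
      also have "(y ^ 2 + y - 1) - (y - 1) * (y + 2) = 1" by (simp add: algebra_simps power2_eq_square)
      finally show False using f(1) by (simp add: irreducible_not_unit)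
    qed
    ultimately show "f dvd [:0, 1:] ^ (3 ^ Suc m * 1) - 1 \<and> \<not> f dvd [:0, 1:] ^ (3 ^ m * 1) - 1"
      by (simp add: y_def power_mult[symmetric] mult.commute)
  next
    fix s assume s: "int 3 ^ Suc m dvd int (card (UNIV :: 'a set)) ^ s - 1"
    have s3: "(3::int) dvd 2 ^ s - 1" using s card by (simp add: dvd_mult_left)
    have "even s"
    proof (rule ccontr)
      assume "odd s"
      then obtain t where t: "s = 2 * t + 1" by (elim oddE)
      have "(3::int) dvd 4 ^ t - 1" using power_minus_one_dvd[of 1 t "4::int"] by simp
      then have "(3::int) dvd (2 ^ s - 1) - 2 * (4 ^ t - 1)" using s3 by (intro dvd_diff[OF _ dvd_mult])
      then show False by (simp add: t power_mult)
    qed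
    then obtain t where t: "s = 2 * t" by (elim evenE)
    have "3 ^ m dvd t"
      by (rule prime_power_dvd_exponent[of 3 1 4]) (use s card t in \<open>auto simp: power_mult\<close>)
    then show "2 * 3 ^ m dvd s" using t by simp
  qed simp_all
qed

text \<open>In characteristic 3, \<open>y ^ 2 + y - 1\<close> divides \<open>y ^ 4 + 1\<close>, so
  \<open>y\<close> has order 8 and \<open>X\<close> order \<open>2 ^ (m + 3)\<close>. If 8 divides
  \<open>3 ^ s - 1\<close> then \<open>s\<close> is even, and lifting starts from 9 with exactly
  three factors 2 in \<open>9 - 1\<close>.\<close>

lemma irreducible_trinomial_3:
  assumes card: "card (UNIV :: 'a::field set) = 3"
  shows "irreducible ([:0, 1:] ^ (2 * 2 ^ m) + [:0, 1:] ^ (2 ^ m) - [:1::'a:])"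
proof -
  have fin: "finite (UNIV :: 'a set)" using card by (metis card.infinite zero_neq_numeral)
  have "of_nat 3 = (0 :: 'a)" using of_nat_card_field[OF fin] card by simp
  then have three: "(3 :: 'a) = 0" by simp
  define y :: "'a poly" where "y = [:0, 1:] ^ (2 ^ m)"
  have threep: "(3 :: 'a poly) = 0" using three by (simp add: numeral_poly)
  let ?H = "[:0, 1:] ^ (2 * 2 ^ m) + [:0, 1:] ^ (2 ^ m) - [:1::'a:]"
  have H: "?H = y ^ 2 + y - 1" by (simp add: y_def power_mult[symmetric] mult.commute one_pCons)
  have degX: "degree ([:0, 1:] ^ n :: 'a poly) = n" for n by (simp add: degree_power_eq)
  show ?thesis
  proof (rule irreducible_if_order[OF fin, of 2 1 ?H "2 * 2 ^ m" "m + 2"])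
    show "degree ?H = 2 * 2 ^ m"
      by (simp add: diff_conv_add_uminus degree_add_eq_left degX add.assoc degree_add_less del: add_uminus_conv_diff)
    show "poly ?H 0 \<noteq> 0" by (simp add: power_0_left)
    fix f :: "'a poly" assume f: "irreducible f" "f dvd ?H"
    have "y ^ 4 + 1 = (y ^ 2 + y - 1) * (y ^ 2 - y + 2) + 3 * (1 - y)"
      by (simp add: algebra_simps power2_eq_square power4_eq_xxxx)
    then have f4: "f dvd y ^ 4 + 1" using f(2) unfolding H threep by simp
    moreover have "y ^ 8 - 1 = (y ^ 4 + 1) * (y ^ 4 - 1)" by (simp add: algebra_simps flip: power_add)
    ultimately have "f dvd y ^ 8 - 1" by simp
    moreover have "\<not> f dvd y ^ 4 - 1"
    proof
      assume "f dvd y ^ 4 - 1"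
      with f4 have "f dvd (y ^ 4 + 1) - (y ^ 4 - 1)" by (rule dvd_diff)
      then have "f dvd 3 - ((y ^ 4 + 1) - (y ^ 4 - 1))" using threep by simp
      then show False using f(1) by (simp add: irreducible_not_unit)
    qed
    ultimately show "f dvd [:0, 1:] ^ (2 ^ Suc (m + 2) * 1) - 1 \<and> \<not> f dvd [:0, 1:] ^ (2 ^ (m + 2) * 1) - 1"
      by (simp add: y_def power_mult[symmetric] power_add mult.commute)
  next
    fix s assume "int 2 ^ Suc (m + 2) dvd int (card (UNIV :: 'a set)) ^ s - 1"
    then have s: "(2::int) ^ (3 + m) dvd 3 ^ s - 1" using card by (simp add: numeral_eq_Suc)
    have s8: "(8::int) dvd 3 ^ s - 1" using s by (simp add: power_add dvd_mult_left)
    have "even s"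
    proof (rule ccontr)
      assume "odd s"
      then obtain t where t: "s = 2 * t + 1" by (elim oddE)
      have "(8::int) dvd 9 ^ t - 1" using power_minus_one_dvd[of 1 t "9::int"] by simp
      then have "(8::int) dvd (3 ^ s - 1) - 3 * (9 ^ t - 1)" using s8 by (intro dvd_diff[OF _ dvd_mult])
      then show False by (simp add: t power_mult)
    qed
    then obtain t where t: "s = 2 * t" by (elim evenE)
    have "2 ^ m dvd t"
      by (rule prime_power_dvd_exponent[of 2 3 9]) (use s t in \<open>auto simp: power_mult\<close>)
    then show "2 * 2 ^ m dvd s" using t by simp
  qed simp_all
qed

text \<open>Binomials \<open>X\<^sup>N - a\<close> work for fields with at least four elements; the unit groups of the two smaller
  fields are too small for them, and there \<open>X\<^bsup>2 N\<^esup> + X\<^sup>N - 1\<close> is used.\<close>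

definition family :: "bool \<Rightarrow> nat \<Rightarrow> 'a::field \<Rightarrow> 'a poly" where
  "family tri N a = [:0, 1:] ^ (if tri then 2 * N else N) + (if tri then [:0, 1:] ^ N else 0) - [:a:]"

text \<open>For fixed \<open>u\<close> the machine can test this condition with a fixed number of
  field operations.\<close>

definition good :: "bool \<Rightarrow> nat \<Rightarrow> 'a::field \<Rightarrow> bool" where
  "good tri u a \<longleftrightarrow> (if tri then a = 1 else a \<noteq> 0 \<and> a ^ u \<noteq> 1)"

lemma ex_irreducible_family:
  assumes fin: "finite (UNIV :: 'a::field set)"
  obtains tri l u where "l \<ge> 2" "\<exists>a::'a. good tri u a"
    "\<And>(a::'a) m. good tri u a \<Longrightarrow> irreducible (family tri (l ^ m) a)"
proof -
  let ?q = "card (UNIV :: 'a set)"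
  have "card {0, 1 :: 'a} \<le> ?q" using fin by (intro card_mono) auto
  then have "?q \<ge> 2" by simp
  then consider "?q = 2" | "?q = 3" | "?q \<ge> 4" by linarith
  then show ?thesis
  proof cases
    case 1
    show ?thesis
      by (rule that[of 3 True 0]) (auto simp: good_def family_def irreducible_trinomial_2[OF 1])
  next
    case 2
    show ?thesis
      by (rule that[of 2 True 0]) (auto simp: good_def family_def irreducible_trinomial_3[OF 2])
  next
    case 3
    obtain l u where l: "prime l" "?q - 1 = l * u" "l = 2 \<Longrightarrow> even u"
    proof (cases "4 dvd ?q - 1")
      case True
      then obtain t where "?q - 1 = 4 * t" by (elim dvdE)
      then show ?thesis by (intro that[of 2 "2 * t"]) auto
    next
      case False
      \<comment> \<open>Odd because 4 does not divide \<open>q - 1\<close>, and greater than 1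
        because \<open>q \<ge> 4\<close>; any prime factor serves as \<open>l\<close>.\<close>
      define h where "h = (if even (?q - 1) then (?q - 1) div 2 else ?q - 1)"
      have h: "odd h" "h > 1" "h dvd ?q - 1"
      proof -
        have "odd h \<and> h > 1 \<and> h dvd ?q - 1"
        proof (cases "even (?q - 1)")
          case True
          then obtain t where t: "?q - 1 = 2 * t" by (elim evenE)
          then have "h = t" "odd t" "t > 1" using False 3 by (auto simp: h_def)
          then show ?thesis using t by simp
        qed (use 3 in \<open>simp add: h_def\<close>)
        then show "odd h" "h > 1" "h dvd ?q - 1" by auto
      qed
      obtain l where "prime l" "l dvd h" using h(2) prime_factor_nat[of h] by auto
      moreover have "l \<noteq> 2" using h(1) \<open>l dvd h\<close> by auto
      ultimately show ?thesis using that[of l "(?q - 1) div l"] h(3) dvd_trans[of l h "?q - 1"] by auto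
    qed
    have u: "u > 0" using l 3 by (cases u) auto
    \<comment> \<open>Otherwise all \<open>l * u\<close> nonzero elements would be roots of
      \<open>X ^ u - 1\<close>.\<close>
    have "\<exists>a::'a. good False u a"
    proof (rule ccontr)
      assume "\<not> ?thesis"
      then have sub: "UNIV - {0} \<subseteq> {a::'a. poly ([:0, 1:] ^ u - 1) a = 0}" by (auto simp: good_def)
      have deg: "degree ([:0, 1:] ^ u - 1 :: 'a poly) \<le> u"
        by (rule degree_diff_le) (simp_all add: degree_power_eq)
      have nz: "[:0, 1:] ^ u - 1 \<noteq> (0 :: 'a poly)"
      proof
        assume "[:0, 1:] ^ u - 1 = (0 :: 'a poly)"
        then have "poly ([:0, 1:] ^ u - 1) (0 :: 'a) = 0" by simp
        then show False using u by (auto simp: power_0_left)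
      qed
      have "?q - 1 = card (UNIV - {0 :: 'a})" using fin by (simp add: card_Diff_singleton)
      also have "\<dots> \<le> u"
        using card_mono[OF poly_roots_finite[OF nz] sub] card_poly_roots_bound[OF nz] deg by linarith
      finally have "l * u \<le> u" using l by simp
      then show False using u prime_ge_2_nat[OF l(1)] by simp
    qed
    then show ?thesis
      by (intro that[of l False u])
        (auto simp: prime_ge_2_nat[OF l(1)] good_def family_def intro!: irreducible_binomial[OF fin l(1,2) u l(3)])
  qed
qed

section \<open>Running times of machine programs\<close>

text \<open>Total correctness with a time bound. The postcondition may itself be a
  \<open>runs\<close> statement, which is how sequences are composed.\<close>

definition runs :: "(nat \<Rightarrow> 'a::field) \<Rightarrow> nat \<Rightarrow> 'a blackbox \<Rightarrow> com \<Rightarrow> 'a state \<Rightarrow> nat \<Rightarrow> ('a state \<Rightarrow> bool) \<Rightarrow> bool" where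
  "runs e n bb c s T Q \<longleftrightarrow> (\<exists>t s'. exec e n bb c s t s' \<and> t \<le> T \<and> Q s')"

lemma runs_mono: "runs e n bb c s T Q \<Longrightarrow> T \<le> T' \<Longrightarrow> (\<And>s'. Q s' \<Longrightarrow> Q' s') \<Longrightarrow> runs e n bb c s T' Q'"
  unfolding runs_def by (meson order.trans)

lemma runs_Skip: "Q s \<Longrightarrow> runs e n bb Skip s 1 Q"
  unfolding runs_def by (blast intro: exec.Skip)

lemma runs_NAssign: "Q (nupdate x (nval a s) (nval b s) s) \<Longrightarrow> runs e n bb (NAssign x a b) s 1 Q"
  unfolding runs_def by (blast intro: exec.NAssign)

lemma runs_FAssign: "Q (fupdate x (nval a s) (fval e b s) s) \<Longrightarrow> runs e n bb (FAssign x a b) s 1 Q"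
  unfolding runs_def by (blast intro: exec.FAssign)

lemma runs_Seq:
  assumes "runs e n bb c1 s T1 (\<lambda>s'. runs e n bb c2 s' T2 Q)"
  shows "runs e n bb (Seq c1 c2) s (T1 + T2) Q"
proof -
  obtain t1 s1 where 1: "exec e n bb c1 s t1 s1" "t1 \<le> T1" "runs e n bb c2 s1 T2 Q"
    using assms unfolding runs_def by blast
  then obtain t2 s2 where "exec e n bb c2 s1 t2 s2" "t2 \<le> T2" "Q s2" unfolding runs_def by blast
  with 1 show ?thesis unfolding runs_def by (meson exec.Seq add_mono)
qed

lemma runs_Cond:
  assumes "bval e b s \<Longrightarrow> runs e n bb c1 s T Q" "\<not> bval e b s \<Longrightarrow> runs e n bb c2 s T Q"
  shows "runs e n bb (Cond b c1 c2) s (T + 1) Q"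
proof (cases "bval e b s")
  case True
  with assms(1) obtain t s' where "exec e n bb c1 s t s'" "t \<le> T" "Q s'" unfolding runs_def by blast
  with exec.CondTrue[OF True] show ?thesis unfolding runs_def by (meson add_mono order.refl)
next
  case False
  with assms(2) obtain t s' where "exec e n bb c2 s t s'" "t \<le> T" "Q s'" unfolding runs_def by blast
  with exec.CondFalse[OF False] show ?thesis unfolding runs_def by (meson add_mono order.refl)
qed

lemma runs_Query:
  assumes "legal_modulus (array_poly (snd s G) 0 (nval a s + 1)) (nval a s)"
    and "Q (store_answer R (nval a s) (bb (array_poly (snd s G) 0 (nval a s + 1)) (array_point (snd s P) n (nval a s))) s)"
  shows "runs e n bb (Query R G a P) s ((n + 2) * nval a s + 1) Q"
  unfolding runs_def using exec.Query[OF refl refl assms(1)] assms(2) by blast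

lemma runs_While:
  fixes \<mu> :: "'a::field state \<Rightarrow> nat"
  assumes "Inv s" and "\<And>s'. Inv s' \<Longrightarrow> bval e b s' \<Longrightarrow> runs e n bb c s' T (\<lambda>s''. Inv s'' \<and> \<mu> s'' < \<mu> s')"
  shows "runs e n bb (While b c) s (1 + \<mu> s * (T + 1)) (\<lambda>s'. Inv s' \<and> \<not> bval e b s')"
  using assms(1)
proof (induction "\<mu> s" arbitrary: s rule: less_induct)
  case less
  show ?case
  proof (cases "bval e b s")
    case False
    then have "exec e n bb (While b c) s 1 s" by (rule exec.WhileFalse)
    then show ?thesis unfolding runs_def using less.prems False
      by (intro exI[of _ 1] exI[of _ s]) auto
  next
    case True
    obtain t1 s1 where 1: "exec e n bb c s t1 s1" "t1 \<le> T" "Inv s1" "\<mu> s1 < \<mu> s"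
      using assms(2)[OF less.prems True] unfolding runs_def by blast
    obtain t2 s2 where 2: "exec e n bb (While b c) s1 t2 s2" "t2 \<le> 1 + \<mu> s1 * (T + 1)" "Inv s2" "\<not> bval e b s2"
      using less.hyps[OF 1(4,3)] unfolding runs_def by blast
    have "t1 + t2 + 1 \<le> 1 + Suc (\<mu> s1) * (T + 1)" using 1(2) 2(2) by simp
    also have "\<dots> \<le> 1 + \<mu> s * (T + 1)" using 1(4) by (intro add_mono mult_le_mono) auto
    finally show ?thesis
      unfolding runs_def using exec.WhileTrue[OF True 1(1) 2(1)] 2(3,4) by blast
  qed
qed

abbreviation var :: "vname \<Rightarrow> nexp" where "var x \<equiv> NArr x (NConst 0)"
abbreviation "set_var x a \<equiv> NAssign x (NConst 0) a"

definition For :: "vname \<Rightarrow> nexp \<Rightarrow> com \<Rightarrow> com" where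
  "For x b c = Seq (set_var x (NConst 0))
     (While (NLess (var x) b) (Seq c (set_var x (NAdd (var x) (NConst 1)))))"

text \<open>Each round pays for the body, the increment and the test; the 2 pays for the
  initialization and the last test. The body has to establish the invariant for the state after the
  increment.\<close>

lemma runs_For:
  assumes init: "Inv 0 (nupdate x 0 0 s)"
    and bound: "\<And>i s'. Inv i s' \<Longrightarrow> fst s' x 0 = i \<and> nval b s' = N"
    and body: "\<And>i s'. i < N \<Longrightarrow> Inv i s' \<Longrightarrow> runs e n bb c s' T (\<lambda>s''. fst s'' x 0 = i \<and> Inv (Suc i) (nupdate x 0 (Suc i) s''))"
  shows "runs e n bb (For x b c) s (2 + N * (T + 2)) (Inv N)"
proof -
  define J where "J = (\<lambda>s'. \<exists>i\<le>N. Inv i s')"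
  have "runs e n bb (While (NLess (var x) b) (Seq c (set_var x (NAdd (var x) (NConst 1))))) (nupdate x 0 0 s)
      (1 + (N - fst (nupdate x 0 0 s) x 0) * (T + 1 + 1)) (\<lambda>s'. J s' \<and> \<not> bval e (NLess (var x) b) s')"
  proof (rule runs_While[where \<mu> = "\<lambda>s. N - fst s x 0"])
    show "J (nupdate x 0 0 s)" using init by (auto simp: J_def)
    fix s' assume "J s'" and b: "bval e (NLess (var x) b) s'"
    then obtain i where i: "Inv i s'" by (auto simp: J_def)
    then have "i < N" using b bound by auto
    have "runs e n bb c s' T (\<lambda>s''. runs e n bb (set_var x (NAdd (var x) (NConst 1))) s'' 1
      (\<lambda>s''. J s'' \<and> N - fst s'' x 0 < N - fst s' x 0))"
      using body[OF \<open>i < N\<close> i]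
    proof (rule runs_mono)
      fix s'' assume s'': "fst s'' x 0 = i \<and> Inv (Suc i) (nupdate x 0 (Suc i) s'')"
      then show "runs e n bb (set_var x (NAdd (var x) (NConst 1))) s'' 1
          (\<lambda>s''. J s'' \<and> N - fst s'' x 0 < N - fst s' x 0)"
        using \<open>i < N\<close> bound[OF i] bound[of "Suc i" "nupdate x 0 (Suc i) s''"]
        by (intro runs_NAssign) (auto simp: J_def intro!: exI[of _ "Suc i"])
    qed simp
    then show "runs e n bb (Seq c (set_var x (NAdd (var x) (NConst 1)))) s' (T + 1)
        (\<lambda>s''. J s'' \<and> N - fst s'' x 0 < N - fst s' x 0)" by (rule runs_Seq)
  qed
  then have "runs e n bb (While (NLess (var x) b) (Seq c (set_var x (NAdd (var x) (NConst 1))))) (nupdate x 0 0 s)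
      (1 + N * (T + 2)) (Inv N)"
  proof (rule runs_mono)
    fix s' assume s': "J s' \<and> \<not> bval e (NLess (var x) b) s'"
    then obtain i where i: "i \<le> N" "Inv i s'" by (auto simp: J_def)
    then have "i = N" using bound[OF i(2)] s' by simp
    then show "Inv N s'" using i(2) by simp
  qed (simp add: nupdate_def)
  then have "runs e n bb (For x b c) s (1 + (1 + N * (T + 2))) (Inv N)"
    unfolding For_def by (intro runs_Seq runs_NAssign) simp
  then show ?thesis by simp
qed

definition unch :: "vname set \<Rightarrow> vname set \<Rightarrow> 'a state \<Rightarrow> 'a state \<Rightarrow> bool" where
  "unch X Y s s' \<longleftrightarrow> (\<forall>x. x \<notin> X \<longrightarrow> fst s' x = fst s x) \<and> (\<forall>y. y \<notin> Y \<longrightarrow> snd s' y = snd s y)"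

lemma unch_refl: "unch X Y s s"
  by (simp add: unch_def)

lemma unch_trans: "unch X Y s s' \<Longrightarrow> unch X' Y' s' s'' \<Longrightarrow> X' \<subseteq> X \<Longrightarrow> Y' \<subseteq> Y \<Longrightarrow> unch X Y s s''"
  unfolding unch_def by (metis subsetD)

lemma unch_fst: "unch X Y s s' \<Longrightarrow> x \<notin> X \<Longrightarrow> fst s' x = fst s x"
  and unch_snd: "unch X Y s s' \<Longrightarrow> y \<notin> Y \<Longrightarrow> snd s' y = snd s y"
  by (simp_all add: unch_def)

lemma unch_nupdate: "unch X Y s s' \<Longrightarrow> x \<in> X \<Longrightarrow> unch X Y s (nupdate x i v s')"
  and unch_fupdate: "unch X Y s s' \<Longrightarrow> y \<in> Y \<Longrightarrow> unch X Y s (fupdate y i w s')"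
  and unch_store: "unch X Y s s' \<Longrightarrow> y \<in> Y \<Longrightarrow> unch X Y s (store_answer y r z s')"
  by (auto simp: unch_def nupdate_def fupdate_def store_answer_def)

lemma state_simps [simp]:
  "fst (nupdate x i v s) = (fst s)(x := (fst s x)(i := v))" "snd (nupdate x i v s) = snd s"
  "fst (fupdate y i w s) = fst s" "snd (fupdate y i w s) = (snd s)(y := (snd s y)(i := w))"
  "fst (store_answer y r z s) = fst s"
  "snd (store_answer y r z s) = (snd s)(y := (\<lambda>j. if j < r then coeff z j else snd s y j))"
  by (simp_all add: nupdate_def fupdate_def store_answer_def)

text \<open>The machine can only add, so a product takes time linear in the factor that drives the
  loop, here \<open>y\<close>.\<close>

definition mul_var :: "vname \<Rightarrow> vname \<Rightarrow> vname \<Rightarrow> com" where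
  "mul_var z x y = Seq (set_var z (NConst 0)) (For ''m'' (var y) (set_var z (NAdd (var z) (var x))))"

lemma runs_mul_var:
  assumes "z \<noteq> x" "z \<noteq> y" "''m'' \<notin> {x, y, z}"
  shows "runs e n bb (mul_var z x y) s (3 + 3 * fst s y 0)
    (\<lambda>s'. unch {z, ''m''} {} s s' \<and> fst s' z 0 = fst s x 0 * fst s y 0)"
proof -
  define Inv where "Inv = (\<lambda>i s'. unch {z, ''m''} {} s s' \<and> fst s' ''m'' 0 = i \<and> fst s' z 0 = fst s x 0 * i)"
  have "runs e n bb (For ''m'' (var y) (set_var z (NAdd (var z) (var x)))) (nupdate z 0 0 s)
      (2 + fst s y 0 * (1 + 2)) (Inv (fst s y 0))"
  proof (rule runs_For)
    show "Inv 0 (nupdate ''m'' 0 0 (nupdate z 0 0 s))"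
      using assms by (simp add: Inv_def unch_nupdate unch_refl)
    show "fst s' ''m'' 0 = i \<and> nval (var y) s' = fst s y 0" if "Inv i s'" for i s'
      using that assms unch_fst[of "{z, ''m''}" "{}" s s' y] by (auto simp: Inv_def)
    show "runs e n bb (set_var z (NAdd (var z) (var x))) s' 1
        (\<lambda>s''. fst s'' ''m'' 0 = i \<and> Inv (Suc i) (nupdate ''m'' 0 (Suc i) s''))" if "Inv i s'" for i s'
      using that assms unch_fst[of "{z, ''m''}" "{}" s s' x]
      by (intro runs_NAssign) (auto simp: Inv_def intro!: unch_nupdate)
  qed
  then have "runs e n bb (mul_var z x y) s (1 + (2 + fst s y 0 * (1 + 2))) (Inv (fst s y 0))"
    unfolding mul_var_def by (intro runs_Seq runs_NAssign) simp
  then show ?thesis by (rule runs_mono) (auto simp: Inv_def)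
qed

section \<open>The search over an infinite field\<close>

definition power_step :: com where
  "power_step = Seq (NAssign ''W'' (NAdd (var ''j'') (NConst 1)) (NConst 0))
     (For ''m'' (NAdd (var ''d'') (NConst 1))
       (NAssign ''W'' (NAdd (var ''j'') (NConst 1))
         (NAdd (NArr ''W'' (NAdd (var ''j'') (NConst 1))) (NArr ''W'' (var ''j'')))))"

lemma runs_power_step:
  assumes "fst s ''j'' 0 = j" "fst s ''d'' 0 = d"
  shows "runs e n bb power_step s (3 + 3 * (d + 1))
    (\<lambda>s'. unch {''W'', ''m''} {} s s' \<and> fst s' ''W'' = (fst s ''W'')(Suc j := fst s ''W'' j * (d + 1)))"
proof -
  define Inv where "Inv = (\<lambda>c s'. unch {''W'', ''m''} {} s s' \<and> fst s' ''m'' 0 = c \<and>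
    fst s' ''W'' = (fst s ''W'')(Suc j := fst s ''W'' j * c))"
  have "runs e n bb (For ''m'' (NAdd (var ''d'') (NConst 1))
       (NAssign ''W'' (NAdd (var ''j'') (NConst 1))
         (NAdd (NArr ''W'' (NAdd (var ''j'') (NConst 1))) (NArr ''W'' (var ''j'')))))
       (nupdate ''W'' (Suc j) 0 s) (2 + (d + 1) * (1 + 2)) (Inv (d + 1))"
  proof (rule runs_For)
    show "Inv 0 (nupdate ''m'' 0 0 (nupdate ''W'' (Suc j) 0 s))"
      by (simp add: Inv_def unch_nupdate unch_refl)
    fix c s' assume I: "Inv c s'"
    then have u: "unch {''W'', ''m''} {} s s'" by (simp add: Inv_def)
    show "fst s' ''m'' 0 = c \<and> nval (NAdd (var ''d'') (NConst 1)) s' = d + 1"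
      using I assms unch_fst[OF u, of "''d''"] by (simp add: Inv_def)
    show "runs e n bb (NAssign ''W'' (NAdd (var ''j'') (NConst 1))
         (NAdd (NArr ''W'' (NAdd (var ''j'') (NConst 1))) (NArr ''W'' (var ''j'')))) s' 1
         (\<lambda>s''. fst s'' ''m'' 0 = c \<and> Inv (Suc c) (nupdate ''m'' 0 (Suc c) s''))"
      using I assms unch_fst[OF u, of "''j''"] by (intro runs_NAssign) (simp add: Inv_def unch_nupdate add.commute)
  qed
  then have "runs e n bb power_step s (1 + (2 + (d + 1) * (1 + 2))) (Inv (d + 1))"
    unfolding power_step_def using assms by (intro runs_Seq runs_NAssign) simp
  then show ?thesis by (rule runs_mono) (auto simp: Inv_def)
qed

text \<open>\<open>W\<close> holds the Kronecker weights, and its entry at \<open>k\<close> is the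
  limit \<open>D\<close>: the number of points tried over an infinite field, and a lower bound for
  the degree of the modulus over a finite one.\<close>

definition ctx :: "nat \<Rightarrow> nat \<Rightarrow> nat \<Rightarrow> nat \<Rightarrow> 'a state \<Rightarrow> bool" where
  "ctx n k d M s \<longleftrightarrow> fst s ''n'' 0 = n \<and> fst s ''k'' 0 = k \<and> (\<forall>j\<le>k. fst s ''W'' j = M * (d + 1) ^ j)"

lemma ctx_unch:
  "ctx n k d M s \<Longrightarrow> unch X Y s s' \<Longrightarrow> ''n'' \<notin> X \<Longrightarrow> ''k'' \<notin> X \<Longrightarrow> ''W'' \<notin> X \<Longrightarrow> ctx n k d M s'"
  by (simp add: ctx_def unch_fst)

text \<open>For \<open>d = 1\<close> the stored \<open>k\<close> becomes 1: a sum of linear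
  polynomials is linear, and the permitted time does not grow with \<open>k\<close>.\<close>

definition prepare :: com where
  "prepare = Seq (Cond (NEq (var ''d'') (NConst 1)) (set_var ''k'' (NConst 1)) Skip)
     (Seq (mul_var ''c'' ''n'' ''k'')
     (Seq (mul_var ''b'' ''c'' ''d'')
     (Seq (NAssign ''W'' (NConst 0) (NAdd (var ''b'') (NConst 1)))
     (For ''j'' (var ''k'') power_step))))"

lemma runs_prepare:
  fixes e :: "nat \<Rightarrow> 'a::field" and k d :: nat
  defines "k' \<equiv> if d = 1 then 1 else k"
  shows "runs e n bb prepare (initial_state n k d)
    (2 + (3 + 3 * k' + (3 + 3 * d + (1 + (2 + k' * (3 + 3 * (d + 1) + 2))))))
    (\<lambda>s'. ctx n k' d (d * (n * k') + 1) s' \<and> snd s' = (\<lambda>_ _. 0))"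
proof -
  define M where "M = d * (n * k') + 1"
  define A where "A = (\<lambda>s :: 'a state. fst s ''n'' 0 = n \<and> fst s ''k'' 0 = k' \<and> fst s ''d'' 0 = d \<and> snd s = (\<lambda>_ _. 0))"
  have A_unch: "A s'" if "A s" "unch X {} s s'" "''n'' \<notin> X" "''k'' \<notin> X" "''d'' \<notin> X" for X s s'
    using that by (auto simp: A_def unch_def)
  have 1: "runs e n bb (Cond (NEq (var ''d'') (NConst 1)) (set_var ''k'' (NConst 1)) Skip)
      (initial_state n k d) (1 + 1) A"
    by (rule runs_Cond; (rule runs_NAssign runs_Skip)) (auto simp: A_def k'_def initial_state_def)
  have 2: "runs e n bb (mul_var ''c'' ''n'' ''k'') s (3 + 3 * k') (\<lambda>s'. A s' \<and> fst s' ''c'' 0 = n * k')"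
    if "A s" for s
  proof -
    have "runs e n bb (mul_var ''c'' ''n'' ''k'') s (3 + 3 * fst s ''k'' 0)
      (\<lambda>s'. unch {''c'', ''m''} {} s s' \<and> fst s' ''c'' 0 = fst s ''n'' 0 * fst s ''k'' 0)"
      by (rule runs_mul_var) auto
    then show ?thesis
      by (rule runs_mono) (use that A_unch[OF that] in \<open>auto simp: A_def\<close>)
  qed
  have 3: "runs e n bb (mul_var ''b'' ''c'' ''d'') s (3 + 3 * d) (\<lambda>s'. A s' \<and> fst s' ''b'' 0 = n * k' * d)"
    if "A s \<and> fst s ''c'' 0 = n * k'" for s
  proof -
    have "runs e n bb (mul_var ''b'' ''c'' ''d'') s (3 + 3 * fst s ''d'' 0)
      (\<lambda>s'. unch {''b'', ''m''} {} s s' \<and> fst s' ''b'' 0 = fst s ''c'' 0 * fst s ''d'' 0)"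
      by (rule runs_mul_var) auto
    then show ?thesis
      by (rule runs_mono) (use that A_unch[of s] in \<open>auto simp: A_def\<close>)
  qed
  have 4: "runs e n bb (For ''j'' (var ''k'') power_step) s (2 + k' * (3 + 3 * (d + 1) + 2))
      (\<lambda>s'. ctx n k' d M s' \<and> snd s' = (\<lambda>_ _. 0))"
    if s: "A s" "fst s ''W'' 0 = M" for s
  proof -
    define Inv where "Inv = (\<lambda>j s'. unch {''W'', ''m'', ''j''} {} s s' \<and> fst s' ''j'' 0 = j \<and>
      (\<forall>i\<le>j. fst s' ''W'' i = M * (d + 1) ^ i))"
    have "runs e n bb (For ''j'' (var ''k'') power_step) s (2 + k' * (3 + 3 * (d + 1) + 2)) (Inv k')"
    proof (rule runs_For)
      show "Inv 0 (nupdate ''j'' 0 0 s)" using s by (simp add: Inv_def unch_nupdate unch_refl)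
      fix j s' assume I: "Inv j s'"
      then have u: "unch {''W'', ''m'', ''j''} {} s s'" by (simp add: Inv_def)
      show "fst s' ''j'' 0 = j \<and> nval (var ''k'') s' = k'"
        using I s unch_fst[OF u, of "''k''"] by (simp add: Inv_def A_def)
      have d: "fst s' ''d'' 0 = d" using s unch_fst[OF u, of "''d''"] by (simp add: A_def)
      have j: "fst s' ''j'' 0 = j" using I by (simp add: Inv_def)
      show "runs e n bb power_step s' (3 + 3 * (d + 1)) (\<lambda>s''. fst s'' ''j'' 0 = j \<and> Inv (Suc j) (nupdate ''j'' 0 (Suc j) s''))"
        using runs_power_step[OF j d]
      proof (rule runs_mono)
        fix s'' assume *: "unch {''W'', ''m''} {} s' s'' \<and> fst s'' ''W'' = (fst s' ''W'')(Suc j := fst s' ''W'' j * (d + 1))"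
        then have "unch {''W'', ''m'', ''j''} {} s s''" by (intro unch_trans[OF u]) auto
        moreover have "\<forall>i\<le>Suc j. fst s'' ''W'' i = M * (d + 1) ^ i" using I * by (auto simp: Inv_def le_Suc_eq algebra_simps)
        ultimately show "fst s'' ''j'' 0 = j \<and> Inv (Suc j) (nupdate ''j'' 0 (Suc j) s'')"
          using * j unch_fst[OF conjunct1[OF *], of "''j''"] by (simp add: Inv_def unch_nupdate)
      qed simp
    qed
    then show ?thesis
    proof (rule runs_mono)
      fix s' assume I: "Inv k' s'"
      then have u: "unch {''W'', ''m'', ''j''} {} s s'" by (simp add: Inv_def)
      have "snd s' = snd s" using u by (auto simp: unch_def)
      then show "ctx n k' d M s' \<and> snd s' = (\<lambda>_ _. 0)"
        using I s unch_fst[OF u, of "''k''"] unch_fst[OF u, of "''n''"] by (simp add: ctx_def A_def Inv_def)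
    qed simp
  qed
  have 5: "runs e n bb (Seq (NAssign ''W'' (NConst 0) (NAdd (var ''b'') (NConst 1))) (For ''j'' (var ''k'') power_step)) s
      (1 + (2 + k' * (3 + 3 * (d + 1) + 2))) (\<lambda>s'. ctx n k' d M s' \<and> snd s' = (\<lambda>_ _. 0))"
    if s: "A s \<and> fst s ''b'' 0 = n * k' * d" for s
    by (intro runs_Seq runs_NAssign 4) (use s in \<open>auto simp: A_def M_def\<close>)
  show ?thesis
    unfolding prepare_def M_def[symmetric]
    using runs_Seq[OF runs_mono[OF 1 order.refl runs_Seq[OF runs_mono[OF 2 order.refl runs_Seq[OF runs_mono[OF 3 order.refl 5]]]]]]
    by simp
qed

definition exponent :: "nat \<Rightarrow> nat \<Rightarrow> nat \<Rightarrow> nat \<Rightarrow> nat" where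
  "exponent d M i j = Suc i * Suc j + M * (d + 1) ^ j"

abbreviation limit :: nexp where "limit \<equiv> NArr ''W'' (var ''k'')"

lemma ctx_limit: "ctx n k d M s \<Longrightarrow> nval limit s = M * (d + 1) ^ k"
  by (simp add: ctx_def)

definition power_table :: com where
  "power_table = Seq (FAssign ''Z'' (NConst 0) FOne)
     (For ''x'' limit (FAssign ''Z'' (NAdd (var ''x'') (NConst 1)) (FMul (FArr ''Z'' (var ''x'')) (FEnum (var ''t'')))))"

lemma runs_power_table:
  assumes c: "ctx n k d M s" and t: "fst s ''t'' 0 = t"
  shows "runs e n' bb power_table s (3 + 3 * (M * (d + 1) ^ k))
    (\<lambda>s'. unch {''x''} {''Z''} s s' \<and> (\<forall>x\<le>M * (d + 1) ^ k. snd s' ''Z'' x = e t ^ x))"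
proof -
  let ?D = "M * (d + 1) ^ k"
  define Inv where "Inv = (\<lambda>x s'. unch {''x''} {''Z''} s s' \<and> fst s' ''x'' 0 = x \<and> (\<forall>y\<le>x. snd s' ''Z'' y = e t ^ y))"
  have "runs e n' bb (For ''x'' limit (FAssign ''Z'' (NAdd (var ''x'') (NConst 1)) (FMul (FArr ''Z'' (var ''x'')) (FEnum (var ''t'')))))
      (fupdate ''Z'' 0 1 s) (2 + ?D * (1 + 2)) (Inv ?D)"
  proof (rule runs_For)
    show "Inv 0 (nupdate ''x'' 0 0 (fupdate ''Z'' 0 1 s))"
      by (simp add: Inv_def unch_nupdate unch_fupdate unch_refl)
    fix x s' assume I: "Inv x s'"
    then have u: "unch {''x''} {''Z''} s s'" by (simp add: Inv_def)
    show "fst s' ''x'' 0 = x \<and> nval limit s' = ?D"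
      using I ctx_limit[OF ctx_unch[OF c u]] by (simp add: Inv_def)
    show "runs e n' bb (FAssign ''Z'' (NAdd (var ''x'') (NConst 1)) (FMul (FArr ''Z'' (var ''x'')) (FEnum (var ''t'')))) s' 1
        (\<lambda>s''. fst s'' ''x'' 0 = x \<and> Inv (Suc x) (nupdate ''x'' 0 (Suc x) s''))"
      using I t unch_fst[OF u, of "''t''"]
      by (intro runs_FAssign) (auto simp: Inv_def unch_nupdate unch_fupdate le_Suc_eq)
  qed
  then have "runs e n' bb power_table s (1 + (2 + ?D * (1 + 2))) (Inv ?D)"
    unfolding power_table_def by (intro runs_Seq runs_FAssign) simp
  then show ?thesis by (rule runs_mono) (auto simp: Inv_def)
qed

text \<open>Both searches build the coordinates term by term; they differ only in where a term is added and
  what is added.\<close>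

definition fill_row :: "nexp \<Rightarrow> fexp \<Rightarrow> com" where
  "fill_row pos val = Seq (set_var ''q'' (NConst 0))
     (For ''j'' (var ''k'')
       (Seq (set_var ''q'' (NAdd (var ''q'') (NAdd (var ''i'') (NConst 1))))
         (FAssign ''P'' pos (FAdd (FArr ''P'' pos) val))))"

text \<open>The postcondition is additive because several terms may go to the same position, as they
  do when values are accumulated. \<open>q\<close> reaches \<open>Suc i * Suc j\<close> by repeated
  addition.\<close>

lemma runs_fill_row:
  assumes c: "ctx n k d M s" and i: "fst s ''i'' 0 = i"
    and ev: "\<And>j s'. j < k \<Longrightarrow> unch {''q'', ''j''} {''P''} s s' \<Longrightarrow> fst s' ''j'' 0 = j \<Longrightarrow> fst s' ''q'' 0 = Suc i * Suc j \<Longrightarrow>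
      nval pos s' = pos' j \<and> fval e val s' = val' j"
  shows "runs e n' bb (fill_row pos val) s (3 + 4 * k)
    (\<lambda>s'. unch {''q'', ''j''} {''P''} s s' \<and>
      snd s' ''P'' = (\<lambda>y. snd s ''P'' y + (\<Sum>j<k. if y = pos' j then val' j else 0)))"
proof -
  define Inv where "Inv = (\<lambda>j s'. unch {''q'', ''j''} {''P''} s s' \<and> fst s' ''j'' 0 = j \<and> fst s' ''q'' 0 = Suc i * j \<and>
      snd s' ''P'' = (\<lambda>y. snd s ''P'' y + (\<Sum>j<j. if y = pos' j then val' j else 0)))"
  let ?body = "Seq (set_var ''q'' (NAdd (var ''q'') (NAdd (var ''i'') (NConst 1))))
         (FAssign ''P'' pos (FAdd (FArr ''P'' pos) val))"
  have "runs e n' bb (For ''j'' (var ''k'') ?body) (nupdate ''q'' 0 0 s) (2 + k * (1 + 1 + 2)) (Inv k)"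
  proof (rule runs_For)
    show "Inv 0 (nupdate ''j'' 0 0 (nupdate ''q'' 0 0 s))"
      by (simp add: Inv_def unch_nupdate unch_refl)
    fix j s' assume I: "Inv j s'"
    then have u: "unch {''q'', ''j''} {''P''} s s'" by (simp add: Inv_def)
    show "fst s' ''j'' 0 = j \<and> nval (var ''k'') s' = k"
      using I c unch_fst[OF u, of "''k''"] by (simp add: Inv_def ctx_def)
    assume j: "j < k"
    let ?s = "nupdate ''q'' 0 (Suc i * Suc j) s'"
    have q: "nval (NAdd (var ''q'') (NAdd (var ''i'') (NConst 1))) s' = Suc i * Suc j"
      using I i unch_fst[OF u, of "''i''"] by (simp add: Inv_def)
    have us: "unch {''q'', ''j''} {''P''} s ?s" using u by (rule unch_nupdate) simp
    have pv: "nval pos ?s = pos' j" "fval e val ?s = val' j"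
      using ev[OF j us] I by (auto simp: Inv_def)
    have "runs e n' bb (FAssign ''P'' pos (FAdd (FArr ''P'' pos) val)) ?s 1
        (\<lambda>s''. fst s'' ''j'' 0 = j \<and> Inv (Suc j) (nupdate ''j'' 0 (Suc j) s''))"
    proof (rule runs_FAssign, unfold fval.simps pv)
      define s1 where "s1 = fupdate ''P'' (pos' j) (snd ?s ''P'' (pos' j) + val' j) ?s"
      have "unch {''q'', ''j''} {''P''} s (nupdate ''j'' 0 (Suc j) s1)"
        unfolding s1_def by (rule unch_nupdate[OF unch_fupdate[OF us]]) auto
      moreover have "fst s1 ''j'' 0 = j" "fst s1 ''q'' 0 = Suc i * Suc j"
        using I by (simp_all add: s1_def Inv_def)
      moreover have "snd s1 ''P'' = (\<lambda>y. snd s ''P'' y + (\<Sum>j<Suc j. if y = pos' j then val' j else 0))"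
        using I by (simp add: s1_def Inv_def fun_eq_iff)
      ultimately have "fst s1 ''j'' 0 = j \<and> Inv (Suc j) (nupdate ''j'' 0 (Suc j) s1)"
        by (simp add: Inv_def)
      then show "fst (fupdate ''P'' (pos' j) (snd ?s ''P'' (pos' j) + val' j) ?s) ''j'' 0 = j \<and>
        Inv (Suc j) (nupdate ''j'' 0 (Suc j) (fupdate ''P'' (pos' j) (snd ?s ''P'' (pos' j) + val' j) ?s))"
        by (simp only: s1_def)
    qed
    then show "runs e n' bb ?body s' (1 + 1) (\<lambda>s''. fst s'' ''j'' 0 = j \<and> Inv (Suc j) (nupdate ''j'' 0 (Suc j) s''))"
      by (intro runs_Seq runs_NAssign) (simp only: q nval.simps(1))
  qed
  then have "runs e n' bb (fill_row pos val) s (1 + (2 + k * (1 + 1 + 2))) (Inv k)"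
    unfolding fill_row_def by (intro runs_Seq runs_NAssign) simp
  then show ?thesis by (rule runs_mono) (auto simp: Inv_def)
qed

definition fill_values :: com where
  "fill_values = For ''i'' (var ''n'') (Seq (FAssign ''P'' (var ''i'') FZero)
     (fill_row (var ''i'') (FArr ''Z'' (NAdd (var ''q'') (NArr ''W'' (var ''j''))))))"

lemma runs_fill_values:
  assumes c: "ctx n k d M s"
  shows "runs e n' bb fill_values s (2 + n * (4 + 4 * k + 2))
    (\<lambda>s'. unch {''i'', ''q'', ''j''} {''P''} s s' \<and> (\<forall>i<n. snd s' ''P'' i = (\<Sum>j<k. snd s ''Z'' (exponent d M i j))))"
proof -
  define Inv where "Inv = (\<lambda>i s'. unch {''i'', ''q'', ''j''} {''P''} s s' \<and> fst s' ''i'' 0 = i \<and>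
     (\<forall>y<i. snd s' ''P'' y = (\<Sum>j<k. snd s ''Z'' (exponent d M y j))))"
  let ?val = "FArr ''Z'' (NAdd (var ''q'') (NArr ''W'' (var ''j'')))"
  have "runs e n' bb fill_values s (2 + n * (1 + (3 + 4 * k) + 2)) (Inv n)"
    unfolding fill_values_def
  proof (rule runs_For)
    show "Inv 0 (nupdate ''i'' 0 0 s)" by (simp add: Inv_def unch_nupdate unch_refl)
    fix i s' assume I: "Inv i s'"
    then have u: "unch {''i'', ''q'', ''j''} {''P''} s s'" by (simp add: Inv_def)
    show "fst s' ''i'' 0 = i \<and> nval (var ''n'') s' = n"
      using I c unch_fst[OF u, of "''n''"] by (simp add: Inv_def ctx_def)
    let ?s = "fupdate ''P'' i 0 s'"
    have us: "unch {''i'', ''q'', ''j''} {''P''} s ?s" using u by (rule unch_fupdate) simp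
    have cs: "ctx n k d M ?s" using ctx_unch[OF c us] by simp
    have "runs e n' bb (fill_row (var ''i'') ?val) ?s (3 + 4 * k)
      (\<lambda>s''. unch {''q'', ''j''} {''P''} ?s s'' \<and>
      snd s'' ''P'' = (\<lambda>y. snd ?s ''P'' y + (\<Sum>j<k. if y = i then snd s ''Z'' (exponent d M i j) else 0)))"
    proof (rule runs_fill_row[OF cs])
      show "fst ?s ''i'' 0 = i" using I by (simp add: Inv_def)
      fix j s'' assume j: "j < k" and u2: "unch {''q'', ''j''} {''P''} ?s s''"
        and vals: "fst s'' ''j'' 0 = j" "fst s'' ''q'' 0 = Suc i * Suc j"
      have "fst s'' ''W'' j = M * (d + 1) ^ j" using ctx_unch[OF cs u2] j by (simp add: ctx_def)
      then show "nval (var ''i'') s'' = i \<and> fval e ?val s'' = snd s ''Z'' (exponent d M i j)"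
        using vals I unch_fst[OF u2, of "''i''"] unch_snd[OF u2, of "''Z''"] unch_snd[OF u, of "''Z''"]
        by (simp add: Inv_def exponent_def)
    qed
    then have "runs e n' bb (fill_row (var ''i'') ?val) ?s (3 + 4 * k)
      (\<lambda>s''. fst s'' ''i'' 0 = i \<and> Inv (Suc i) (nupdate ''i'' 0 (Suc i) s''))"
    proof (rule runs_mono)
      fix s'' assume *: "unch {''q'', ''j''} {''P''} ?s s'' \<and>
        snd s'' ''P'' = (\<lambda>y. snd ?s ''P'' y + (\<Sum>j<k. if y = i then snd s ''Z'' (exponent d M i j) else 0))"
      then have "unch {''i'', ''q'', ''j''} {''P''} s s''" by (intro unch_trans[OF us]) auto
      then show "fst s'' ''i'' 0 = i \<and> Inv (Suc i) (nupdate ''i'' 0 (Suc i) s'')"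
        using * I unch_fst[of _ _ ?s s'' "''i''"] by (auto simp: Inv_def unch_nupdate less_Suc_eq)
    qed simp
    then show "runs e n' bb (Seq (FAssign ''P'' (var ''i'') FZero) (fill_row (var ''i'') ?val)) s' (1 + (3 + 4 * k))
      (\<lambda>s''. fst s'' ''i'' 0 = i \<and> Inv (Suc i) (nupdate ''i'' 0 (Suc i) s''))"
      using I by (intro runs_Seq runs_FAssign) (simp add: Inv_def)
  qed
  then show ?thesis by (rule runs_mono) (auto simp: Inv_def)
qed

text \<open>The modulus \<open>X\<close> makes every query an evaluation over the field itself; its
  constant coefficient 0 is already present in the initial state.\<close>

definition search_infinite :: com where
  "search_infinite = Seq (set_var ''out'' (NConst 1)) (Seq (FAssign ''G'' (NConst 1) FOne)
    (For ''t'' limit (Seq power_table (Seq fill_values (Seq (Query ''R'' ''G'' (NConst 1) ''P'')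
      (Cond (FEq (FArr ''R'' (NConst 0)) FZero) Skip (set_var ''out'' (NConst 0))))))))"

lemma array_poly_X: "array_poly A 0 2 = [:0, 1:]" if "A 0 = 0" "A 1 = 1"
  using that by (simp add: array_poly_def numeral_2_eq_2 monom_0 monom_Suc)

lemma runs_search_infinite:
  fixes e :: "nat \<Rightarrow> 'a::field"
  assumes c: "ctx n k d M s" and G: "snd s ''G'' 0 = 0" and D: "D = M * (d + 1) ^ k"
    and exp: "\<And>i j. i < n \<Longrightarrow> j < k \<Longrightarrow> exponent d M i j \<le> D"
    and bb: "\<And>P t. (\<And>i. i < n \<Longrightarrow> P i = (\<Sum>j<k. e t ^ exponent d M i j)) \<Longrightarrow>
      bb [:0, 1:] (array_point P n 1) = [:f t:]"
  shows "runs e n bb search_infinite s (4 + D * (3 + 3 * D + (2 + n * (4 + 4 * k + 2) + ((n + 2) * 1 + 1 + 2)) + 2))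
    (\<lambda>s'. verdict s' = (if \<forall>t<D. f t = 0 then 1 else 0))"
proof -
  define Inv where "Inv = (\<lambda>t (s' :: 'a state). ctx n k d M s' \<and> fst s' ''t'' 0 = t \<and> snd s' ''G'' 0 = 0 \<and> snd s' ''G'' 1 = 1 \<and>
     verdict s' = (if \<forall>x<t. f x = 0 then 1 else 0))"
  let ?test = "Cond (FEq (FArr ''R'' (NConst 0)) FZero) Skip (set_var ''out'' (NConst 0))"
  let ?query = "Query ''R'' ''G'' (NConst 1) ''P''"
  let ?s0 = "fupdate ''G'' 1 1 (nupdate ''out'' 0 1 s)"
  have "runs e n bb (For ''t'' limit (Seq power_table (Seq fill_values (Seq ?query ?test)))) ?s0
    (2 + D * (3 + 3 * D + (2 + n * (4 + 4 * k + 2) + ((n + 2) * 1 + 1 + (1 + 1))) + 2)) (Inv D)"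
  proof (rule runs_For)
    show "Inv 0 (nupdate ''t'' 0 0 ?s0)" using c G by (simp add: Inv_def ctx_def verdict_def)
    fix t s1 assume I: "Inv t s1"
    then have c1: "ctx n k d M s1" and t1: "fst s1 ''t'' 0 = t" by (simp_all add: Inv_def)
    show "fst s1 ''t'' 0 = t \<and> nval limit s1 = D" using t1 ctx_limit[OF c1] D by simp
    let ?post = "\<lambda>s''. fst s'' ''t'' 0 = t \<and> Inv (Suc t) (nupdate ''t'' 0 (Suc t) s'')"
    have last: "runs e n bb (Seq ?query ?test) s3 ((n + 2) * 1 + 1 + (1 + 1)) ?post"
      if u: "unch {''x'', ''i'', ''q'', ''j''} {''Z'', ''P''} s1 s3"
        and P: "\<And>i. i < n \<Longrightarrow> snd s3 ''P'' i = (\<Sum>j<k. e t ^ exponent d M i j)" for s3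
    proof -
      have G3: "array_poly (snd s3 ''G'') 0 2 = [:0, 1:]"
        using I unch_snd[OF u, of "''G''"] by (intro array_poly_X) (simp_all add: Inv_def)
      let ?s4 = "store_answer ''R'' 1 [:f t:] s3"
      have u4: "unch {''x'', ''i'', ''q'', ''j''} {''Z'', ''P'', ''R''} s1 ?s4"
        by (rule unch_store) (use u in \<open>auto simp: unch_def\<close>)
      have ctx4: "ctx n k d M ?s4" by (rule ctx_unch[OF c1 u4]) auto
      have f4: "fst ?s4 ''t'' 0 = t" "fst ?s4 ''out'' 0 = (if \<forall>x<t. f x = 0 then 1 else 0)"
        using I t1 unch_fst[OF u, of "''t''"] unch_fst[OF u, of "''out''"] by (simp_all add: Inv_def verdict_def)
      have G4: "snd ?s4 ''G'' 0 = 0" "snd ?s4 ''G'' 1 = 1"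
        using I unch_snd[OF u4, of "''G''"] by (simp_all add: Inv_def)
      have R: "snd ?s4 ''R'' 0 = f t" by simp
      have "runs e n bb ?test ?s4 (1 + 1) ?post"
      proof (rule runs_Cond)
        assume "bval e (FEq (FArr ''R'' (NConst 0)) FZero) ?s4"
        then have "f t = 0" by simp
        then show "runs e n bb Skip ?s4 1 ?post"
          using ctx4 f4 G4 by (intro runs_Skip) (auto simp: Inv_def verdict_def less_Suc_eq ctx_def)
      next
        assume "\<not> bval e (FEq (FArr ''R'' (NConst 0)) FZero) ?s4"
        then have "f t \<noteq> 0" by simp
        then show "runs e n bb (set_var ''out'' (NConst 0)) ?s4 1 ?post"
          using ctx4 f4 G4 by (intro runs_NAssign) (auto simp: Inv_def verdict_def less_Suc_eq ctx_def)
      qed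
      moreover have "legal_modulus [:0, 1 :: 'a:] 1"
        by (simp add: legal_modulus_def irreducible_linear_field_poly)
      ultimately have "runs e n bb ?query s3 ((n + 2) * nval (NConst 1) s3 + 1) (\<lambda>s4. runs e n bb ?test s4 (1 + 1) ?post)"
        using G3 bb[of "snd s3 ''P''" t, OF P] by (intro runs_Query) (simp_all add: numeral_2_eq_2)
      then show ?thesis by (intro runs_Seq) simp
    qed
    have "runs e n bb (Seq fill_values (Seq ?query ?test)) s2 (2 + n * (4 + 4 * k + 2) + ((n + 2) * 1 + 1 + (1 + 1))) ?post"
      if s2: "unch {''x''} {''Z''} s1 s2 \<and> (\<forall>x\<le>M * (d + 1) ^ k. snd s2 ''Z'' x = e t ^ x)" for s2
    proof -
      have c2: "ctx n k d M s2" by (rule ctx_unch[OF c1 conjunct1[OF s2]]) auto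
      show ?thesis
      proof (rule runs_Seq, rule runs_mono[OF runs_fill_values[OF c2] order.refl])
        fix s3 assume s3: "unch {''i'', ''q'', ''j''} {''P''} s2 s3 \<and> (\<forall>i<n. snd s3 ''P'' i = (\<Sum>j<k. snd s2 ''Z'' (exponent d M i j)))"
        show "runs e n bb (Seq ?query ?test) s3 ((n + 2) * 1 + 1 + (1 + 1)) ?post"
        proof (rule last)
          show "unch {''x'', ''i'', ''q'', ''j''} {''Z'', ''P''} s1 s3"
            using s2 s3 by (auto simp: unch_def)
          show "snd s3 ''P'' i = (\<Sum>j<k. e t ^ exponent d M i j)" if "i < n" for i
            using s2 s3 that exp[OF that] D by simp
        qed
      qed
    qed
    then show "runs e n bb (Seq power_table (Seq fill_values (Seq ?query ?test))) s1
      (3 + 3 * D + (2 + n * (4 + 4 * k + 2) + ((n + 2) * 1 + 1 + (1 + 1)))) ?post"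
      unfolding D by (intro runs_Seq[OF runs_mono[OF runs_power_table[OF c1 t1] order.refl]])
  qed
  then have "runs e n bb search_infinite s (1 + (1 + (2 + D * (3 + 3 * D + (2 + n * (4 + 4 * k + 2) + ((n + 2) * 1 + 1 + (1 + 1))) + 2)))) (Inv D)"
    unfolding search_infinite_def by (intro runs_Seq runs_NAssign runs_FAssign) simp
  then show ?thesis by (rule runs_mono) (auto simp: Inv_def)
qed

section \<open>The search over a finite field\<close>

lemma coeff_array_poly: "coeff (array_poly A start len) x = (if x < len then A (start + x) else 0)"
  unfolding array_poly_def coeff_sum by (simp add: coeff_monom)

definition fill_coeffs :: com where
  "fill_coeffs = Seq (set_var ''base'' (NConst 0)) (For ''i'' (var ''n'')
     (Seq (fill_row (NAdd (var ''base'') (NAdd (var ''q'') (NArr ''W'' (var ''j'')))) FOne)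
       (set_var ''base'' (NAdd (var ''base'') (var ''r'')))))"

lemma runs_fill_coeffs:
  fixes s :: "'a::field state"
  assumes c: "ctx n k d M s" and r: "fst s ''r'' 0 = r" and P: "snd s ''P'' = (\<lambda>_. 0)"
  shows "runs e n' bb fill_coeffs s (3 + n * (6 + 4 * k))
    (\<lambda>s'. unch {''i'', ''q'', ''j'', ''base''} {''P''} s s' \<and>
      snd s' ''P'' = (\<lambda>y. \<Sum>i<n. \<Sum>j<k. if y = i * r + exponent d M i j then 1 else 0))"
proof -
  define Inv where "Inv = (\<lambda>i (s' :: 'a state). unch {''i'', ''q'', ''j'', ''base''} {''P''} s s' \<and> fst s' ''i'' 0 = i \<and>
     fst s' ''base'' 0 = i * r \<and>
     snd s' ''P'' = (\<lambda>y. \<Sum>i<i. \<Sum>j<k. if y = i * r + exponent d M i j then 1 else 0))"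
  let ?pos = "NAdd (var ''base'') (NAdd (var ''q'') (NArr ''W'' (var ''j'')))"
  let ?body = "Seq (fill_row ?pos FOne) (set_var ''base'' (NAdd (var ''base'') (var ''r'')))"
  have "runs e n' bb (For ''i'' (var ''n'') ?body) (nupdate ''base'' 0 0 s) (2 + n * (3 + 4 * k + 1 + 2)) (Inv n)"
  proof (rule runs_For)
    show "Inv 0 (nupdate ''i'' 0 0 (nupdate ''base'' 0 0 s))" using P by (simp add: Inv_def unch_nupdate unch_refl)
    fix i s' assume I: "Inv i s'"
    then have u: "unch {''i'', ''q'', ''j'', ''base''} {''P''} s s'" by (simp add: Inv_def)
    have cs: "ctx n k d M s'" using ctx_unch[OF c u] by simp
    show "fst s' ''i'' 0 = i \<and> nval (var ''n'') s' = n"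
      using I cs by (simp add: Inv_def ctx_def)
    let ?post = "\<lambda>s''. fst s'' ''i'' 0 = i \<and> Inv (Suc i) (nupdate ''i'' 0 (Suc i) s'')"
    have "runs e n' bb (fill_row ?pos FOne) s' (3 + 4 * k)
      (\<lambda>s''. unch {''q'', ''j''} {''P''} s' s'' \<and>
      snd s'' ''P'' = (\<lambda>y. snd s' ''P'' y + (\<Sum>j<k. if y = i * r + exponent d M i j then 1 else 0)))"
    proof (rule runs_fill_row[OF cs])
      show "fst s' ''i'' 0 = i" using I by (simp add: Inv_def)
      fix j s'' assume j: "j < k" and u2: "unch {''q'', ''j''} {''P''} s' s''"
        and vals: "fst s'' ''j'' 0 = j" "fst s'' ''q'' 0 = Suc i * Suc j"
      have "fst s'' ''W'' j = M * (d + 1) ^ j" using ctx_unch[OF cs u2] j by (simp add: ctx_def)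
      then show "nval ?pos s'' = i * r + exponent d M i j \<and> fval e FOne s'' = 1"
        using vals I unch_fst[OF u2, of "''base''"] by (simp add: Inv_def exponent_def)
    qed
    then have "runs e n' bb (fill_row ?pos FOne) s' (3 + 4 * k)
      (\<lambda>s''. runs e n' bb (set_var ''base'' (NAdd (var ''base'') (var ''r''))) s'' 1 ?post)"
    proof (rule runs_mono)
      fix s'' assume *: "unch {''q'', ''j''} {''P''} s' s'' \<and>
        snd s'' ''P'' = (\<lambda>y. snd s' ''P'' y + (\<Sum>j<k. if y = i * r + exponent d M i j then 1 else 0))"
      then have u3: "unch {''i'', ''q'', ''j'', ''base''} {''P''} s s''" by (intro unch_trans[OF u]) auto
      have "fst s'' ''i'' 0 = i" "fst s'' ''base'' 0 = i * r"
        using I unch_fst[OF conjunct1[OF *], of "''i''"] unch_fst[OF conjunct1[OF *], of "''base''"]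
        by (simp_all add: Inv_def)
      moreover have "fst s'' ''r'' 0 = r" using r unch_fst[OF u3, of "''r''"] by simp
      moreover have "snd s'' ''P'' = (\<lambda>y. \<Sum>i<Suc i. \<Sum>j<k. if y = i * r + exponent d M i j then 1 else 0)"
        using * I by (simp add: Inv_def)
      ultimately show "runs e n' bb (set_var ''base'' (NAdd (var ''base'') (var ''r''))) s'' 1 ?post"
        using u3 by (intro runs_NAssign) (simp add: Inv_def unch_nupdate add.commute)
    qed simp
    then show "runs e n' bb ?body s' (3 + 4 * k + 1) ?post" by (rule runs_Seq)
  qed
  then have "runs e n' bb fill_coeffs s (1 + (2 + n * (3 + 4 * k + 1 + 2))) (Inv n)"
    unfolding fill_coeffs_def by (intro runs_Seq runs_NAssign) simp
  then show ?thesis by (rule runs_mono) (auto simp: Inv_def)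
qed

text \<open>All exponents are below \<open>r\<close>, so the blocks of length \<open>r\<close> do
  not overlap and division by \<open>r\<close> recovers the coordinate.\<close>

lemma array_poly_fill:
  fixes P :: "nat \<Rightarrow> 'a::field"
  assumes P: "P = (\<lambda>y. \<Sum>i<n. \<Sum>j<k. if y = i * r + exponent d M i j then 1 else 0)"
    and exp: "\<And>i j. i < n \<Longrightarrow> j < k \<Longrightarrow> exponent d M i j < r" and i: "i < n"
  shows "array_poly P (i * r) r = hit k d M i"
proof (rule poly_eqI)
  fix x
  have hit: "coeff (hit k d M i :: 'a poly) x = (\<Sum>j<k. if x = exponent d M i j then 1 else 0)"
    unfolding hit_def coeff_sum exponent_def coeff_monom by (simp add: eq_commute)
  show "coeff (array_poly P (i * r) r) x = coeff (hit k d M i) x"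
  proof (cases "x < r")
    case True
    have "P (i * r + x) = (\<Sum>i'<n. if i' = i then \<Sum>j<k. if x = exponent d M i j then 1 else 0 else 0)"
      unfolding P
    proof (rule sum.cong[OF refl])
      fix i' assume i': "i' \<in> {..<n}"
      have eq: "i * r + x = i' * r + exponent d M i' j \<longleftrightarrow> i' = i \<and> x = exponent d M i' j" if "j < k" for j
      proof
        assume *: "i * r + x = i' * r + exponent d M i' j"
        have "exponent d M i' j < r" using exp i' that by simp
        then have "(i' * r + exponent d M i' j) div r = i'" "(i * r + x) div r = i" using True by simp_all
        then have "i' = i" using * by simp
        then show "i' = i \<and> x = exponent d M i' j" using * by simp
      qed simp
      show "(\<Sum>j<k. if i * r + x = i' * r + exponent d M i' j then 1 else 0)
          = (if i' = i then \<Sum>j<k. if x = exponent d M i j then 1 else 0 else (0::'a))"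
        by (cases "i' = i") (simp_all add: eq)
    qed
    also have "\<dots> = (\<Sum>j<k. if x = exponent d M i j then 1 else 0)" using i by simp
    finally show ?thesis using True by (simp add: coeff_array_poly hit)
  next
    case False
    then have "x \<noteq> exponent d M i j" if "j < k" for j using exp[OF i that] by auto
    then show ?thesis using False by (simp add: coeff_array_poly hit)
  qed
qed

section \<open>Constructing the irreducible modulus\<close>

primrec ntimes :: "nat \<Rightarrow> nexp \<Rightarrow> nexp" where
  "ntimes 0 a = NConst 0"
| "ntimes (Suc m) a = NAdd a (ntimes m a)"

lemma nval_ntimes [simp]: "nval (ntimes m a) s = m * nval a s"
  by (induction m) auto

text \<open>As with \<open>ntimes\<close>, the number is a constant of the program, so the
  expression has fixed size and costs one step.\<close>

primrec fpower :: "nat \<Rightarrow> fexp \<Rightarrow> fexp" where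
  "fpower 0 a = FOne"
| "fpower (Suc m) a = FMul a (fpower m a)"

lemma fval_fpower [simp]: "fval e (fpower m a) s = fval e a s ^ m"
  by (induction m) auto

definition good_test :: "bool \<Rightarrow> nat \<Rightarrow> fexp \<Rightarrow> bexp" where
  "good_test tri u a = (if tri then FEq a FOne
     else BAnd (BNot (FEq a FZero)) (BNot (FEq (fpower u a) FOne)))"

lemma bval_good_test [simp]: "bval e (good_test tri u a) s \<longleftrightarrow> good tri u (fval e a s)"
  by (simp add: good_test_def good_def)

text \<open>\<open>N\<close> ends as the least power of \<open>l\<close> that is not below the
  limit. For binomials \<open>N\<close> and \<open>r\<close> coincide, and the last two assignments
  write the same leading coefficient.\<close>

definition find_modulus :: "nat \<Rightarrow> bool \<Rightarrow> nat \<Rightarrow> com" where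
  "find_modulus l tri u =
     Seq (set_var ''a'' (NConst 0))
    (Seq (While (BNot (good_test tri u (FEnum (var ''a'')))) (set_var ''a'' (NAdd (var ''a'') (NConst 1))))
    (Seq (set_var ''N'' (NConst 1))
    (Seq (While (NLess (var ''N'') limit) (set_var ''N'' (ntimes l (var ''N''))))
    (Seq (set_var ''r'' (ntimes (if tri then 2 else 1) (var ''N'')))
    (Seq (FAssign ''G'' (NConst 0) (FSub FZero (FEnum (var ''a''))))
    (Seq (FAssign ''G'' (var ''N'') FOne)
         (FAssign ''G'' (var ''r'') FOne)))))))"

lemma array_poly_family:
  assumes "N > 0" and r: "r = (if tri then 2 else 1) * N"
  shows "array_poly ((\<lambda>_. 0)(0 := 0 - a, N := 1, r := 1)) 0 (r + 1) = family tri N a"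
proof (rule poly_eqI)
  fix x
  have X: "[:0, 1:] ^ i = (monom 1 i :: 'a poly)" for i by (simp add: monom_altdef)
  have c: "coeff [:a:] x = (if x = 0 then a else 0)" by (cases x) simp_all
  show "coeff (array_poly ((\<lambda>_. 0)(0 := 0 - a, N := 1, r := 1)) 0 (r + 1)) x = coeff (family tri N a) x"
    using assms unfolding coeff_array_poly family_def X by (cases tri) (auto simp: coeff_monom c)
qed

lemma degree_family:
  assumes "N > 0"
  shows "degree (family tri N a) = (if tri then 2 else 1) * N"
proof -
  let ?r = "(if tri then 2 else 1) * N"
  have X: "[:0, 1:] ^ i = (monom 1 i :: 'a poly)" for i by (simp add: monom_altdef)
  have c: "coeff [:a:] x = (if x = 0 then a else 0)" for x by (cases x) simp_all
  show ?thesis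
  proof (rule antisym)
    show "degree (family tri N a) \<le> ?r"
      using assms by (intro degree_le) (auto simp: family_def X coeff_monom c)
    have "coeff (family tri N a) ?r \<noteq> 0"
      using assms by (auto simp: family_def X coeff_monom c)
    then show "?r \<le> degree (family tri N a)" by (rule le_degree)
  qed
qed

text \<open>The last multiplication overshoots \<open>D\<close> by at most the factor
  \<open>l\<close>. Every round increases \<open>N\<close>, so the crude count of \<open>D\<close>
  rounds is enough.\<close>

lemma runs_find_modulus:
  fixes s :: "'a::field state"
  assumes c: "ctx n k d M s" and D: "D = M * (d + 1) ^ k" "D > 0" and G: "snd s ''G'' = (\<lambda>_. 0)"
    and l: "l \<ge> 2" and i0: "good tri u (e i0)"
  shows "runs e n' bb (find_modulus l tri u) s (8 + 2 * i0 + 2 * D)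
    (\<lambda>s'. unch {''a'', ''N'', ''r''} {''G''} s s' \<and> (\<exists>m x. good tri u x \<and> D \<le> l ^ m \<and> l ^ m \<le> l * D \<and>
       fst s' ''r'' 0 = (if tri then 2 else 1) * l ^ m \<and>
       array_poly (snd s' ''G'') 0 (fst s' ''r'' 0 + 1) = family tri (l ^ m) x))" (is "runs _ _ _ _ _ _ ?Q")
proof -
  define I1 where "I1 = (\<lambda>s' :: 'a state. unch {''a''} {} s s' \<and> fst s' ''a'' 0 \<le> i0)"
  define I2 where "I2 = (\<lambda>s' :: 'a state. unch {''a'', ''N''} {} s s' \<and> good tri u (e (fst s' ''a'' 0)) \<and>
    (\<exists>m. fst s' ''N'' 0 = l ^ m) \<and> fst s' ''N'' 0 \<le> l * D)"
  let ?w1 = "While (BNot (good_test tri u (FEnum (var ''a'')))) (set_var ''a'' (NAdd (var ''a'') (NConst 1)))"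
  let ?w2 = "While (NLess (var ''N'') limit) (set_var ''N'' (ntimes l (var ''N'')))"
  let ?fin = "Seq (set_var ''r'' (ntimes (if tri then 2 else 1) (var ''N'')))
    (Seq (FAssign ''G'' (NConst 0) (FSub FZero (FEnum (var ''a''))))
    (Seq (FAssign ''G'' (var ''N'') FOne) (FAssign ''G'' (var ''r'') FOne)))"
  have fin: "runs e n' bb ?fin s' (1 + (1 + (1 + 1))) ?Q" if s': "I2 s'" "D \<le> fst s' ''N'' 0" for s'
  proof -
    obtain m where m: "fst s' ''N'' 0 = l ^ m" using s' by (auto simp: I2_def)
    have u: "unch {''a'', ''N''} {} s s'" using s' by (simp add: I2_def)
    have G': "snd s' ''G'' = (\<lambda>_. 0)" using unch_snd[OF u, of "''G''"] G by simp
    define r where "r = (if tri then 2 else 1) * l ^ m"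
    let ?a = "e (fst s' ''a'' 0)"
    define s4 where "s4 = fupdate ''G'' r 1 (fupdate ''G'' (l ^ m) 1 (fupdate ''G'' 0 (0 - ?a) (nupdate ''r'' 0 r s')))"
    have "l ^ m > 0" using l by simp
    then have fam: "array_poly ((\<lambda>_. 0)(0 := 0 - ?a, l ^ m := 1, r := 1)) 0 (r + 1) = family tri (l ^ m) ?a"
      by (intro array_poly_family) (simp_all add: r_def)
    have "unch {''a'', ''N'', ''r''} {''G''} s s'" using u by (auto simp: unch_def)
    then have "unch {''a'', ''N'', ''r''} {''G''} s s4" unfolding s4_def
      by (intro unch_nupdate unch_fupdate) auto
    moreover have "snd s4 ''G'' = (\<lambda>_. 0)(0 := 0 - ?a, l ^ m := 1, r := 1)" by (simp add: s4_def G')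
    moreover have "fst s4 ''r'' 0 = r" by (simp add: s4_def)
    ultimately have Q: "?Q s4"
      using s' m fam by (auto simp: I2_def r_def intro!: exI[of _ m] exI[of _ ?a])
    then show ?thesis
      by (intro runs_Seq runs_NAssign runs_FAssign) (simp add: m s4_def r_def)
  qed
  have w2: "runs e n' bb (Seq ?w2 ?fin) s' ((1 + D * (1 + 1)) + (1 + (1 + (1 + 1)))) ?Q"
    if s': "I2 s'" for s'
  proof (rule runs_Seq)
    have "runs e n' bb ?w2 s' (1 + (D - fst s' ''N'' 0) * (1 + 1)) (\<lambda>s'. I2 s' \<and> \<not> bval e (NLess (var ''N'') limit) s')"
    proof (rule runs_While[where \<mu> = "\<lambda>s. D - fst s ''N'' 0"])
      show "I2 s'" by (rule s')
      fix s'' assume I: "I2 s''" and b: "bval e (NLess (var ''N'') limit) s''"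
      have u: "unch {''a'', ''N''} {} s s''" using I by (simp add: I2_def)
      have lim: "nval limit s'' = D" using ctx_limit[OF ctx_unch[OF c u]] D by simp
      obtain m where m: "fst s'' ''N'' 0 = l ^ m" using I by (auto simp: I2_def)
      have less: "l ^ m < D" using b lim m by simp
      then have "l * l ^ m \<le> l * D" by simp
      moreover have "l ^ m < l * l ^ m" using l by simp
      then have "D - l * l ^ m < D - l ^ m" using less by linarith
      ultimately have "I2 (nupdate ''N'' 0 (l * l ^ m) s'') \<and> D - l * l ^ m < D - l ^ m"
        using I less u by (auto simp: I2_def intro!: unch_nupdate exI[of _ "Suc m"])
      then show "runs e n' bb (set_var ''N'' (ntimes l (var ''N''))) s'' 1
          (\<lambda>s'''. I2 s''' \<and> D - fst s''' ''N'' 0 < D - fst s'' ''N'' 0)"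
        using m by (intro runs_NAssign) simp
    qed
    then show "runs e n' bb ?w2 s' (1 + D * (1 + 1)) (\<lambda>s'. runs e n' bb ?fin s' (1 + (1 + (1 + 1))) ?Q)"
    proof (rule runs_mono)
      fix s'' assume I: "I2 s'' \<and> \<not> bval e (NLess (var ''N'') limit) s''"
      then have u: "unch {''a'', ''N''} {} s s''" by (simp add: I2_def)
      have "nval limit s'' = D" using ctx_limit[OF ctx_unch[OF c u]] D by simp
      then show "runs e n' bb ?fin s'' (1 + (1 + (1 + 1))) ?Q" using I by (intro fin) auto
    qed simp
  qed
  have "runs e n' bb ?w1 (nupdate ''a'' 0 0 s) (1 + (i0 - fst (nupdate ''a'' 0 0 s) ''a'' 0) * (1 + 1))
    (\<lambda>s'. I1 s' \<and> \<not> bval e (BNot (good_test tri u (FEnum (var ''a'')))) s')"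
  proof (rule runs_While[where \<mu> = "\<lambda>s. i0 - fst s ''a'' 0"])
    show "I1 (nupdate ''a'' 0 0 s)" by (simp add: I1_def unch_nupdate unch_refl)
    fix s' assume I: "I1 s'" and b: "bval e (BNot (good_test tri u (FEnum (var ''a'')))) s'"
    then have "fst s' ''a'' 0 \<noteq> i0" using i0 by auto
    then show "runs e n' bb (set_var ''a'' (NAdd (var ''a'') (NConst 1))) s' 1
        (\<lambda>s''. I1 s'' \<and> i0 - fst s'' ''a'' 0 < i0 - fst s' ''a'' 0)"
      using I by (intro runs_NAssign) (auto simp: I1_def unch_nupdate)
  qed
  then have "runs e n' bb ?w1 (nupdate ''a'' 0 0 s) (1 + i0 * (1 + 1))
    (\<lambda>s'. runs e n' bb (Seq (set_var ''N'' (NConst 1)) (Seq ?w2 ?fin)) s' (1 + ((1 + D * (1 + 1)) + (1 + (1 + (1 + 1))))) ?Q)"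
  proof (rule runs_mono)
    fix s' assume I: "I1 s' \<and> \<not> bval e (BNot (good_test tri u (FEnum (var ''a'')))) s'"
    then have "unch {''a'', ''N''} {} s s'" by (auto simp: I1_def unch_def)
    then have "I2 (nupdate ''N'' 0 1 s')"
      using I l D by (auto simp: I2_def intro!: unch_nupdate exI[of _ 0])
    then show "runs e n' bb (Seq (set_var ''N'' (NConst 1)) (Seq ?w2 ?fin)) s' (1 + ((1 + D * (1 + 1)) + (1 + (1 + (1 + 1))))) ?Q"
      by (intro runs_Seq[of _ _ _ "set_var ''N'' (NConst 1)"] runs_NAssign) (simp only: nval.simps w2)
  qed simp
  then have "runs e n' bb (find_modulus l tri u) s (1 + ((1 + i0 * (1 + 1)) + (1 + ((1 + D * (1 + 1)) + (1 + (1 + (1 + 1))))))) ?Q"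
    unfolding find_modulus_def by (intro runs_Seq[of _ _ _ "set_var ''a'' (NConst 0)"] runs_NAssign)
      (simp only: nval.simps, rule runs_Seq)
  then show ?thesis by (rule runs_mono) auto
qed

definition search_finite :: "nat \<Rightarrow> bool \<Rightarrow> nat \<Rightarrow> com" where
  "search_finite l tri u = Seq (set_var ''out'' (NConst 1)) (Seq (find_modulus l tri u) (Seq fill_coeffs
    (Seq (Query ''R'' ''G'' (var ''r'') ''P'')
      (For ''j'' (var ''r'') (Cond (FEq (FArr ''R'' (var ''j'')) FZero) Skip (set_var ''out'' (NConst 0)))))))"

text \<open>\<open>U\<close> stands for the univariate restriction. By the hypothesis on
  \<open>bb\<close> the answer is the same for all moduli of degree at least \<open>D\<close>, and
  as \<open>degree U < D\<close> the stored entries include all its coefficients.\<close>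

lemma runs_search_finite:
  fixes s :: "'a::field state"
  assumes fin: "finite (UNIV :: 'a set)"
    and c: "ctx n k d M s" and D: "D = M * (d + 1) ^ k" "D > 0" and s: "snd s = (\<lambda>_ _. 0)"
    and l: "l \<ge> 2" and i0: "good tri u (e i0)"
    and irr: "\<And>(a::'a) m. good tri u a \<Longrightarrow> irreducible (family tri (l ^ m) a)"
    and exp: "\<And>i j. i < n \<Longrightarrow> j < k \<Longrightarrow> exponent d M i j < D"
    and bb: "\<And>f P r. degree f = r \<Longrightarrow> D \<le> r \<Longrightarrow> (\<And>i. i < n \<Longrightarrow> array_poly P (i * r) r = hit k d M i) \<Longrightarrow>
      bb f (array_point P n r) = U"
    and U: "degree U < D"
  shows "runs e n bb (search_finite l tri u) s (1 + (8 + 2 * i0 + 2 * D + (3 + n * (6 + 4 * k) + ((n + 2) * (2 * l * D) + 1 + (2 + 2 * l * D * 4)))))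
    (\<lambda>s'. verdict s' = (if U = 0 then 1 else 0))" (is "runs _ _ _ _ _ _ ?Q")
proof -
  let ?test = "Cond (FEq (FArr ''R'' (var ''j'')) FZero) Skip (set_var ''out'' (NConst 0))"
  let ?loop = "For ''j'' (var ''r'') ?test"
  let ?query = "Query ''R'' ''G'' (var ''r'') ''P''"
  have loop: "runs e n bb ?loop s3 (2 + r * 4) ?Q"
    if r: "fst s3 ''r'' 0 = r" "D \<le> r" and R: "\<And>j. j < r \<Longrightarrow> snd s3 ''R'' j = coeff U j"
      and out: "fst s3 ''out'' 0 = 1" for s3 r
  proof -
    define Inv where "Inv = (\<lambda>j (s' :: 'a state). fst s' ''r'' 0 = r \<and> snd s' ''R'' = snd s3 ''R'' \<and> fst s' ''j'' 0 = j \<and>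
      fst s' ''out'' 0 = (if \<forall>i<j. coeff U i = 0 then 1 else 0))"
    have "runs e n bb ?loop s3 (2 + r * (1 + 1 + 2)) (Inv r)"
    proof (rule runs_For)
      show "Inv 0 (nupdate ''j'' 0 0 s3)" using r out by (simp add: Inv_def)
      show "fst s' ''j'' 0 = j \<and> nval (var ''r'') s' = r" if "Inv j s'" for j s' using that by (simp add: Inv_def)
      fix j s' assume j: "j < r" and I: "Inv j s'"
      show "runs e n bb ?test s' (1 + 1) (\<lambda>s''. fst s'' ''j'' 0 = j \<and> Inv (Suc j) (nupdate ''j'' 0 (Suc j) s''))"
      proof (rule runs_Cond)
        assume "bval e (FEq (FArr ''R'' (var ''j'')) FZero) s'"
        then have "coeff U j = 0" using I R[OF j] by (simp add: Inv_def)
        then show "runs e n bb Skip s' 1 (\<lambda>s''. fst s'' ''j'' 0 = j \<and> Inv (Suc j) (nupdate ''j'' 0 (Suc j) s''))"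
          using I by (intro runs_Skip) (auto simp: Inv_def less_Suc_eq)
      next
        assume "\<not> bval e (FEq (FArr ''R'' (var ''j'')) FZero) s'"
        then have "coeff U j \<noteq> 0" using I R[OF j] by (simp add: Inv_def)
        then show "runs e n bb (set_var ''out'' (NConst 0)) s' 1 (\<lambda>s''. fst s'' ''j'' 0 = j \<and> Inv (Suc j) (nupdate ''j'' 0 (Suc j) s''))"
          using I by (intro runs_NAssign) (auto simp: Inv_def less_Suc_eq)
      qed
    qed
    then show ?thesis
    proof (rule runs_mono)
      fix s' assume "Inv r s'"
      moreover have "(\<forall>i<r. coeff U i = 0) \<longleftrightarrow> U = 0"
      proof
        assume "\<forall>i<r. coeff U i = 0"
        then have "lead_coeff U = 0" using U r by simp
        then show "U = 0" by simp
      qed simp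
      ultimately show "?Q s'" by (simp add: Inv_def verdict_def)
    qed simp
  qed
  have last: "runs e n bb (Seq fill_coeffs (Seq ?query ?loop)) s1
      (3 + n * (6 + 4 * k) + ((n + 2) * (2 * l * D) + 1 + (2 + 2 * l * D * 4))) ?Q"
    if u: "unch {''a'', ''N'', ''r'', ''out''} {''G''} s s1" and out: "fst s1 ''out'' 0 = 1"
      and gx: "good tri u x" and m: "D \<le> l ^ m" "l ^ m \<le> l * D"
      and r: "fst s1 ''r'' 0 = (if tri then 2 else 1) * l ^ m"
      and G: "array_poly (snd s1 ''G'') 0 (fst s1 ''r'' 0 + 1) = family tri (l ^ m) x" for s1 x m
  proof -
    define r' where "r' = (if tri then 2 else 1) * l ^ m"
    have r': "D \<le> r'" "r' \<le> 2 * l * D" using m by (auto simp: r'_def)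
    have c1: "ctx n k d M s1" by (rule ctx_unch[OF c u]) auto
    have P1: "snd s1 ''P'' = (\<lambda>_. 0)" using unch_snd[OF u, of "''P''"] s by simp
    have deg: "degree (family tri (l ^ m) x) = r'" unfolding r'_def using l by (intro degree_family) simp
    have legal: "legal_modulus (family tri (l ^ m) x) r'"
      unfolding legal_modulus_def using irr[OF gx] deg fin by simp
    show ?thesis
    proof (rule runs_Seq, rule runs_mono[OF runs_fill_coeffs[OF c1 r P1] order.refl])
      fix s2 assume s2: "unch {''i'', ''q'', ''j'', ''base''} {''P''} s1 s2 \<and>
         snd s2 ''P'' = (\<lambda>y. \<Sum>i<n. \<Sum>j<k. if y = i * ((if tri then 2 else 1) * l ^ m) + exponent d M i j then 1 else 0)"
      then have P2: "array_poly (snd s2 ''P'') (i * r') r' = hit k d M i" if "i < n" for i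
      proof (intro array_poly_fill[where n = n and k = k and d = d and M = M])
        show "exponent d M i j < r'" if "i < n" "j < k" for i j using exp[OF that] r'(1) by simp
      qed (use s2 that in \<open>simp_all add: r'_def\<close>)
      note u2 = conjunct1[OF s2]
      have f2: "fst s2 ''r'' 0 = r'" "fst s2 ''out'' 0 = 1" "snd s2 ''G'' = snd s1 ''G''"
        using unch_fst[OF u2, of "''r''"] unch_fst[OF u2, of "''out''"] unch_snd[OF u2, of "''G''"] r out
        by (simp_all add: r'_def)
      have G2: "array_poly (snd s2 ''G'') 0 (nval (var ''r'') s2 + 1) = family tri (l ^ m) x"
        using G f2 r by (simp add: r'_def)
      have "runs e n bb ?query s2 ((n + 2) * nval (var ''r'') s2 + 1) (\<lambda>s3. runs e n bb ?loop s3 (2 + r' * 4) ?Q)"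
      proof (rule runs_Query, unfold G2)
        show "legal_modulus (family tri (l ^ m) x) (nval (var ''r'') s2)" using legal f2 by simp
        have "bb (family tri (l ^ m) x) (array_point (snd s2 ''P'') n r') = U"
          by (rule bb[OF deg r'(1) P2])
        then show "runs e n bb ?loop (store_answer ''R'' (nval (var ''r'') s2) (bb (family tri (l ^ m) x)
            (array_point (snd s2 ''P'') n (nval (var ''r'') s2))) s2) (2 + r' * 4) ?Q"
          using f2 r'(1) by (intro loop) simp_all
      qed
      then have "runs e n bb (Seq ?query ?loop) s2 ((n + 2) * nval (var ''r'') s2 + 1 + (2 + r' * 4)) ?Q"
        by (rule runs_Seq)
      then show "runs e n bb (Seq ?query ?loop) s2 ((n + 2) * (2 * l * D) + 1 + (2 + 2 * l * D * 4)) ?Q"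
      proof (rule runs_mono)
        show "(n + 2) * nval (var ''r'') s2 + 1 + (2 + r' * 4) \<le> (n + 2) * (2 * l * D) + 1 + (2 + 2 * l * D * 4)"
          using f2 r'(2) by (intro add_mono mult_le_mono) auto
      qed
    qed
  qed
  let ?s0 = "nupdate ''out'' 0 1 s"
  have u0: "unch {''out''} {} s ?s0" by (simp add: unch_nupdate unch_refl)
  have c0: "ctx n k d M ?s0" by (rule ctx_unch[OF c u0]) auto
  have G0: "snd ?s0 ''G'' = (\<lambda>_. 0)" using s by simp
  have "runs e n bb (find_modulus l tri u) ?s0 (8 + 2 * i0 + 2 * D)
    (\<lambda>s1. runs e n bb (Seq fill_coeffs (Seq ?query ?loop)) s1
      (3 + n * (6 + 4 * k) + ((n + 2) * (2 * l * D) + 1 + (2 + 2 * l * D * 4))) ?Q)"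
  proof (rule runs_mono[OF runs_find_modulus[where e = e and ?i0.0 = i0, OF c0 D G0 l i0] order.refl])
    fix s1 assume *: "unch {''a'', ''N'', ''r''} {''G''} ?s0 s1 \<and> (\<exists>m x. good tri u x \<and> D \<le> l ^ m \<and> l ^ m \<le> l * D \<and>
       fst s1 ''r'' 0 = (if tri then 2 else 1) * l ^ m \<and>
       array_poly (snd s1 ''G'') 0 (fst s1 ''r'' 0 + 1) = family tri (l ^ m) x)"
    then have "unch {''a'', ''N'', ''r'', ''out''} {''G''} s s1" using u0 by (auto simp: unch_def)
    moreover have "fst s1 ''out'' 0 = 1" using unch_fst[OF conjunct1[OF *], of "''out''"] by simp
    ultimately show "runs e n bb (Seq fill_coeffs (Seq ?query ?loop)) s1
      (3 + n * (6 + 4 * k) + ((n + 2) * (2 * l * D) + 1 + (2 + 2 * l * D * 4))) ?Q"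
      using * last by blast
  qed
  then have "runs e n bb (Seq (find_modulus l tri u) (Seq fill_coeffs (Seq ?query ?loop))) ?s0
    (8 + 2 * i0 + 2 * D + (3 + n * (6 + 4 * k) + ((n + 2) * (2 * l * D) + 1 + (2 + 2 * l * D * 4)))) ?Q"
    by (rule runs_Seq)
  then show ?thesis unfolding search_finite_def
    by (intro runs_Seq[of _ _ _ "set_var ''out'' (NConst 1)"] runs_NAssign) (simp only: nval.simps)
qed

section \<open>The identity test\<close>

lemma linear_mpolyI: "l = mconst c + (\<Sum>i<n. mconst (a i) * mvar i) \<Longrightarrow> linear_mpoly n l"
  unfolding linear_mpoly_def by (intro exI)

lemma linear_mpoly_0: "linear_mpoly n 0"
  by (rule linear_mpolyI[of _ 0 "\<lambda>_. 0"]) (simp add: mconst_def)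

lemma linear_mpoly_add:
  assumes "linear_mpoly n x" "linear_mpoly n y"
  shows "linear_mpoly n (x + y)"
proof -
  obtain c a where 1: "x = mconst c + (\<Sum>i<n. mconst (a i) * mvar i)"
    using assms(1)[unfolded linear_mpoly_def] by (elim exE) (rule that)
  obtain c' a' where 2: "y = mconst c' + (\<Sum>i<n. mconst (a' i) * mvar i)"
    using assms(2)[unfolded linear_mpoly_def] by (elim exE) (rule that)
  have "x + y = mconst (c + c') + (\<Sum>i<n. mconst (a i + a' i) * mvar i)"
    unfolding 1 2 by (simp add: mconst_def single_add sum.distrib distrib_right)
  then show ?thesis by (rule linear_mpolyI)
qed

lemma linear_mpoly_sum: "(\<And>i. i \<in> A \<Longrightarrow> linear_mpoly n (f i)) \<Longrightarrow> linear_mpoly n (\<Sum>i\<in>A. f i)"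
  by (induction A rule: infinite_finite_induct) (simp_all add: linear_mpoly_0 linear_mpoly_add)

lemma sps_computes_degree_1:
  assumes "sps_computes k 1 n p"
  shows "sps_computes 1 1 n p"
proof -
  obtain l where l: "\<forall>i<k. \<forall>j<1::nat. linear_mpoly n (l i j)" "p = (\<Sum>i<k. \<Prod>j<1::nat. l i j)"
    using assms unfolding sps_computes_def by blast
  have "p = (\<Sum>i<k. l i 0)" using l(2) by simp
  then have "linear_mpoly n p" using l(1) by (auto intro: linear_mpoly_sum)
  then show ?thesis unfolding sps_computes_def by (intro exI[of _ "\<lambda>_ _. p"]) simp
qed

lemma pcompose_const: "pcompose p [:x:] = [:poly p x:]"
  by (induction p) (simp_all add: pcompose_pCons mult.commute)

lemma const_mod_X: "[:y:] mod [:0, 1:] = [:y :: 'a::field:]"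
  by (rule mod_poly_less) simp

section \<open>Correctness of the searches\<close>

context circuit
begin

lemma msubst_cong:
  assumes "\<And>l. l < n \<Longrightarrow> a l = a' l"
  shows "msubst p a = msubst p a'"
  unfolding msubst_p using assms by simp

lemma msubst_const: "msubst p (\<lambda>l. [:poly (a l) x:]) = [:poly (msubst p a) x:]"
proof -
  have "[:poly (msubst p a) x:] = pcompose (msubst p a) [:x:]" by (simp add: pcompose_const)
  also have "\<dots> = msubst p (\<lambda>l. [:poly (a l) x:])"
    unfolding msubst_p pcompose_sum pcompose_prod pcompose_add pcompose_mult
    by (simp only: pcompose_const) simp
  finally show ?thesis by simp
qed

context
  fixes M D :: nat
  assumes k: "k \<ge> 1" and d: "d \<ge> 1" and M: "M = d * (n * k) + 1" and D: "D = M * (d + 1) ^ k"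
begin

text \<open>\<open>D\<close> is \<open>d + 1\<close> times the largest weight \<open>X\<close>
  occurring in \<open>hit\<close>, and \<open>d n k < M \<le> X\<close>. So \<open>D\<close> exceeds
  the exponent bound \<open>n k + X\<close>, which limits the table of powers, and \<open>d\<close>
  times that bound, which limits the degree of the restriction.\<close>

lemma top_exponent: "n * k + M * (d + 1) ^ (k - 1) < D" "d * (n * k + M * (d + 1) ^ (k - 1)) < D"
proof -
  define X where "X = M * (d + 1) ^ (k - 1)"
  have "(d + 1) ^ k = (d + 1) * (d + 1) ^ (k - 1)" using k by (cases k) auto
  then have DX: "D = d * X + X" by (simp add: D X_def algebra_simps)
  have "M \<le> X" by (simp add: X_def)
  then have X: "d * (n * k) < X" by (simp add: M)
  then show "d * (n * k + M * (d + 1) ^ (k - 1)) < D"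
    unfolding X_def[symmetric] DX by (simp add: distrib_left)
  have "n * k \<le> d * (n * k)" "X \<le> d * X" using d by auto
  then show "n * k + M * (d + 1) ^ (k - 1) < D" using X unfolding X_def[symmetric] DX by linarith
qed

lemma exponent_le:
  assumes "i < n" "j < k"
  shows "exponent d M i j \<le> n * k + M * (d + 1) ^ (k - 1)"
  unfolding exponent_def using assms
  by (intro add_mono mult_le_mono power_increasing) auto

lemma degree_hit_value: "degree (msubst p (hit k d M)) < D"
proof -
  have "degree (hit k d M l :: 'a poly) \<le> n * k + M * (d + 1) ^ (k - 1)" if "l < n" for l
    unfolding hit_def
    using exponent_le[OF that] by (intro degree_sum_le order.trans[OF degree_monom_le]) (auto simp: exponent_def)
  from degree_msubst_le[OF this] show ?thesis using top_exponent(2) by (rule le_less_trans)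
qed

lemma hit_value_eq_0_iff: "msubst p (hit k d M) = 0 \<longleftrightarrow> p = 0"
proof
  show "msubst p (hit k d M) = 0 \<Longrightarrow> p = 0" using msubst_hit_nonzero[of M] M by auto
qed (simp add: msubst_def)

text \<open>The \<open>D\<close> points are distinct and more numerous than the degree of the
  restriction, so a nonzero restriction cannot vanish at all of them.\<close>

lemma runs_infinite:
  fixes e :: "nat \<Rightarrow> 'a"
  assumes e: "inj e" and c: "ctx n k d M s" and s: "snd s = (\<lambda>_ _. 0)"
  shows "runs e n (blackbox_of p) search_infinite s
    (4 + D * (3 + 3 * D + (2 + n * (4 + 4 * k + 2) + ((n + 2) * 1 + 1 + 2)) + 2))
    (\<lambda>s'. verdict s' = (if p = 0 then 1 else 0))"
proof -
  let ?U = "msubst p (hit k d M) :: 'a poly"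
  have "runs e n (blackbox_of p) search_infinite s
    (4 + D * (3 + 3 * D + (2 + n * (4 + 4 * k + 2) + ((n + 2) * 1 + 1 + 2)) + 2))
    (\<lambda>s'. verdict s' = (if \<forall>t<D. poly ?U (e t) = 0 then 1 else 0))"
  proof (rule runs_search_infinite[OF c _ D])
    show "snd s ''G'' 0 = 0" using s by simp
    show "exponent d M i j \<le> D" if "i < n" "j < k" for i j
      using exponent_le[OF that] top_exponent(1) by linarith
    fix P t assume P: "\<And>i. i < n \<Longrightarrow> P i = (\<Sum>j<k. e t ^ exponent d M i j)"
    have "array_point P n 1 l = [:poly (hit k d M l) (e t):]" if "l < n" for l
    proof -
      have "array_point P n 1 l = [:P l:]" using that by (simp add: array_point_def array_poly_def monom_0)
      moreover have "poly (hit k d M l) (e t) = P l"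
        by (simp only: P[OF that] hit_def poly_sum poly_monom exponent_def mult_1)
      ultimately show ?thesis by simp
    qed
    then have "msubst p (array_point P n 1) = msubst p (\<lambda>l. [:poly (hit k d M l) (e t):])"
      by (rule msubst_cong)
    also have "\<dots> = [:poly ?U (e t):]" by (rule msubst_const)
    finally have "msubst p (array_point P n 1) = [:poly ?U (e t):]" .
    then show "blackbox_of p [:0, 1:] (array_point P n 1) = [:poly ?U (e t):]"
      by (simp add: blackbox_of_def const_mod_X)
  qed
  moreover have "(\<forall>t<D. poly ?U (e t) = 0) \<longleftrightarrow> p = 0"
  proof
    assume 0: "\<forall>t<D. poly ?U (e t) = 0"
    show "p = 0"
    proof (rule ccontr)
      assume "p \<noteq> 0"
      then have nz: "?U \<noteq> 0" by (simp add: hit_value_eq_0_iff)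
      have "e ` {..<D} \<subseteq> {x. poly ?U x = 0}" using 0 by auto
      from card_mono[OF poly_roots_finite[OF nz] this] have "D \<le> card {x. poly ?U x = 0}"
        using e by (simp add: card_image inj_on_subset)
      also have "\<dots> \<le> degree ?U" by (rule card_poly_roots_bound[OF nz])
      finally show False using degree_hit_value by simp
    qed
  next
    assume "p = 0"
    then show "\<forall>t<D. poly ?U (e t) = 0" using hit_value_eq_0_iff by simp
  qed
  ultimately show ?thesis by simp
qed

lemma runs_finite:
  fixes e :: "nat \<Rightarrow> 'a"
  assumes fin: "finite (UNIV :: 'a set)" and c: "ctx n k d M s" and s: "snd s = (\<lambda>_ _. 0)"
    and l: "l \<ge> 2" and i0: "good tri u (e i0)"
    and irr: "\<And>(a::'a) m. good tri u a \<Longrightarrow> irreducible (family tri (l ^ m) a)"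
  shows "runs e n (blackbox_of p) (search_finite l tri u) s
    (1 + (8 + 2 * i0 + 2 * D + (3 + n * (6 + 4 * k) + ((n + 2) * (2 * l * D) + 1 + (2 + 2 * l * D * 4)))))
    (\<lambda>s'. verdict s' = (if p = 0 then 1 else 0))"
  unfolding hit_value_eq_0_iff[symmetric]
proof (rule runs_search_finite[OF fin c D _ s l])
  show "D > 0" by (simp add: D M)
  show "exponent d M i j < D" if "i < n" "j < k" for i j
    using exponent_le[OF that] top_exponent(1) by linarith
  show "degree (msubst p (hit k d M)) < D" by (rule degree_hit_value)
  fix f :: "'a poly" and P :: "nat \<Rightarrow> 'a" and r
  assume f: "degree f = r" "D \<le> r" and P: "\<And>i. i < n \<Longrightarrow> array_poly P (i * r) r = hit k d M i"
  have "msubst p (array_point P n r) = msubst p (hit k d M)"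
    by (rule msubst_cong) (simp add: array_point_def P)
  \<comment> \<open>The restriction has smaller degree than the modulus, so reduction leaves it
    unchanged.\<close>
  then show "blackbox_of p f (array_point P n r) = msubst p (hit k d M)"
    using degree_hit_value f by (simp add: blackbox_of_def mod_poly_less)
qed (use i0 irr in auto)

end

end

section \<open>Estimates of the running time\<close>

lemma limit_bound:
  assumes "n \<ge> 1" "k \<ge> 1" "d \<ge> 1" and k': "k' = (if d = 1 then 1 else k)"
    and D: "D = (d * (n * k') + 1) * (d + 1) ^ k'"
  shows "real D \<le> 2 * (real n + real d powr (real k ^ 3 * log 2 (real d))) ^ 5"
proof -
  \<comment> \<open>For \<open>d = 1\<close>, \<open>X\<close> is 1 and
    \<open>D = 2 (n + 1)\<close>. For \<open>d \<ge> 2\<close>, the numbers \<open>d\<close>,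
    \<open>k\<close> and \<open>d ^ k\<close> are at most \<open>X\<close>; then
    \<open>(d + 1) ^ k \<le> X ^ 2\<close> and \<open>d n k + 1 \<le> 2 n X ^ 2\<close>, which gives
    \<open>2 n X ^ 4\<close> and hence the exponent 5.\<close>
  define X where "X = real d powr (real k ^ 3 * log 2 (real d))"
  have n: "real n \<ge> 1" using assms(1) by simp
  show ?thesis
  proof (cases "d = 1")
    case True
    then have "real D = 2 * (real n + X) ^ 1" by (simp add: D k' X_def)
    also have "\<dots> \<le> 2 * (real n + X) ^ 5"
    proof (intro mult_left_mono power_increasing)
      show "1 \<le> real n + X" unfolding X_def using n powr_ge_zero by (rule add_increasing2[rotated])
    qed auto
    finally show ?thesis by (simp add: X_def)
  next
    case False
    then have d: "real d \<ge> 2" using assms(3) by simp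
    have kk: "k' = k" using False k' by simp
    have "real k \<le> real k ^ 3 * log 2 (real d)"
    proof -
      have "real k * 1 \<le> real k ^ 3 * log 2 (real d)"
      proof (rule mult_mono)
        show "real k \<le> real k ^ 3" using assms(2) power_increasing[of 1 3 "real k"] by simp
        show "1 \<le> log 2 (real d)" using d by (simp add: le_log_iff)
      qed auto
      then show ?thesis by simp
    qed
    then have "real d powr real k \<le> X" unfolding X_def using d by (intro powr_mono) auto
    then have Xk: "real d ^ k \<le> X" using d by (simp add: powr_realpow)
    have "real d ^ 1 \<le> real d ^ k" using d assms(2) by (intro power_increasing) auto
    then have Xd: "real d \<le> X" unfolding power_one_right using Xk by linarith
    have "real k \<le> 2 ^ k" using of_nat_less_two_power[of k, where ?'a = real] by simp
    also have "\<dots> \<le> real d ^ k" using d by (intro power_mono) auto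
    finally have Xk': "real k \<le> X" using Xk by linarith
    have X1: "X \<ge> 1" using Xd d by simp
    have "real (d + 1) \<le> real d ^ 2"
    proof -
      have "2 * real d \<le> real d * real d" using d by (intro mult_right_mono) auto
      then show ?thesis using d unfolding power2_eq_square of_nat_add of_nat_1 by linarith
    qed
    then have "real (d + 1) ^ k \<le> (real d ^ 2) ^ k" by (intro power_mono) auto
    also have "\<dots> = (real d ^ k) ^ 2" by (simp add: power_mult[symmetric] mult.commute)
    also have "\<dots> \<le> X ^ 2" using Xk by (intro power_mono) auto
    finally have 1: "real (d + 1) ^ k \<le> X ^ 2" .
    have "real d * (real n * real k) + 1 \<le> X * (real n * X) + 1"
      using Xd Xk' X1 by (intro add_right_mono mult_mono) auto
    also have "\<dots> \<le> 2 * real n * X ^ 2"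
    proof -
      have "1 * 1 \<le> real n * X ^ 2" using n X1 by (intro mult_mono one_le_power) auto
      then show ?thesis by (simp add: power2_eq_square mult_ac)
    qed
    finally have 2: "real d * (real n * real k) + 1 \<le> 2 * real n * X ^ 2" .
    have "real D = (real d * (real n * real k) + 1) * real (d + 1) ^ k" by (simp add: D kk distrib_right)
    also have "\<dots> \<le> (2 * real n * X ^ 2) * X ^ 2"
      using 1 2 by (intro mult_mono) auto
    also have "\<dots> = 2 * (real n * X ^ 4)" by (simp add: power_add[symmetric] mult.assoc)
    also have "\<dots> \<le> 2 * ((real n + X) * (real n + X) ^ 4)"
      using n X1 by (intro mult_left_mono mult_mono power_mono) auto
    finally show ?thesis by (simp add: X_def power_Suc[symmetric])
  qed
qed

lemma time_bound:
  fixes D :: nat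
  assumes "n \<ge> 1" "k \<ge> 1" "d \<ge> 1" and D: "D = (d * (n * k) + 1) * (d + 1) ^ k"
  shows "n \<le> D" "k \<le> D" "d + 1 \<le> D" "D \<ge> 1"
proof -
  have "1 * 1 \<le> (d + 1) ^ k" by simp
  then have "d * (n * k) + 1 \<le> D" unfolding D using mult_le_mono2[of 1 "(d + 1) ^ k" "d * (n * k) + 1"] by simp
  moreover have "n \<le> d * (n * k)" "k \<le> d * (n * k)" "d \<le> d * (n * k)" using assms(1-3) by auto
  ultimately show "n \<le> D" "k \<le> D" "d + 1 \<le> D" "D \<ge> 1" by linarith+
qed

text \<open>With all parameters at most \<open>D\<close>, the worst term is \<open>n k D\<close>;
  \<open>l\<close> and \<open>i\<close> enter linearly and are kept in the constant.\<close>

lemma cubic_bound: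
  fixes D :: nat
  assumes "n \<le> D" "k \<le> D" "d + 1 \<le> D" "D \<ge> 1"
  shows "2 + (3 + 3 * k + (3 + 3 * d + (1 + (2 + k * (3 + 3 * (d + 1) + 2))))) \<le> 30 * D ^ 3"
    and "4 + D * (3 + 3 * D + (2 + n * (4 + 4 * k + 2) + ((n + 2) * 1 + 1 + 2)) + 2) \<le> 40 * D ^ 3"
    and "1 + (8 + 2 * i + 2 * D + (3 + n * (6 + 4 * k) + ((n + 2) * (2 * l * D) + 1 + (2 + 2 * l * D * 4))))
      \<le> (40 + 14 * l + 2 * i) * D ^ 3"
proof -
  have D2: "D \<le> D ^ 2" using assms(4) power_increasing[of 1 2 D] by simp
  have D3: "D ^ 2 \<le> D ^ 3" "1 \<le> D ^ 3" using assms(4) by (auto intro: power_increasing)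
  have nk: "n * k \<le> D ^ 2" "k * (d + 1) \<le> D ^ 2" "n * D \<le> D ^ 2"
    unfolding power2_eq_square by (intro mult_le_mono assms order.refl)+
  have nkD: "n * k * D \<le> D ^ 3"
    using mult_le_mono1[OF nk(1), of D] by (simp add: power2_eq_square power3_eq_cube)
  have Dn: "D * D = D ^ 2" by (simp add: power2_eq_square)
  show "2 + (3 + 3 * k + (3 + 3 * d + (1 + (2 + k * (3 + 3 * (d + 1) + 2))))) \<le> 30 * D ^ 3"
  proof -
    have "2 + (3 + 3 * k + (3 + 3 * d + (1 + (2 + k * (3 + 3 * (d + 1) + 2))))) = 11 + 8 * k + 3 * d + 3 * (k * (d + 1))"
      by (simp add: algebra_simps)
    then show ?thesis using assms nk D2 D3 by linarith
  qed
  show "4 + D * (3 + 3 * D + (2 + n * (4 + 4 * k + 2) + ((n + 2) * 1 + 1 + 2)) + 2) \<le> 40 * D ^ 3"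
  proof -
    have "4 + D * (3 + 3 * D + (2 + n * (4 + 4 * k + 2) + ((n + 2) * 1 + 1 + 2)) + 2)
        = 4 + 12 * D + 3 * (D * D) + 7 * (n * D) + 4 * (n * k * D)"
      by (simp add: algebra_simps)
    then show ?thesis using assms nk nkD D2 D3 Dn by linarith
  qed
  show "1 + (8 + 2 * i + 2 * D + (3 + n * (6 + 4 * k) + ((n + 2) * (2 * l * D) + 1 + (2 + 2 * l * D * 4))))
      \<le> (40 + 14 * l + 2 * i) * D ^ 3"
  proof -
    have 1: "1 + (8 + 2 * i + 2 * D + (3 + n * (6 + 4 * k) + ((n + 2) * (2 * l * D) + 1 + (2 + 2 * l * D * 4))))
        = 15 + 2 * D + 6 * n + 4 * (n * k) + 2 * i * 1 + l * (2 * (n * D) + 12 * D)"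
      by (simp add: algebra_simps)
    have "2 * (n * D) + 12 * D \<le> 14 * D ^ 3" using nk D2 D3 by linarith
    then have "l * (2 * (n * D) + 12 * D) \<le> l * (14 * D ^ 3)" by (rule mult_le_mono2)
    moreover have "2 * i * 1 \<le> 2 * i * D ^ 3" using D3(2) by (rule mult_le_mono2)
    moreover have "15 + 2 * D + 6 * n + 4 * (n * k) \<le> 40 * D ^ 3" using assms nk D2 D3 by linarith
    moreover have "(40 + 14 * l + 2 * i) * D ^ 3 = 40 * D ^ 3 + 2 * i * D ^ 3 + l * (14 * D ^ 3)" by (simp add: algebra_simps)
    ultimately show ?thesis unfolding 1 by linarith
  qed
qed

lemma prepared_run:
  fixes e :: "nat \<Rightarrow> 'a::field"
  assumes pos: "n \<ge> 1" "k \<ge> 1" "d \<ge> 1" and k': "k' = (if d = 1 then 1 else k)"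
    and M: "M = d * (n * k') + 1" and D: "D = M * (d + 1) ^ k'"
    and main: "\<And>s. ctx n k' d M s \<Longrightarrow> snd s = (\<lambda>_ _. 0) \<Longrightarrow> runs e n bb c s (K * D ^ 3) Q"
  shows "\<exists>t s'. exec e n bb (Seq prepare c) (initial_state n k d) t s' \<and> Q s' \<and>
    real t \<le> real (8 * (30 + K)) * (real n + real d powr (real k ^ 3 * log 2 (real d))) ^ 15"
proof -
  have "k' \<ge> 1" using pos k' by simp
  note b = time_bound[OF pos(1) this pos(3) D[unfolded M]]
  have "runs e n bb (Seq prepare c) (initial_state n k d) (30 * D ^ 3 + K * D ^ 3) Q"
  proof (rule runs_Seq, rule runs_mono[OF runs_prepare[of e n bb k d, folded k']])
    show "2 + (3 + 3 * k' + (3 + 3 * d + (1 + (2 + k' * (3 + 3 * (d + 1) + 2))))) \<le> 30 * D ^ 3"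
      by (rule cubic_bound(1)[OF b])
  qed (use main in \<open>simp add: M\<close>)
  then obtain t s' where t: "exec e n bb (Seq prepare c) (initial_state n k d) t s'" "t \<le> 30 * D ^ 3 + K * D ^ 3" "Q s'"
    unfolding runs_def by blast
  let ?Y = "real n + real d powr (real k ^ 3 * log 2 (real d))"
  have "real t \<le> real (30 + K) * real D ^ 3"
    using t(2) by (simp add: distrib_right flip: of_nat_power of_nat_mult of_nat_add)
  also have "\<dots> \<le> real (30 + K) * (2 * ?Y ^ 5) ^ 3"
    using limit_bound[OF pos k' D[unfolded M]] by (intro mult_left_mono power_mono) auto
  \<comment> \<open>The cubic time in \<open>D\<close> turns the bound \<open>2 * ?Y ^ 5\<close>
    into the factor 8 and the exponent 15.\<close>
  also have "\<dots> = real (8 * (30 + K)) * ?Y ^ 15" by (simp add: power_mult_distrib power_mult[symmetric])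
  finally show ?thesis using t by blast
qed

text \<open>For \<open>d = 1\<close> the circuit is rewritten with one summand, matching the
  \<open>k\<close> that \<open>prepare\<close> leaves behind; a search need only be verified for
  this adjusted fanin.\<close>

lemma identity_test:
  fixes p :: "'a::field mpoly"
  assumes pos: "n \<ge> 1" "k \<ge> 1" "d \<ge> 1" and p: "sps_computes k d n p"
    and main: "\<And>k' b c M D s. circuit n k' d b c p \<Longrightarrow> k' \<ge> 1 \<Longrightarrow> M = d * (n * k') + 1 \<Longrightarrow>
      D = M * (d + 1) ^ k' \<Longrightarrow> ctx n k' d M s \<Longrightarrow> snd s = (\<lambda>_ _. 0) \<Longrightarrow>
      runs e n (blackbox_of p) prog s (K * D ^ 3) (\<lambda>s. verdict s = (if p = 0 then 1 else 0))"
  shows "\<exists>t s. exec e n (blackbox_of p) (Seq prepare prog) (initial_state n k d) t s \<and>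
    verdict s = (if p = 0 then 1 else 0) \<and>
    real t \<le> real (8 * (30 + K)) * (real n + real d powr (real k ^ 3 * log 2 (real d))) ^ 15"
proof -
  define k' where "k' = (if d = 1 then 1 else k)"
  have "sps_computes k' d n p"
    using p sps_computes_degree_1[of k n p] by (cases "d = 1") (simp_all add: k'_def)
  then obtain b c where circ: "circuit n k' d b c p" by (rule sps_computes_circuit)
  have "k' \<ge> 1" using pos by (simp add: k'_def)
  then show ?thesis by (rule prepared_run[OF pos k'_def refl refl main[OF circ _ refl refl]])
qed

theorem theorem2:
  shows "\<exists>(prog :: com) (C :: nat) (c :: nat).
    \<forall>(e :: nat \<Rightarrow> 'a::field) (n :: nat) (k :: nat) (d :: nat) (p :: 'a mpoly).
      enumerates_field e \<and> n \<ge> 1 \<and> k \<ge> 1 \<and> d \<ge> 1 \<and> sps_computes k d n p \<longrightarrow>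
      (\<exists>t s. exec e n (blackbox_of p) prog (initial_state n k d) t s \<and>
             verdict s = (if p = 0 then 1 else 0) \<and>
             real t \<le> real C * (real n + real d powr (real k ^ 3 * log 2 (real d))) ^ c)"
proof (cases "finite (UNIV :: 'a set)")
  \<comment> \<open>The type fixes the field, so the program may depend on whether the field is
    finite.\<close>
  case False
  show ?thesis
  proof (rule exI[of _ "Seq prepare search_infinite"], rule exI[of _ "8 * (30 + 40)"], rule exI[of _ 15],
      intro allI impI, elim conjE, rule identity_test)
    fix e :: "nat \<Rightarrow> 'a" and n d k' M D :: nat and p :: "'a mpoly" and b c and s :: "'a state"
    assume e: "enumerates_field e" and pos: "1 \<le> n" "1 \<le> d" "1 \<le> k'" and circ: "circuit n k' d b c p"
      and M: "M = d * (n * k') + 1" and D: "D = M * (d + 1) ^ k'" and s: "ctx n k' d M s" "snd s = (\<lambda>_ _. 0)"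
    have "inj e" using e False by (simp add: enumerates_field_def)
    then show "runs e n (blackbox_of p) search_infinite s (40 * D ^ 3) (\<lambda>s. verdict s = (if p = 0 then 1 else 0))"
      using runs_mono[OF circuit.runs_infinite[OF circ pos(3,2) M D _ s]
          cubic_bound(2)[OF time_bound[OF pos(1,3,2) D[unfolded M]]]] by simp
  qed
next
  case True
  let ?q = "card (UNIV :: 'a set)"
  obtain tri l u where l: "l \<ge> 2" "\<exists>a::'a. good tri u a"
    "\<And>(a::'a) m. good tri u a \<Longrightarrow> irreducible (family tri (l ^ m) a)"
    using ex_irreducible_family[OF True] by metis
  \<comment> \<open>The search for \<open>a\<close> ends within \<open>?q\<close> rounds because the
    enumeration covers the field; \<open>?q\<close> is a constant of the field.\<close>
  let ?K = "40 + 14 * l + 2 * ?q"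
  show ?thesis
  proof (rule exI[of _ "Seq prepare (search_finite l tri u)"], rule exI[of _ "8 * (30 + ?K)"], rule exI[of _ 15],
      intro allI impI, elim conjE, rule identity_test)
    fix e :: "nat \<Rightarrow> 'a" and n d k' M D :: nat and p :: "'a mpoly" and b c and s :: "'a state"
    assume e: "enumerates_field e" and pos: "1 \<le> n" "1 \<le> d" "1 \<le> k'" and circ: "circuit n k' d b c p"
      and M: "M = d * (n * k') + 1" and D: "D = M * (d + 1) ^ k'" and s: "ctx n k' d M s" "snd s = (\<lambda>_ _. 0)"
    obtain a :: 'a where a: "good tri u a" using l(2) by blast
    have "bij_betw e {..<?q} UNIV" using e True by (simp add: enumerates_field_def)
    then have "a \<in> e ` {..<?q}" by (simp add: bij_betw_def)
    then obtain i where i: "i < ?q" "good tri u (e i)" using a by auto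
    have "(40 + 14 * l + 2 * i) * D ^ 3 \<le> ?K * D ^ 3" using i(1) by (intro mult_le_mono1) simp
    note le = order.trans[OF cubic_bound(3)[OF time_bound[OF pos(1,3,2) D[unfolded M]], of i l] this]
    show "runs e n (blackbox_of p) (search_finite l tri u) s (?K * D ^ 3) (\<lambda>s. verdict s = (if p = 0 then 1 else 0))"
      by (rule runs_mono[OF circuit.runs_finite[where e = e and ?i0.0 = i,
            OF circ pos(3,2) M D True s l(1) i(2) l(3)] le])
  qed
qed

end
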